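(* Let $k$ be an algebraically closed field of characteristic zero and let $B$ be an affine $k$-domain such that $B$ is a UFD and $\dim B=3$. Then the following are equivalent: (I) $B=k^{[3]}$. (II) $ML^{*}(B)=k$. (III) $ML(B)=k$ and $ML^{*}(B)\neq B$.
   Context: An affine $k$-domain is an integral domain that is a finitely generated (commutative, unital) $k$-algebra; $\dim$ means Krull dimension. For a ring $R$ and an $R$-algebra $A$, the notation $A=R^{[n]}$ means that $A$ is isomorphic, as an $R$-algebra, to a polynomial ring in $n$ variables over $R$. $LND(B)$ denotes the set of locally nilpotent $k$-derivations of $B$, i.e. $k$-derivations $D:B\to B$ such that for every $b\in B$ there is $m\ge 1$ with $D^m(b)=0$. The Makar-Limanov invariant is $ML(B):=\bigcap_{D\in LND(B)}\operatorname{Ker} D$. Let $LND^{*}(B):=\{D\in LND(B)\mid Ds=1 \text{ for some } s\in B\}$. The Makar-Limanov--Freudenburg invariant is $ML^{*}(B):=\bigcap_{D\in LND^{*}(B)}\operatorname{Ker} D$, with the convention $ML^{*}(B):=B$ if $LND^{*}(B)=\emptyset$. *)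

theory Defs
  imports
    "HOL-Computational_Algebra.Computational_Algebra"
    "HOL-Library.Poly_Mapping"
    "HOL-Library.Numeral_Type"
    "HOL-Library.Extended_Nat"
begin

section \<open>Algebras over a field\<close>

locale comm_algebra = vector_space scale
  for scale :: "'k::field \<Rightarrow> 'b::comm_ring_1 \<Rightarrow> 'b" +
  assumes scale_mult_left: "scale c (x * y) = scale c x * y"

text \<open>The image of the field \<open>k\<close> under the structure map, usually just written \<open>k\<close>.\<close>

definition scalars :: "('k::field \<Rightarrow> 'b::comm_ring_1 \<Rightarrow> 'b) \<Rightarrow> 'b set" where
  "scalars scale = range (\<lambda>c. scale c 1)"

definition subalgebra :: "('k::field \<Rightarrow> 'b::comm_ring_1 \<Rightarrow> 'b) \<Rightarrow> 'b set \<Rightarrow> bool" where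
  "subalgebra scale A \<longleftrightarrow>
     1 \<in> A \<and> (\<forall>x\<in>A. \<forall>y\<in>A. x + y \<in> A \<and> x * y \<in> A) \<and> (\<forall>c. \<forall>x\<in>A. scale c x \<in> A)"

definition finitely_generated_algebra :: "('k::field \<Rightarrow> 'b::comm_ring_1 \<Rightarrow> 'b) \<Rightarrow> bool" where
  "finitely_generated_algebra scale \<longleftrightarrow> (\<exists>S. finite S \<and> subalgebra scale hull S = UNIV)"

definition affine_domain :: "('k::field \<Rightarrow> 'b::idom \<Rightarrow> 'b) \<Rightarrow> bool" where
  "affine_domain scale \<longleftrightarrow> comm_algebra scale \<and> finitely_generated_algebra scale"

definition algebra_iso ::
  "('k::field \<Rightarrow> 'a::comm_ring_1 \<Rightarrow> 'a) \<Rightarrow> ('k \<Rightarrow> 'b::comm_ring_1 \<Rightarrow> 'b) \<Rightarrow> ('a \<Rightarrow> 'b) \<Rightarrow> bool" where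
  "algebra_iso scale1 scale2 f \<longleftrightarrow>
     Vector_Spaces.linear scale1 scale2 f \<and> f 1 = 1 \<and> (\<forall>x y. f (x * y) = f x * f y) \<and> bij f"


section \<open>Polynomial algebras\<close>

text \<open>
  The type \<open>('n \<Rightarrow>\<^sub>0 nat) \<Rightarrow>\<^sub>0 'k\<close> of finitely supported functions on the monoid of monomials,
  with the convolution product, is the polynomial ring over \<open>'k\<close> in the variables indexed by \<open>'n\<close>.
  The field is embedded as the polynomials supported on the monomial \<open>0\<close>.
\<close>

definition mpoly_scale ::
  "'k::field \<Rightarrow> (('n \<Rightarrow>\<^sub>0 nat) \<Rightarrow>\<^sub>0 'k) \<Rightarrow> (('n \<Rightarrow>\<^sub>0 nat) \<Rightarrow>\<^sub>0 'k)" where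
  "mpoly_scale c p = Poly_Mapping.single 0 c * p"

lemma comm_algebra_mpoly_scale: "comm_algebra mpoly_scale"
  by unfold_locales
    (simp_all add: mpoly_scale_def algebra_simps single_add mult_single flip: mult.assoc)

text \<open>\<open>B = k\<^sup>[\<^sup>n\<^sup>]\<close>, where \<open>n\<close> is the cardinality of the finite type \<open>'n\<close>.\<close>

definition polynomial_algebra ::
  "('k::field \<Rightarrow> 'b::comm_ring_1 \<Rightarrow> 'b) \<Rightarrow> 'n::finite itself \<Rightarrow> bool" where
  "polynomial_algebra scale _ \<longleftrightarrow>
     (\<exists>f :: (('n \<Rightarrow>\<^sub>0 nat) \<Rightarrow>\<^sub>0 'k) \<Rightarrow> 'b. algebra_iso mpoly_scale scale f)"


section \<open>Unique factorization domains and Krull dimension\<close>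

text \<open>
  The library class \<open>factorial_semiring\<close> also carries a chosen normalization of associates and a
  division operation; a plain UFD has neither. Factorizations are compared as multisets, up to
  associates.
\<close>

definition is_UFD :: "'b::idom itself \<Rightarrow> bool" where
  "is_UFD _ \<longleftrightarrow>
     (\<forall>x::'b. x \<noteq> 0 \<longrightarrow> \<not> x dvd 1 \<longrightarrow> (\<exists>F. (\<forall>p\<in>#F. irreducible p) \<and> prod_mset F = x)) \<and>
     (\<forall>F G :: 'b multiset. (\<forall>p\<in>#F. irreducible p) \<longrightarrow> (\<forall>q\<in>#G. irreducible q) \<longrightarrow>
        prod_mset F = prod_mset G \<longrightarrow> rel_mset (\<lambda>p q. p dvd q \<and> q dvd p) F G)"

definition ring_ideal :: "'b::comm_ring_1 set \<Rightarrow> bool" where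
  "ring_ideal I \<longleftrightarrow> 0 \<in> I \<and> (\<forall>x\<in>I. \<forall>y\<in>I. x + y \<in> I) \<and> (\<forall>r. \<forall>x\<in>I. r * x \<in> I)"

definition prime_ideal :: "'b::comm_ring_1 set \<Rightarrow> bool" where
  "prime_ideal P \<longleftrightarrow>
     ring_ideal P \<and> P \<noteq> UNIV \<and> (\<forall>x y. x * y \<in> P \<longrightarrow> x \<in> P \<or> y \<in> P)"

definition krull_dim :: "'b::comm_ring_1 itself \<Rightarrow> enat" where
  "krull_dim _ = Sup {enat n | n. \<exists>P :: nat \<Rightarrow> 'b set.
     (\<forall>i\<le>n. prime_ideal (P i)) \<and> (\<forall>i<n. P i \<subset> P (Suc i))}"


section \<open>Locally nilpotent derivations and the two invariants\<close>

definition derivation :: "('k::field \<Rightarrow> 'b::comm_ring_1 \<Rightarrow> 'b) \<Rightarrow> ('b \<Rightarrow> 'b) \<Rightarrow> bool" where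
  "derivation scale D \<longleftrightarrow>
     Vector_Spaces.linear scale scale D \<and> (\<forall>x y. D (x * y) = x * D y + D x * y)"

definition LND :: "('k::field \<Rightarrow> 'b::comm_ring_1 \<Rightarrow> 'b) \<Rightarrow> ('b \<Rightarrow> 'b) set" where
  "LND scale = {D. derivation scale D \<and> (\<forall>b. \<exists>m\<ge>1. (D ^^ m) b = 0)}"

definition LND_star :: "('k::field \<Rightarrow> 'b::comm_ring_1 \<Rightarrow> 'b) \<Rightarrow> ('b \<Rightarrow> 'b) set" where
  "LND_star scale = {D \<in> LND scale. \<exists>s. D s = 1}"

definition makar_limanov :: "('k::field \<Rightarrow> 'b::comm_ring_1 \<Rightarrow> 'b) \<Rightarrow> 'b set" where
  "makar_limanov scale = (\<Inter>D\<in>LND scale. {b. D b = 0})"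

text \<open>If \<open>LND_star scale\<close> is empty, the intersection is \<open>UNIV\<close>, which is the stated convention.\<close>

definition makar_limanov_star :: "('k::field \<Rightarrow> 'b::comm_ring_1 \<Rightarrow> 'b) \<Rightarrow> 'b set" where
  "makar_limanov_star scale = (\<Inter>D\<in>LND_star scale. {b. D b = 0})"

end

theory Submission
  imports "HOL-Algebra.Algebraic_Closure_Type" Defs
begin

text \<open>
  Only the implication from (III) to (I) is difficult. Write \<open>k\<close> also for the image of the field in \<open>B\<close>.
  A locally nilpotent derivation with \<open>D s = 1\<close> makes \<open>B = A[s]\<close> a polynomial ring over its kernel \<open>A\<close>
  (\<open>slice_decomposition\<close>), and \<open>A\<close> is factorially closed in the factorial ring \<open>B\<close>.

  First, \<open>A\<close> carries a nonzero locally nilpotent derivation \<open>\<delta>\<close>. Indeed, if some locally nilpotent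
  derivation of \<open>A[s]\<close> does not kill \<open>A\<close>, then its homogeneous part of highest degree in \<open>s\<close> kills \<open>s\<close> and
  restricts to a nonzero derivation of \<open>A\<close> (\<open>nonzero_lnd_of_coefficients\<close>). Otherwise \<open>A\<close> lies in the
  Makar-Limanov invariant, which is \<open>k\<close>, and \<open>B = k[s]\<close> has too small a dimension.

  Next, let \<open>C\<close> be the kernel of \<open>\<delta>\<close>. It is not \<open>k\<close>, since \<open>B\<close> would have two generators. Any two elements
  of \<open>C\<close> are algebraically dependent, since together with a local slice of \<open>\<delta>\<close> and \<open>s\<close> two independent
  elements would give a chain of five prime ideals in \<open>B\<close>. Take an irreducible element \<open>p\<close> of \<open>C\<close>. All elements
  of \<open>C\<close> are algebraic over \<open>k\<close> modulo \<open>p\<close>, hence constant, so one can divide by \<open>p\<close> after subtracting a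
  constant. The division ends, because \<open>p\<close> is moved by some locally nilpotent derivation of \<open>B\<close> and
  every division by \<open>p\<close> lowers the degree with respect to it. So \<open>C = k[p]\<close>.

  Finally, choose \<open>t\<close> in \<open>A\<close> such that \<open>\<delta> t\<close> is a nonzero polynomial in \<open>p\<close> of least degree. A local slice
  generates \<open>A\<close> over \<open>C\<close> after inverting \<open>\<delta> t\<close>, and minimality allows the denominators to be cancelled
  (\<open>kernel_polynomial_ring_imp_polynomial_ring\<close>). So \<open>A = k[p,t]\<close> and \<open>B = k[p,t,s]\<close>.

  Two facts about dimension enter. Algebras with two generators have no chain of four primes
  (\<open>two_generated_no_prime_chain\<close>), by a direct analysis of the primes of \<open>k[X,Y]\<close>. A finitely generated
  domain with a tower of \<open>n\<close> transcendental extensions inside it has a chain of \<open>n + 1\<close> primes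
  (\<open>prime_chain_exists\<close>), namely the kernels of successive specializations into an algebraically
  closed field.

  From (I) to (II): the partial derivatives have slices, and their common kernel consists of the constants.
  From (II) to (III): the invariants are nested, and \<open>B \<noteq> k\<close> for reasons of dimension.
\<close>

section \<open>Subrings and transcendental elements\<close>

text \<open>
  Kernels of derivations and subalgebras are represented as subsets of one ring type, so that
  towers of them can be formed and a derivation of a kernel needs no new type.
\<close>

definition is_subring :: "'a::comm_ring_1 set \<Rightarrow> bool" where
  "is_subring S \<longleftrightarrow>
     0 \<in> S \<and> 1 \<in> S \<and> (\<forall>x\<in>S. - x \<in> S) \<and> (\<forall>x\<in>S. \<forall>y\<in>S. x + y \<in> S \<and> x * y \<in> S)"

definition polys_over :: "'a::zero set \<Rightarrow> 'a poly set" where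
  "polys_over S = {q. \<forall>n. coeff q n \<in> S}"

definition hom_on :: "'a::comm_ring_1 set \<Rightarrow> ('a \<Rightarrow> 'c::comm_ring_1) \<Rightarrow> bool" where
  "hom_on S h \<longleftrightarrow>
     h 1 = 1 \<and> (\<forall>x\<in>S. \<forall>y\<in>S. h (x + y) = h x + h y \<and> h (x * y) = h x * h y)"

text \<open>
  Evaluation at \<open>x\<close> with the coefficients mapped by \<open>h\<close>. Nested, it evaluates an element of
  \<open>k[X][Y]\<close>, represented in the type of polynomials over polynomials, at a pair of elements.
\<close>

definition eval_at :: "('a::zero \<Rightarrow> 'c::comm_semiring_0) \<Rightarrow> 'c \<Rightarrow> 'a poly \<Rightarrow> 'c" where
  "eval_at h x q = poly (map_poly h q) x"

definition adjoin :: "'a::comm_semiring_0 set \<Rightarrow> 'a \<Rightarrow> 'a set" where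
  "adjoin S x = (\<lambda>q. poly q x) ` polys_over S"

definition transcendental_over :: "'a::comm_semiring_0 set \<Rightarrow> 'a \<Rightarrow> bool" where
  "transcendental_over S x \<longleftrightarrow> (\<forall>q\<in>polys_over S. poly q x = 0 \<longrightarrow> q = 0)"

lemma is_subringD:
  assumes "is_subring S"
  shows "0 \<in> S" "1 \<in> S" "x \<in> S \<Longrightarrow> - x \<in> S"
    "x \<in> S \<Longrightarrow> y \<in> S \<Longrightarrow> x + y \<in> S" "x \<in> S \<Longrightarrow> y \<in> S \<Longrightarrow> x * y \<in> S"
    "x \<in> S \<Longrightarrow> y \<in> S \<Longrightarrow> x - y \<in> S"
  using assms unfolding is_subring_def by (auto simp flip: add_uminus_conv_diff)

lemma is_subring_sum:
  assumes "is_subring S" "\<And>i. i \<in> I \<Longrightarrow> f i \<in> S"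
  shows "sum f I \<in> S"
  using assms(2) by (induction I rule: infinite_finite_induct) (auto simp: is_subringD[OF assms(1)])

lemma is_subring_power: "is_subring S \<Longrightarrow> x \<in> S \<Longrightarrow> x ^ n \<in> S"
  by (induction n) (auto simp: is_subringD)

lemma is_subring_of_nat: "is_subring S \<Longrightarrow> of_nat n \<in> S"
  by (induction n) (auto simp: is_subringD)

lemma is_subring_UNIV: "is_subring UNIV"
  by (simp add: is_subring_def)

lemma polys_overD: "q \<in> polys_over S \<Longrightarrow> coeff q n \<in> S"
  by (simp add: polys_over_def)

lemma polys_over_UNIV [simp]: "polys_over UNIV = UNIV"
  by (simp add: polys_over_def)

lemma polys_over_pCons [simp]:
  "0 \<in> S \<Longrightarrow> pCons a q \<in> polys_over S \<longleftrightarrow> a \<in> S \<and> q \<in> polys_over S"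
  unfolding polys_over_def mem_Collect_eq
  by (metis coeff_pCons_0 coeff_pCons_Suc not0_implies_Suc)

lemma polys_over_0 [simp]: "0 \<in> S \<Longrightarrow> 0 \<in> polys_over S"
  by (simp add: polys_over_def)

lemma polys_over_monom [simp]: "0 \<in> S \<Longrightarrow> a \<in> S \<Longrightarrow> monom a n \<in> polys_over S"
  by (simp add: polys_over_def)

lemma is_subring_polys_over:
  assumes "is_subring S"
  shows "is_subring (polys_over S)"
proof -
  have "(1 :: 'a poly) \<in> polys_over S"
    using assms by (auto simp: polys_over_def coeff_1 is_subringD)
  moreover have "p * q \<in> polys_over S" if "p \<in> polys_over S" "q \<in> polys_over S" for p q
    using that assms by (auto simp: polys_over_def coeff_mult intro!: is_subring_sum is_subringD)
  ultimately show ?thesis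
    using assms by (simp add: is_subring_def polys_over_def)
qed

lemma polys_over_smult:
  "is_subring S \<Longrightarrow> a \<in> S \<Longrightarrow> q \<in> polys_over S \<Longrightarrow> smult a q \<in> polys_over S"
  by (simp add: polys_over_def is_subringD)

lemma polys_over_pderiv:
  "is_subring S \<Longrightarrow> q \<in> polys_over S \<Longrightarrow> pderiv q \<in> polys_over S"
  using is_subring_of_nat[of S]
  by (auto simp: polys_over_def coeff_pderiv simp del: of_nat_Suc intro!: is_subringD)

lemma poly_mem_subring:
  assumes "is_subring S" "q \<in> polys_over S" "x \<in> S"
  shows "poly q x \<in> S"
  unfolding poly_altdef
  by (intro is_subring_sum is_subringD is_subring_power polys_overD assms)

lemma hom_onD:
  assumes "hom_on S h"
  shows "h 1 = 1" "x \<in> S \<Longrightarrow> y \<in> S \<Longrightarrow> h (x + y) = h x + h y"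
    "x \<in> S \<Longrightarrow> y \<in> S \<Longrightarrow> h (x * y) = h x * h y"
  using assms by (auto simp: hom_on_def)

lemma hom_on_0: "hom_on S h \<Longrightarrow> is_subring S \<Longrightarrow> h 0 = 0"
  using hom_onD(2)[of S h 0 0] by (simp add: is_subringD)

lemma hom_on_minus: "hom_on S h \<Longrightarrow> is_subring S \<Longrightarrow> x \<in> S \<Longrightarrow> h (- x) = - h x"
  using hom_onD(2)[of S h x "- x"] hom_on_0[of S h]
  by (simp add: is_subringD eq_neg_iff_add_eq_0 add.commute)

lemma hom_on_diff:
  "hom_on S h \<Longrightarrow> is_subring S \<Longrightarrow> x \<in> S \<Longrightarrow> y \<in> S \<Longrightarrow> h (x - y) = h x - h y"
  using hom_onD(2)[of S h x "- y"] hom_on_minus[of S h y] by (simp add: is_subringD)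

lemma hom_on_sum:
  assumes "hom_on S h" "is_subring S" "\<And>i. i \<in> I \<Longrightarrow> f i \<in> S"
  shows "h (sum f I) = (\<Sum>i\<in>I. h (f i))"
  using assms(3)
proof (induction I rule: infinite_finite_induct)
  case (insert i I)
  then show ?case
    using hom_onD(2)[OF assms(1)] is_subring_sum[OF assms(2), of I f] by simp
qed (simp_all add: hom_on_0[OF assms(1,2)])

lemma hom_on_power:
  "hom_on S h \<Longrightarrow> is_subring S \<Longrightarrow> x \<in> S \<Longrightarrow> h (x ^ n) = h x ^ n"
  by (induction n) (simp_all add: hom_onD is_subring_power)

lemma hom_on_comp:
  "hom_on S h \<Longrightarrow> hom_on T g \<Longrightarrow> h ` S \<subseteq> T \<Longrightarrow> hom_on S (g \<circ> h)"
  by (auto simp: hom_on_def image_subset_iff)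

lemma hom_on_image_subring:
  assumes h: "hom_on S h" and S: "is_subring S"
  shows "is_subring (h ` S)"
  unfolding is_subring_def
proof (intro conjI ballI)
  show "0 \<in> h ` S" "1 \<in> h ` S"
    using imageI[OF is_subringD(1)[OF S], of h] imageI[OF is_subringD(2)[OF S], of h]
    by (simp_all add: hom_on_0[OF h S] hom_onD(1)[OF h])
next
  fix x assume "x \<in> h ` S"
  then obtain a where a: "a \<in> S" "x = h a" by blast
  show "- x \<in> h ` S"
    unfolding a(2) hom_on_minus[OF h S a(1), symmetric] using is_subringD(3)[OF S a(1)] by blast
next
  fix x y assume "x \<in> h ` S" "y \<in> h ` S"
  then obtain a b where ab: "a \<in> S" "b \<in> S" "x = h a" "y = h b" by blast
  show "x + y \<in> h ` S" "x * y \<in> h ` S"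
    unfolding ab hom_onD(2)[OF h ab(1,2), symmetric] hom_onD(3)[OF h ab(1,2), symmetric]
    using ab is_subringD(4,5)[OF S] by blast+
qed

lemma hom_on_map_poly:
  assumes h: "hom_on S h" and S: "is_subring S"
  shows "hom_on (polys_over S) (map_poly h)"
proof -
  have h0: "h 0 = 0" by (rule hom_on_0[OF h S])
  have "map_poly h (p * q) = map_poly h p * map_poly h q"
    if p: "p \<in> polys_over S" and q: "q \<in> polys_over S" for p q
  proof (rule poly_eqI)
    fix n
    have "coeff (map_poly h (p * q)) n = (\<Sum>i\<le>n. h (coeff p i * coeff q (n - i)))"
      using p q S
      by (simp add: coeff_map_poly[of h, OF h0] coeff_mult is_subringD polys_overD
          hom_on_sum[OF h S, of "{..n}" "\<lambda>i. coeff p i * coeff q (n - i)"])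
    also have "\<dots> = coeff (map_poly h p * map_poly h q) n"
      using p q by (simp add: coeff_mult coeff_map_poly[of h, OF h0] hom_onD(3)[OF h] polys_overD)
    finally show "coeff (map_poly h (p * q)) n = coeff (map_poly h p * map_poly h q) n" .
  qed
  moreover have "map_poly h (p + q) = map_poly h p + map_poly h q"
    if p: "p \<in> polys_over S" and q: "q \<in> polys_over S" for p q
    using that
    by (intro poly_eqI) (simp add: coeff_map_poly[of h, OF h0] hom_onD(2)[OF h] polys_overD)
  moreover have "map_poly h 1 = 1"
    by (rule map_poly_1') (rule hom_onD(1)[OF h])
  ultimately show ?thesis by (auto simp: hom_on_def)
qed

lemma hom_on_eval_at:
  assumes "hom_on S h" "is_subring S"
  shows "hom_on (polys_over S) (eval_at h x)"
  using hom_on_map_poly[OF assms] by (simp add: hom_on_def eval_at_def)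

lemma eval_at_pCons [simp]: "h 0 = 0 \<Longrightarrow> eval_at h x (pCons a q) = h a + x * eval_at h x q"
  by (simp add: eval_at_def map_poly_pCons)

lemma eval_at_0 [simp]: "eval_at h x 0 = 0"
  by (simp add: eval_at_def)

lemma eval_at_id [simp]: "eval_at (\<lambda>a. a) x q = poly q x"
  by (simp add: eval_at_def map_poly_id')

lemma hom_on_poly: "hom_on (polys_over S) (\<lambda>q. poly q x)"
  by (simp add: hom_on_def)

lemma is_subring_adjoin: "is_subring S \<Longrightarrow> is_subring (adjoin S x)"
  unfolding adjoin_def
  by (rule hom_on_image_subring[OF hom_on_poly is_subring_polys_over])

lemma subset_adjoin: "is_subring S \<Longrightarrow> S \<subseteq> adjoin S x"
proof
  fix a assume "is_subring S" "a \<in> S"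
  then have "[:a:] \<in> polys_over S" by (simp add: is_subringD)
  then show "a \<in> adjoin S x"
    unfolding adjoin_def by (rule rev_image_eqI) simp
qed

lemma mem_adjoin: "is_subring S \<Longrightarrow> x \<in> adjoin S x"
proof -
  assume "is_subring S"
  then have "[:0, 1:] \<in> polys_over S" by (simp add: is_subringD)
  then show "x \<in> adjoin S x"
    unfolding adjoin_def by (rule rev_image_eqI) simp
qed

lemma adjoin_least: "is_subring T \<Longrightarrow> S \<subseteq> T \<Longrightarrow> x \<in> T \<Longrightarrow> adjoin S x \<subseteq> T"
  unfolding adjoin_def using poly_mem_subring[of T _ x] by (auto simp: polys_over_def subset_iff)

lemma transcendental_overD:
  "transcendental_over S x \<Longrightarrow> q \<in> polys_over S \<Longrightarrow> poly q x = 0 \<Longrightarrow> q = 0"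
  by (simp add: transcendental_over_def)

lemma transcendental_over_inj:
  assumes "transcendental_over S x" "is_subring S"
    "p \<in> polys_over S" "q \<in> polys_over S" "poly p x = poly q x"
  shows "p = q"
  using transcendental_overD[OF assms(1), of "p - q"] assms(3-5)
    is_subringD(6)[OF is_subring_polys_over[OF assms(2)]] by simp

lemma transcendental_over_mono:
  "transcendental_over T x \<Longrightarrow> S \<subseteq> T \<Longrightarrow> transcendental_over S x"
  unfolding transcendental_over_def polys_over_def by blast

text \<open>
  Division with remainder that stays over \<open>S\<close>: the dividend is multiplied by powers of the leading
  coefficient of the divisor instead of dividing by it.
\<close>

lemma pseudo_division:
  fixes f g :: "'a::idom poly"
  assumes S: "is_subring S" and g: "g \<in> polys_over S" "g \<noteq> 0" and f: "f \<in> polys_over S"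
  obtains N q r where "q \<in> polys_over S" "r \<in> polys_over S"
    "smult (lead_coeff g ^ N) f = g * q + r" "r = 0 \<or> degree r < degree g"
proof -
  note P = is_subring_polys_over[OF S]
  have "\<exists>N q r. q \<in> polys_over S \<and> r \<in> polys_over S \<and>
    smult (lead_coeff g ^ N) f = g * q + r \<and> (r = 0 \<or> degree r < degree g)"
    using f
  proof (induction "degree f" arbitrary: f rule: less_induct)
    case (less f)
    show ?case
    proof (cases "f = 0 \<or> degree f < degree g")
      case True
      with less.prems P show ?thesis
        by (intro exI[of _ 0] exI[of _ "0::'a poly"] exI[of _ f]) (simp add: is_subringD)
    next
      case False
      define m where "m = monom (lead_coeff f) (degree f - degree g)"
      define f' where "f' = smult (lead_coeff g) f - g * m"
      have m: "m \<in> polys_over S"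
        unfolding m_def using less.prems S by (simp add: is_subringD polys_overD)
      have f': "f' \<in> polys_over S"
        unfolding f'_def using less.prems g m
        by (intro is_subringD[OF P] polys_over_smult[OF S]) (auto intro: polys_overD)
      have deg: "f' = 0 \<or> degree f' < degree f"
      proof (cases "degree f = 0")
        case True
        then have "degree g = 0" using False by simp
        then have "f' = 0" unfolding f'_def m_def
          using True by (auto elim!: degree_eq_zeroE simp: monom_0)
        then show ?thesis ..
      next
        case df: False
        have "degree f' \<le> degree f"
          unfolding f'_def m_def
          using False degree_mult_le[of g "monom (lead_coeff f) (degree f - degree g)"]
          by (intro degree_diff_le degree_smult_le order_trans[OF degree_mult_le])
            (auto intro: order_trans[OF add_left_mono[OF degree_monom_le]])
        moreover have "coeff f' (degree f) = 0"
        proof -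
          have "coeff (g * m) (degree g + (degree f - degree g)) = lead_coeff g * lead_coeff f"
            unfolding m_def mult.commute[of g] by (simp only: coeff_monom_mult) (simp add: False mult.commute)
          then show ?thesis using False by (simp add: f'_def)
        qed
        ultimately show ?thesis using df
          by (metis eq_zero_or_degree_less)
      qed
      obtain N q r where IH: "q \<in> polys_over S" "r \<in> polys_over S"
        "smult (lead_coeff g ^ N) f' = g * q + r" "r = 0 \<or> degree r < degree g"
      proof (cases "f' = 0")
        case True
        then show thesis using that[of 0 0 0] S by (simp add: is_subringD)
      next
        case False
        then show thesis using less.hyps[of f'] deg f' that by blast
      qed
      have "smult (lead_coeff g ^ Suc N) f = g * (q + smult (lead_coeff g ^ N) m) + r"
        using IH(3) by (simp add: f'_def algebra_simps smult_diff_right)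
      moreover have "q + smult (lead_coeff g ^ N) m \<in> polys_over S"
        using IH(1) m g
        by (intro is_subringD[OF P] polys_over_smult[OF S] is_subring_power[OF S])
          (auto intro: polys_overD)
      ultimately show ?thesis using IH by blast
    qed
  qed
  then show thesis using that by blast
qed

section \<open>Locally nilpotent derivations and their degree\<close>

text \<open>
  A locally nilpotent derivation of a subring \<open>A\<close>; the values of \<open>D\<close> outside \<open>A\<close> are arbitrary. The
  assumption \<open>rational\<close> says that \<open>A\<close> contains the rational numbers. It excludes positive
  characteristic, where binomial coefficients could vanish, and permits integration of polynomials.
\<close>

locale lnd_subring =
  fixes A :: "'a::idom set" and D :: "'a \<Rightarrow> 'a"
  assumes subring: "is_subring A"
    and rational: "\<And>n. n > 0 \<Longrightarrow> \<exists>u\<in>A. of_nat n * u = 1"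
    and closed: "a \<in> A \<Longrightarrow> D a \<in> A"
    and additive: "a \<in> A \<Longrightarrow> b \<in> A \<Longrightarrow> D (a + b) = D a + D b"
    and leibniz: "a \<in> A \<Longrightarrow> b \<in> A \<Longrightarrow> D (a * b) = a * D b + D a * b"
    and nilpotent: "a \<in> A \<Longrightarrow> \<exists>n. (D ^^ n) a = 0"
begin

definition ker :: "'a set" where
  "ker = {a \<in> A. D a = 0}"

text \<open>
  The zero element gets degree 0 as well, so that degree 0 characterizes the kernel.
\<close>

definition deg :: "'a \<Rightarrow> nat" where
  "deg a = (LEAST n. (D ^^ Suc n) a = 0)"

lemmas A_closed = is_subringD[OF subring]

lemma of_nat_nonzero: "n > 0 \<Longrightarrow> of_nat n \<noteq> (0 :: 'a)"
  using rational[of n] by auto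

lemma D_0 [simp]: "D 0 = 0"
  using additive[OF A_closed(1) A_closed(1)] by (simp only: add_0_left add_cancel_right_right)

lemma D_1 [simp]: "D 1 = 0"
  using leibniz[OF A_closed(2) A_closed(2)]
  by (simp only: mult_1_left mult_1_right add_cancel_right_right)

lemma D_minus: "a \<in> A \<Longrightarrow> D (- a) = - D a"
  using additive[of a "- a"] A_closed(3)[of a] by (simp add: eq_neg_iff_add_eq_0 add.commute)

lemma D_diff: "a \<in> A \<Longrightarrow> b \<in> A \<Longrightarrow> D (a - b) = D a - D b"
  using additive[of a "- b"] D_minus[of b] A_closed(3)[of b] by simp

lemma D_of_nat [simp]: "D (of_nat n) = 0"
  by (induction n) (simp_all add: additive A_closed is_subring_of_nat[OF subring])

lemma iter_closed: "a \<in> A \<Longrightarrow> (D ^^ n) a \<in> A"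
  by (induction n) (simp_all add: closed)

lemma iter_0 [simp]: "(D ^^ n) 0 = 0"
  by (induction n) simp_all

lemma iter_add: "a \<in> A \<Longrightarrow> b \<in> A \<Longrightarrow> (D ^^ n) (a + b) = (D ^^ n) a + (D ^^ n) b"
  by (induction n) (simp_all add: additive iter_closed)

lemma iter_zero_mono: "(D ^^ m) a = 0 \<Longrightarrow> m \<le> n \<Longrightarrow> (D ^^ n) a = 0"
  by (metis iter_0 funpow_add comp_apply le_add_diff_inverse2)

lemma iter_ker_mult: "c \<in> A \<Longrightarrow> D c = 0 \<Longrightarrow> b \<in> A \<Longrightarrow> (D ^^ n) (c * b) = c * (D ^^ n) b"
  by (induction n) (simp_all add: leibniz iter_closed)

text \<open>
  In the product rule for the iterates only one term survives at the sum of the two degrees, and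
  in characteristic zero its binomial coefficient is not zero. This makes the degree additive.
\<close>

lemma iter_mult_top:
  assumes "a \<in> A" "b \<in> A" "(D ^^ Suc n) a = 0" "(D ^^ Suc m) b = 0"
  shows "(D ^^ (n + m)) (a * b) = of_nat ((n + m) choose n) * ((D ^^ n) a * (D ^^ m) b)"
  using assms
proof (induction "n + m" arbitrary: a b n m rule: less_induct)
  case less
  consider "n = 0" | "m = 0" | n' m' where "n = Suc n'" "m = Suc m'"
    using not0_implies_Suc by blast
  then show ?case
  proof cases
    case 1
    then show ?thesis using less.prems by (simp add: iter_ker_mult)
  next
    case 2
    then show ?thesis using less.prems iter_ker_mult[of b a n] by (simp add: mult.commute)
  next
    case 3
    have Da: "(D ^^ n') (D a) = (D ^^ n) a" "(D ^^ Suc n') (D a) = 0"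
      using less.prems(3) by (simp_all add: 3 funpow_swap1)
    have Db: "(D ^^ m') (D b) = (D ^^ m) b" "(D ^^ Suc m') (D b) = 0"
      using less.prems(4) by (simp_all add: 3 funpow_swap1)
    have "(D ^^ (n + m)) (a * b) = (D ^^ (n + m')) (a * D b + D a * b)"
      using less.prems by (simp add: 3 leibniz funpow_swap1)
    also have "\<dots> = (D ^^ (n + m')) (a * D b) + (D ^^ (n' + m)) (D a * b)"
      using less.prems by (subst iter_add) (simp_all add: A_closed closed 3)
    also have "(D ^^ (n + m')) (a * D b) = of_nat ((n + m') choose n) * ((D ^^ n) a * (D ^^ m) b)"
      using less.hyps[of n m' a "D b"] less.prems Db 3 by (simp add: closed)
    also have "(D ^^ (n' + m)) (D a * b) = of_nat ((n' + m) choose n') * ((D ^^ n) a * (D ^^ m) b)"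
      using less.hyps[of n' m "D a" b] less.prems Da 3 by (simp add: closed)
    also have "of_nat ((n + m') choose n) * ((D ^^ n) a * (D ^^ m) b) +
        of_nat ((n' + m) choose n') * ((D ^^ n) a * (D ^^ m) b) =
        of_nat ((n + m) choose n) * ((D ^^ n) a * (D ^^ m) b)"
      by (simp add: 3 algebra_simps)
    finally show ?thesis .
  qed
qed

lemma iter_deg: "a \<in> A \<Longrightarrow> (D ^^ Suc (deg a)) a = 0"
proof -
  assume "a \<in> A"
  then obtain n where "(D ^^ n) a = 0" using nilpotent by blast
  then have "(D ^^ Suc n) a = 0" by simp
  then show ?thesis unfolding deg_def by (rule LeastI)
qed

lemma iter_deg_nonzero: "a \<in> A \<Longrightarrow> a \<noteq> 0 \<Longrightarrow> (D ^^ deg a) a \<noteq> 0"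
proof (cases "deg a")
  case (Suc n)
  then show ?thesis
    using not_less_Least[of n "\<lambda>n. (D ^^ Suc n) a = 0"] unfolding deg_def by simp
qed simp

lemma deg_eqI:
  assumes "(D ^^ n) a \<noteq> 0" "(D ^^ Suc n) a = 0"
  shows "deg a = n"
  unfolding deg_def
proof (rule Least_equality)
  fix m assume "(D ^^ Suc m) a = 0"
  then show "n \<le> m" using iter_zero_mono[of "Suc m" a n] assms(1) by (meson not_less_eq_eq)
qed (rule assms(2))

lemma deg_mult:
  assumes a: "a \<in> A" "a \<noteq> 0" and b: "b \<in> A" "b \<noteq> 0"
  shows "deg (a * b) = deg a + deg b"
proof (rule deg_eqI)
  have "((deg a + deg b) choose deg a) > 0" by simp
  then show "(D ^^ (deg a + deg b)) (a * b) \<noteq> 0"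
    using iter_mult_top[OF a(1) b(1) iter_deg[OF a(1)] iter_deg[OF b(1)]]
      iter_deg_nonzero[OF a] iter_deg_nonzero[OF b] of_nat_nonzero by simp
  show "(D ^^ Suc (deg a + deg b)) (a * b) = 0"
    using iter_mult_top[OF a(1) b(1), of "Suc (deg a)" "deg b"] iter_deg[OF a(1)] iter_deg[OF b(1)]
    by simp
qed

lemma deg_eq_0_iff: "a \<in> A \<Longrightarrow> deg a = 0 \<longleftrightarrow> D a = 0"
proof
  assume "a \<in> A" "deg a = 0"
  then show "D a = 0" using iter_deg[of a] by simp
next
  assume "D a = 0"
  then show "deg a = 0" unfolding deg_def by (intro Least_equality) simp_all
qed

lemma deg_diff_ker:
  assumes "a \<in> A" "c \<in> A" "D c = 0"
  shows "deg (a - c) = deg a"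
proof -
  have "(D ^^ Suc n) (a - c) = (D ^^ Suc n) a" for n
    using assms by (simp add: funpow_swap1 D_diff)
  then show ?thesis unfolding deg_def by metis
qed

lemma ker_subset: "ker \<subseteq> A"
  by (auto simp: ker_def)

lemma is_subring_ker: "is_subring ker"
  by (auto simp: is_subring_def ker_def A_closed D_minus additive leibniz)

lemma rational_ker:
  assumes "n > 0"
  shows "\<exists>u\<in>ker. of_nat n * u = 1"
proof -
  obtain u where u: "u \<in> A" "of_nat n * u = 1" using rational[OF assms] by blast
  have "of_nat n * D u = D (of_nat n * u)"
    using leibniz[of "of_nat n" u] u(1) is_subring_of_nat[OF subring] by simp
  then have "D u = 0" using of_nat_nonzero[OF assms] by (simp add: u(2))
  then show ?thesis using u by (auto simp: ker_def)
qed

text \<open>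
  Degrees add, so both factors of a nonzero element of degree zero have degree zero: the kernel is
  factorially closed.
\<close>

lemma ker_factor:
  assumes "a \<in> A" "b \<in> A" "a * b \<noteq> 0" "D (a * b) = 0"
  shows "D a = 0"
proof -
  have "a \<noteq> 0" "b \<noteq> 0" using assms(3) by auto
  then have "deg a + deg b = 0"
    using deg_mult[of a b] deg_eq_0_iff[of "a * b"] assms A_closed(5) by simp
  then show ?thesis using deg_eq_0_iff[of a] assms(1) by simp
qed

text \<open>
  \<open>D\<close> lowers the degree of \<open>a\<close>, but a nonzero multiple of \<open>a\<close> has at least the degree of \<open>a\<close>.
\<close>

lemma D_eq_0_if_dvd:
  assumes "a \<in> A" "u \<in> A" "D a = a * u"
  shows "D a = 0"
proof (rule ccontr)
  assume nz: "D a \<noteq> 0"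
  then have "a \<noteq> 0" "u \<noteq> 0" using assms(3) by auto
  then have "deg (D a) = deg a + deg u" using deg_mult[OF assms(1) _ assms(2)] assms(3) by simp
  moreover have "(D ^^ deg a) (D a) = 0"
    using iter_deg[OF assms(1)] by (simp add: funpow_swap1)
  ultimately show False
    using iter_deg_nonzero[OF closed[OF assms(1)] nz] iter_zero_mono[of "deg a" "D a"] by simp
qed

text \<open>
  The last but one nonzero iterate of \<open>D\<close> on \<open>a\<close> has degree one.
\<close>

lemma local_slice_exists:
  assumes "a \<in> A" "D a \<noteq> 0"
  obtains t where "t \<in> A" "D t \<noteq> 0" "D (D t) = 0"
proof -
  obtain n where n: "deg a = Suc n"
    using deg_eq_0_iff[OF assms(1)] assms(2) not0_implies_Suc by blast
  have "a \<noteq> 0" using assms(2) by auto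
  then show thesis
    using that[of "(D ^^ n) a"] iter_deg[OF assms(1)] iter_deg_nonzero[OF assms(1)] iter_closed[OF assms(1)]
    by (simp add: n)
qed

lemma polys_over_ker_mono: "q \<in> polys_over ker \<Longrightarrow> q \<in> polys_over A"
  using ker_subset by (auto simp: polys_over_def)

lemma D_poly:
  assumes "q \<in> polys_over ker" "t \<in> A"
  shows "D (poly q t) = poly (pderiv q) t * D t"
  using assms(1)
proof (induction q)
  case (pCons a q)
  have a: "a \<in> ker" and q: "q \<in> polys_over ker"
    using pCons.prems is_subringD(1)[OF is_subring_ker] by simp_all
  have "poly q t \<in> A"
    by (rule poly_mem_subring[OF subring polys_over_ker_mono[OF q] assms(2)])
  then show ?case
    using pCons.IH[OF q] a assms(2)
    by (simp add: ker_def additive leibniz A_closed pderiv_pCons algebra_simps)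
qed simp

text \<open>
  Applying \<open>D\<close> to a relation \<open>q(t) = 0\<close> over the kernel gives \<open>q'(t) D t = 0\<close>, a relation of smaller
  degree.
\<close>

lemma transcendental_over_ker:
  assumes "t \<in> A" "D t \<noteq> 0"
  shows "transcendental_over ker t"
  unfolding transcendental_over_def
proof (intro ballI impI)
  fix q assume "q \<in> polys_over ker" "poly q t = 0"
  then show "q = 0"
  proof (induction "degree q" arbitrary: q rule: less_induct)
    case less
    have "poly (pderiv q) t = 0"
      using D_poly[OF less.prems(1) assms(1)] less.prems(2) assms(2) by simp
    moreover have "degree (pderiv q) < degree q" if "degree q > 0"
    proof -
      have "degree (pderiv q) \<le> degree q - 1"
        by (rule degree_le) (simp add: coeff_pderiv coeff_eq_0)
      then show ?thesis using that by simp
    qed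
    ultimately have "degree q > 0 \<Longrightarrow> pderiv q = 0"
      using less.hyps[of "pderiv q"] polys_over_pderiv[OF is_subring_ker less.prems(1)] by simp
    moreover have "pderiv q \<noteq> 0" if "degree q > 0"
    proof
      assume "pderiv q = 0"
      then have "coeff (pderiv q) (degree q - 1) = 0" by simp
      then have "of_nat (degree q) * lead_coeff q = 0" using that by (simp add: coeff_pderiv)
      then show False using of_nat_nonzero[OF that] that by auto
    qed
    ultimately have "degree q = 0" by blast
    then show "q = 0" using less.prems(2) by (auto elim!: degree_eq_zeroE)
  qed
qed

lemma antiderivative_exists:
  assumes "q \<in> polys_over ker"
  obtains r where "r \<in> polys_over ker" "pderiv r = q"
proof -
  have "\<forall>n. \<exists>u. u \<in> ker \<and> of_nat (Suc n) * u = 1" using rational_ker by blast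
  then obtain u where u: "\<And>n. u n \<in> ker" "\<And>n. of_nat (Suc n) * u n = 1" by metis
  define r where "r = (\<Sum>i\<le>degree q. monom (u i * coeff q i) (Suc i))"
  have pderiv_sum: "pderiv (sum f I) = (\<Sum>i\<in>I. pderiv (f i))" for f :: "nat \<Rightarrow> 'a poly" and I
    by (induction I rule: infinite_finite_induct) (simp_all add: pderiv_add)
  have "r \<in> polys_over ker"
    unfolding r_def using u(1) polys_overD[OF assms] is_subringD[OF is_subring_ker]
    by (intro is_subring_sum is_subring_polys_over is_subring_ker) simp
  moreover have "pderiv r = (\<Sum>i\<le>degree q. monom (coeff q i) i)"
    unfolding r_def by (simp add: pderiv_monom mult.assoc[symmetric] u(2) pderiv_sum del: of_nat_Suc)
  then have "pderiv r = q" by (simp add: poly_as_sum_of_monoms)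
  ultimately show thesis by (rule that)
qed

text \<open>
  After inverting \<open>D t\<close>, a local slice \<open>t\<close> generates the ring over the kernel: integrating the
  expression for \<open>D a\<close> recovers \<open>a\<close> up to a constant.
\<close>

lemma local_slice_generates:
  assumes t: "t \<in> A" "D t \<noteq> 0" "D (D t) = 0" and a: "a \<in> A"
  shows "\<exists>m. \<exists>q\<in>polys_over ker. D t ^ m * a = poly q t"
proof -
  have ft: "D t \<in> ker" using t closed by (simp add: ker_def)
  obtain n where "(D ^^ n) a = 0" using nilpotent[OF a] by blast
  then show ?thesis using a
  proof (induction n arbitrary: a)
    case 0
    then show ?case using is_subringD(1)[OF is_subring_ker] by (intro exI[of _ 0] bexI[of _ 0]) auto
  next
    case (Suc n)
    have "(D ^^ n) (D a) = 0" using Suc.prems(1) by (simp add: funpow_swap1)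
    then obtain m q where q: "q \<in> polys_over ker" "D t ^ m * D a = poly q t"
      using Suc.IH[of "D a"] closed[OF Suc.prems(2)] by blast
    obtain r where r: "r \<in> polys_over ker" "pderiv r = q"
      using antiderivative_exists[OF q(1)] .
    define c where "c = D t ^ Suc m * a - poly r t"
    have fm: "D t ^ Suc m \<in> ker" using ft by (rule is_subring_power[OF is_subring_ker])
    have rA: "poly r t \<in> A"
      by (rule poly_mem_subring[OF subring polys_over_ker_mono[OF r(1)] t(1)])
    have "D c = D t ^ Suc m * D a - poly q t * D t"
      using fm rA Suc.prems(2) r
      by (simp add: c_def D_diff A_closed leibniz ker_def D_poly[OF r(1) t(1)] del: power_Suc)
    also have "\<dots> = 0" by (simp add: q(2)[symmetric])
    finally have "c \<in> ker"
      using fm rA Suc.prems(2) by (simp add: ker_def c_def A_closed del: power_Suc)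
    then have "r + [:c:] \<in> polys_over ker"
      using r(1) is_subringD(1)[OF is_subring_ker]
      by (intro is_subringD(4)[OF is_subring_polys_over[OF is_subring_ker]]) simp_all
    moreover have "D t ^ Suc m * a = poly (r + [:c:]) t" by (simp add: c_def)
    ultimately show ?case by blast
  qed
qed

lemma unit_local_slice_generates:
  assumes t: "t \<in> A" "D t * u = 1" "u \<in> ker" "D (D t) = 0" and a: "a \<in> A"
  shows "a \<in> adjoin ker t"
proof -
  have "D t \<noteq> 0" using t(2) by auto
  then obtain m q where q: "q \<in> polys_over ker" "D t ^ m * a = poly q t"
    using local_slice_generates[OF t(1) _ t(4) a] by blast
  have "a = (u * D t) ^ m * a" using t(2) by (simp add: mult.commute)
  also have "\<dots> = u ^ m * (D t ^ m * a)" by (simp add: power_mult_distrib)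
  also have "\<dots> = poly (smult (u ^ m) q) t" using q(2) by simp
  finally show ?thesis
    unfolding adjoin_def
    by (rule image_eqI) (intro polys_over_smult is_subring_power is_subring_ker t(3) q(1))
qed

end

section \<open>Locally nilpotent derivations of a polynomial ring\<close>

lemma coeff_mult_at_degree_bound:
  fixes p q :: "'a::comm_semiring_0 poly"
  assumes "degree p \<le> m" "degree q \<le> n"
  shows "coeff (p * q) (m + n) = coeff p m * coeff q n"
proof -
  have "coeff p i * coeff q (m + n - i) = 0" if "i \<noteq> m" for i
  proof (cases "i < m")
    case True
    then have "coeff q (m + n - i) = 0" using assms(2) by (intro coeff_eq_0) linarith
    then show ?thesis by simp
  next
    case False
    then have "coeff p i = 0" using assms(1) that by (intro coeff_eq_0) linarith
    then show ?thesis by simp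
  qed
  then have "coeff (p * q) (m + n) = (\<Sum>i\<in>{m}. coeff p i * coeff q (m + n - i))"
    unfolding coeff_mult by (intro sum.mono_neutral_right) auto
  then show ?thesis by simp
qed

context
  fixes A :: "'a::idom set" and D :: "'a poly \<Rightarrow> 'a poly"
  assumes A: "is_subring A"
    and rational: "\<And>n. n > 0 \<Longrightarrow> \<exists>u\<in>A. of_nat n * u = 1"
    and lnd: "lnd_subring (polys_over A) D"
begin

interpretation P: lnd_subring "polys_over A" D by (rule lnd)

lemma polys_over_A_closed: "a \<in> A \<Longrightarrow> q \<in> polys_over A \<Longrightarrow> pCons a q \<in> polys_over A"
  using A by (simp add: is_subringD)

context
  fixes d :: nat
  assumes deg_const: "\<And>a. a \<in> A \<Longrightarrow> degree (D [:a:]) \<le> d"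
    and deg_var: "degree (D [:0, 1:]) \<le> Suc d"
begin

definition top_const :: "'a \<Rightarrow> 'a" where
  "top_const a = coeff (D [:a:]) d"

definition top_var :: 'a where
  "top_var = coeff (D [:0, 1:]) (Suc d)"

text \<open>
  The derivation \<open>X\<^sup>d (\<delta> + \<gamma> X d/dX)\<close>, where \<open>\<delta>\<close> is \<open>top_const\<close> and \<open>\<gamma>\<close> is \<open>top_var\<close>. Since \<open>D\<close>
  raises degrees by at most \<open>d\<close>, this is its homogeneous component of degree \<open>d\<close>.
\<close>

definition top_part :: "'a poly \<Rightarrow> 'a poly" where
  "top_part q = monom 1 d * (map_poly top_const q + smult top_var (pCons 0 (pderiv q)))"

lemma var_mem: "[:0, 1:] \<in> polys_over A"
  using A by (simp add: is_subringD)

lemma const_mem: "a \<in> A \<Longrightarrow> [:a:] \<in> polys_over A"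
  using A by (simp add: is_subringD)

lemma top_var_mem: "top_var \<in> A"
  unfolding top_var_def by (intro polys_overD[OF P.closed] var_mem)

lemma top_const_closed: "a \<in> A \<Longrightarrow> top_const a \<in> A"
  unfolding top_const_def by (intro polys_overD[OF P.closed] const_mem)

lemma top_const_add: "a \<in> A \<Longrightarrow> b \<in> A \<Longrightarrow> top_const (a + b) = top_const a + top_const b"
  using P.additive[OF const_mem const_mem, of a b] by (simp add: top_const_def)

lemma top_const_mult:
  "a \<in> A \<Longrightarrow> b \<in> A \<Longrightarrow> top_const (a * b) = a * top_const b + top_const a * b"
  using P.leibniz[OF const_mem const_mem, of a b] by (simp add: top_const_def mult.commute)

lemma top_const_0 [simp]: "top_const 0 = 0"
  by (simp add: top_const_def)

lemma top_const_1: "top_const 1 = 0"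
  using top_const_mult[of 1 1] is_subringD(2)[OF A]
  by (simp only: mult_1_left mult_1_right add_cancel_right_right)

lemma top_const_sum:
  "(\<And>i. i \<in> I \<Longrightarrow> f i \<in> A) \<Longrightarrow> top_const (sum f I) = (\<Sum>i\<in>I. top_const (f i))"
  by (induction I rule: infinite_finite_induct)
    (simp_all add: top_const_add is_subring_sum[OF A])

text \<open>
  Up to terms of lower degree \<open>D\<close> acts on the leading term as \<open>top_part\<close> does; the induction splits
  \<open>q\<close> as \<open>a + X r\<close> and uses the product rule.
\<close>

lemma degree_D_and_top_coeff:
  assumes "q \<in> polys_over A" "degree q \<le> n"
  shows "degree (D q) \<le> n + d \<and>
    coeff (D q) (n + d) = top_const (coeff q n) + of_nat n * top_var * coeff q n"
  using assms
proof (induction n arbitrary: q)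
  case 0
  then obtain a where "q = [:a:]" by (metis degree_eq_zeroE le_zero_eq)
  moreover have "a \<in> A" using 0(1) calculation A by (simp add: is_subringD)
  ultimately show ?case using deg_const[of a] by (simp add: top_const_def)
next
  case (Suc n)
  obtain a r where q: "q = pCons a r" by (cases q)
  have a: "a \<in> A" and r: "r \<in> polys_over A"
    using Suc.prems(1) A by (simp_all add: q is_subringD)
  have deg_r: "degree r \<le> n"
    using Suc.prems(2) by (simp add: q split: if_splits)
  have "q = [:a:] + [:0, 1:] * r" by (simp add: q)
  then have Dq: "D q = D [:a:] + (pCons 0 (D r) + D [:0, 1:] * r)"
    using P.leibniz[OF var_mem r] P.additive[OF const_mem[OF a] P.A_closed(5)[OF var_mem r]]
    by simp
  note IH = Suc.IH[OF r deg_r]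
  have "degree (D [:0, 1:] * r) \<le> Suc n + d"
    using degree_mult_le[of "D [:0, 1:]" r] deg_var deg_r by linarith
  moreover have "degree (pCons 0 (D r)) \<le> Suc n + d"
    using IH degree_pCons_le[of 0 "D r"] by linarith
  moreover have "degree (D [:a:]) \<le> Suc n + d" using deg_const[OF a] by simp
  ultimately have "degree (D q) \<le> Suc n + d" unfolding Dq by (intro degree_add_le)
  moreover have "coeff (D [:a:]) (Suc n + d) = 0"
    using deg_const[OF a] by (intro coeff_eq_0) simp
  moreover have "coeff (D [:0, 1:] * r) (Suc n + d) = top_var * coeff r n"
    using coeff_mult_at_degree_bound[OF deg_var deg_r] by (simp add: top_var_def add.commute)
  ultimately show ?case using IH Dq by (simp add: q algebra_simps del: mult_pCons_left)
qed

lemma top_part_monom: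
  "top_part (monom a n) = monom (top_const a + of_nat n * top_var * a) (n + d)"
proof -
  have "pCons 0 (pderiv (monom a n)) = monom (of_nat n * a) n"
    by (intro poly_eqI) (simp add: coeff_pCons coeff_pderiv split: nat.split)
  then show ?thesis
    by (simp add: top_part_def map_poly_monom smult_monom add_monom mult_monom algebra_simps)
qed

text \<open>
  Iterating \<open>top_part\<close> on the leading monomial of \<open>q\<close> follows the top coefficients of the iterates of
  \<open>D\<close> on \<open>q\<close>. This transfers local nilpotency from \<open>D\<close> to \<open>top_part\<close>.
\<close>

lemma iter_top_part_monom:
  assumes "q \<in> polys_over A" "degree q \<le> n"
  shows "degree ((D ^^ k) q) \<le> n + k * d \<and>
    (top_part ^^ k) (monom (coeff q n) n) = monom (coeff ((D ^^ k) q) (n + k * d)) (n + k * d)"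
proof (induction k)
  case (Suc k)
  then have "degree ((D ^^ k) q) \<le> n + k * d" by simp
  from degree_D_and_top_coeff[OF P.iter_closed[OF assms(1)] this] Suc show ?case
    by (simp add: top_part_monom add_ac)
qed (use assms in simp)

lemma map_poly_top_const_mem: "q \<in> polys_over A \<Longrightarrow> map_poly top_const q \<in> polys_over A"
  by (simp add: polys_over_def coeff_map_poly top_const_closed)

lemma top_part_closed:
  assumes "q \<in> polys_over A"
  shows "top_part q \<in> polys_over A"
  unfolding top_part_def
proof (intro P.A_closed(4,5))
  show "monom 1 d \<in> polys_over A" using A by (simp add: is_subringD)
  show "map_poly top_const q \<in> polys_over A" by (rule map_poly_top_const_mem[OF assms])
  show "smult top_var (pCons 0 (pderiv q)) \<in> polys_over A"
    using A assms by (intro polys_over_smult polys_over_A_closed polys_over_pderiv)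
      (simp_all add: is_subringD top_var_mem)
qed

lemma top_part_add:
  assumes "p \<in> polys_over A" "q \<in> polys_over A"
  shows "top_part (p + q) = top_part p + top_part q"
proof -
  have "map_poly top_const (p + q) = map_poly top_const p + map_poly top_const q"
    using assms by (intro poly_eqI) (simp add: coeff_map_poly top_const_add polys_overD)
  moreover have "pCons 0 (pderiv (p + q)) = pCons 0 (pderiv p) + pCons 0 (pderiv q)"
    by (simp add: pderiv_add)
  ultimately show ?thesis
    by (simp only: top_part_def smult_add_right distrib_left add_ac)
qed

lemma top_part_leibniz:
  assumes "p \<in> polys_over A" "q \<in> polys_over A"
  shows "top_part (p * q) = p * top_part q + top_part p * q"
proof -
  have 1: "map_poly top_const (p * q) = p * map_poly top_const q + map_poly top_const p * q"
    using assms A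
    by (intro poly_eqI)
      (simp add: coeff_map_poly coeff_mult top_const_sum top_const_mult polys_overD is_subringD
        sum.distrib)
  have 2: "pCons 0 (pderiv (p * q)) = p * pCons 0 (pderiv q) + pCons 0 (pderiv p) * q"
    by (simp add: pderiv_mult mult.commute)
  show ?thesis
    unfolding top_part_def 1 2 smult_add_right mult_smult_left[symmetric] mult_smult_right[symmetric]
    by (simp only: algebra_simps mult_smult_left mult_smult_right)
qed

lemma iter_top_part_add:
  "p \<in> polys_over A \<Longrightarrow> q \<in> polys_over A \<Longrightarrow>
    (top_part ^^ n) (p + q) = (top_part ^^ n) p + (top_part ^^ n) q"
proof (induction n arbitrary: p q)
  case (Suc n)
  then show ?case by (simp del: funpow.simps add: funpow_Suc_right top_part_add top_part_closed)
qed simp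

lemma iter_top_part_0: "(top_part ^^ n) 0 = 0"
  by (induction n) (simp_all add: top_part_def)

lemma top_part_nilpotent:
  assumes "q \<in> polys_over A"
  shows "\<exists>n. (top_part ^^ n) q = 0"
proof -
  have "\<exists>n. (top_part ^^ n) (\<Sum>i<m. monom (coeff q i) i) = 0" for m
  proof (induction m)
    case (Suc m)
    have mem: "monom (coeff q i) i \<in> polys_over A" for i
      using A assms by (simp add: is_subringD polys_overD)
    from Suc obtain n where n: "(top_part ^^ n) (\<Sum>i<m. monom (coeff q i) i) = 0" by blast
    obtain k where k: "(D ^^ k) (monom (coeff q m) m) = 0"
      using P.nilpotent[OF mem] by blast
    have "(top_part ^^ k) (monom (coeff q m) m) = 0"
      using iter_top_part_monom[OF mem[of m] degree_monom_le, of k] by (simp add: k)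
    then have "(top_part ^^ (n + k)) (monom (coeff q m) m) = 0"
      by (simp add: funpow_add iter_top_part_0)
    moreover have "(top_part ^^ (n + k)) (\<Sum>i<m. monom (coeff q i) i) = 0"
      using n by (simp add: add.commute[of n] funpow_add iter_top_part_0)
    ultimately have "(top_part ^^ (n + k)) (\<Sum>i<Suc m. monom (coeff q i) i) = 0"
      using mem is_subring_sum[OF P.subring, of "{..<m}"] by (simp add: iter_top_part_add)
    then show ?case by blast
  qed (simp add: exI[of _ 0])
  from this[of "Suc (degree q)"] show ?thesis
    by (simp add: lessThan_Suc_atMost poly_as_sum_of_monoms)
qed

lemma lnd_top_part: "lnd_subring (polys_over A) top_part"
  by unfold_locales
    (fact P.subring P.rational top_part_closed top_part_add top_part_leibniz top_part_nilpotent)+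

text \<open>
  The homogeneous derivation \<open>top_part\<close> sends the variable to a multiple of itself, and a locally
  nilpotent derivation can only do this by killing it.
\<close>

lemma top_var_eq_0: "top_var = 0"
proof -
  interpret T: lnd_subring "polys_over A" top_part by (rule lnd_top_part)
  have "top_part [:0, 1:] = [:0, 1:] * monom top_var d"
    using top_part_monom[of 1 1] top_const_1 by (simp add: monom_Suc monom_0)
  moreover have "monom top_var d \<in> polys_over A"
    using A by (simp add: is_subringD top_var_mem)
  ultimately have "top_part [:0, 1:] = 0" by (intro T.D_eq_0_if_dvd var_mem)
  then show ?thesis
    using \<open>top_part [:0, 1:] = [:0, 1:] * monom top_var d\<close> by simp
qed

text \<open>
  Since \<open>top_part\<close> kills the variable, on constants its iterates are those of \<open>top_const\<close> times powers
  of the variable.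
\<close>

lemma lnd_top_const: "lnd_subring A top_const"
proof
  fix a assume a: "a \<in> A"
  obtain k where k: "(top_part ^^ k) [:a:] = 0" using top_part_nilpotent[OF const_mem[OF a]] by blast
  have "(top_part ^^ j) [:a:] = monom ((top_const ^^ j) a) (j * d)" for j
    by (induction j) (simp_all add: monom_0 top_part_monom top_var_eq_0 add.commute)
  then show "\<exists>n. (top_const ^^ n) a = 0" using k by auto
qed (fact A rational top_const_closed top_const_add top_const_mult)+

end

text \<open>
  The argument of Crachiola and Makar-Limanov: if \<open>D\<close> does not kill \<open>A\<close>, its homogeneous part of
  highest degree restricts to a nonzero locally nilpotent derivation of \<open>A\<close>. The degree bound ensures
  that a highest degree exists.
\<close>

lemma nonzero_lnd_of_coefficients:
  assumes bound: "\<And>a. a \<in> A \<Longrightarrow> degree (D [:a:]) \<le> N"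
    and nz: "a \<in> A" "D [:a:] \<noteq> 0"
  shows "\<exists>\<delta>. lnd_subring A \<delta> \<and> (\<exists>a\<in>A. \<delta> a \<noteq> 0)"
proof -
  \<comment> \<open>By the product rule, \<open>D\<close> raises degrees by at most \<open>d\<close> if it does so on \<open>A\<close> and the variable.\<close>
  define good where
    "good d \<longleftrightarrow> (\<forall>a\<in>A. degree (D [:a:]) \<le> d) \<and> degree (D [:0, 1:]) \<le> Suc d" for d
  have "good (max N (degree (D [:0, 1:])))"
    unfolding good_def using bound by (auto intro: le_max_iff_disj[THEN iffD2])
  define d where "d = (LEAST d. good d)"
  have d: "\<And>a. a \<in> A \<Longrightarrow> degree (D [:a:]) \<le> d" "degree (D [:0, 1:]) \<le> Suc d"
    using LeastI[of good, OF \<open>good (max _ _)\<close>] by (auto simp: d_def good_def)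
  have "\<exists>a\<in>A. top_const d a \<noteq> 0"
  proof (cases d)
    case 0
    have "degree (D [:a:]) = 0" using d(1)[OF nz(1)] 0 by simp
    moreover have "top_const d a = coeff (D [:a:]) d" by (rule top_const_def[OF d])
    ultimately have "top_const d a \<noteq> 0" using nz(2) leading_coeff_neq_0[of "D [:a:]"] 0 by metis
    then show ?thesis using nz(1) by blast
  next
    case (Suc e)
    then have "\<not> good e" using not_less_Least[of e good] by (simp add: d_def)
    moreover have "degree (D [:0, 1:]) \<le> Suc e"
    proof (rule ccontr)
      assume "\<not> ?thesis"
      then have "degree (D [:0, 1:]) = Suc d" using d(2) Suc by simp
      then show False
        using top_var_eq_0[OF d] leading_coeff_neq_0[of "D [:0, 1:]"]
        top_var_def[OF d] by (metis degree_0 nat.distinct(1))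
    qed
    ultimately obtain b where b: "b \<in> A" "\<not> degree (D [:b:]) \<le> e" by (auto simp: good_def)
    then have "degree (D [:b:]) = d" using d(1)[OF b(1)] Suc by simp
    moreover have "top_const d b = coeff (D [:b:]) d" by (rule top_const_def[OF d])
    moreover have "D [:b:] \<noteq> 0" using b(2) by auto
    ultimately have "top_const d b \<noteq> 0" using leading_coeff_neq_0[of "D [:b:]"] by metis
    then show ?thesis using b(1) by blast
  qed
  then show ?thesis using lnd_top_const[OF d] by blast
qed

end

section \<open>Prime ideals of the polynomial ring in two variables\<close>

lemma ring_ideal_lincomb: "ring_ideal I \<Longrightarrow> x \<in> I \<Longrightarrow> y \<in> I \<Longrightarrow> r * x + s * y \<in> I"
  by (auto simp: ring_ideal_def)

lemma prime_idealD:
  assumes "prime_ideal P"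
  shows "0 \<in> P" "x \<in> P \<Longrightarrow> y \<in> P \<Longrightarrow> x + y \<in> P" "x \<in> P \<Longrightarrow> r * x \<in> P" "x \<in> P \<Longrightarrow> x * r \<in> P"
    "x \<in> P \<Longrightarrow> y \<in> P \<Longrightarrow> x - y \<in> P" "1 \<notin> P" "x * y \<in> P \<Longrightarrow> x \<in> P \<or> y \<in> P"
proof -
  have I: "ring_ideal P" using assms by (simp add: prime_ideal_def)
  show "0 \<in> P" "x \<in> P \<Longrightarrow> y \<in> P \<Longrightarrow> x + y \<in> P" "x \<in> P \<Longrightarrow> r * x \<in> P"
    using I by (auto simp: ring_ideal_def)
  show "x \<in> P \<Longrightarrow> x * r \<in> P"
    using I by (auto simp: ring_ideal_def mult.commute[of x])
  show "x \<in> P \<Longrightarrow> y \<in> P \<Longrightarrow> x - y \<in> P"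
    using ring_ideal_lincomb[OF I, of x y 1 "-1"] by simp
  show "1 \<notin> P"
  proof
    assume "1 \<in> P"
    then have "r * 1 \<in> P" for r using I unfolding ring_ideal_def by blast
    then have "P = UNIV" by auto
    then show False using assms by (simp add: prime_ideal_def)
  qed
  show "x * y \<in> P \<Longrightarrow> x \<in> P \<or> y \<in> P" using assms by (auto simp: prime_ideal_def)
qed

lemma prime_ideal_vimage:
  assumes h: "hom_on UNIV h" and P: "prime_ideal P"
  shows "prime_ideal (h -` P)"
proof -
  have "h -` P \<noteq> UNIV" using hom_onD(1)[OF h] prime_idealD(6)[OF P] by (metis UNIV_I vimageD)
  then show ?thesis
    unfolding prime_ideal_def ring_ideal_def
    using hom_on_0[OF h is_subring_UNIV] hom_onD[OF h] prime_idealD[OF P] by auto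
qed

lemma hom_on_eval_UNIV: "hom_on UNIV h \<Longrightarrow> hom_on UNIV (eval_at h x)"
  using hom_on_eval_at[OF _ is_subring_UNIV, of h x] by simp

text \<open>
  Over an algebraically closed field a nonzero polynomial is a product of linear factors, so a
  prime ideal that contains one of its values contains a linear value.
\<close>

lemma linear_in_prime_ideal:
  fixes \<phi> :: "'k::alg_closed_field \<Rightarrow> 'b::comm_ring_1"
  assumes \<phi>: "hom_on UNIV \<phi>" and P: "prime_ideal P"
    and g: "g \<noteq> 0" "eval_at \<phi> x g \<in> P"
  obtains \<mu> where "x - \<phi> \<mu> \<in> P" "poly g \<mu> = 0"
proof -
  note \<phi>0 = hom_on_0[OF \<phi> is_subring_UNIV]
  have "\<exists>\<mu>. x - \<phi> \<mu> \<in> P \<and> poly g \<mu> = 0"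
    using g
  proof (induction "degree g" arbitrary: g)
    case 0
    then obtain c where c: "g = [:c:]" "c \<noteq> 0" by (metis degree_eq_zeroE pCons_0_0)
    then have "\<phi> (inverse c) * \<phi> c = 1"
      using hom_onD(3)[OF \<phi>, of "inverse c" c] hom_onD(1)[OF \<phi>] by simp
    moreover have "\<phi> c \<in> P" using 0 c \<phi>0 by simp
    ultimately have "1 \<in> P" using prime_idealD(3)[OF P] by metis
    then show ?case using prime_idealD(6)[OF P] by simp
  next
    case (Suc n)
    then obtain \<mu> where "poly g \<mu> = 0" using alg_closed_imp_poly_has_root[of g] by auto
    then obtain r where r: "g = [:- \<mu>, 1:] * r" by (metis dvdE poly_eq_0_iff_dvd)
    have "eval_at \<phi> x g = eval_at \<phi> x [:- \<mu>, 1:] * eval_at \<phi> x r"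
      unfolding r by (intro hom_onD(3)[OF hom_on_eval_UNIV[OF \<phi>]]) auto
    also have "eval_at \<phi> x [:- \<mu>, 1:] = x - \<phi> \<mu>"
      using \<phi>0 hom_on_minus[OF \<phi> is_subring_UNIV, of \<mu>] hom_onD(1)[OF \<phi>] by simp
    finally have "x - \<phi> \<mu> \<in> P \<or> eval_at \<phi> x r \<in> P" using Suc.prems(2) prime_idealD(7)[OF P] by metis
    moreover have "r \<noteq> 0" "n = degree r"
      using Suc.prems(1) Suc.hyps(2) r by (auto simp del: mult_pCons_left simp: degree_mult_eq)
    ultimately show ?case using Suc.hyps(1)[of r] \<open>poly g \<mu> = 0\<close> by (auto simp: r)
  qed
  then show thesis using that by blast
qed

lemma linear_dvd_coeffs:
  fixes F :: "'k::idom poly poly"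
  assumes "map_poly (\<lambda>q. poly q c) F = 0"
  obtains G where "F = smult [:- c, 1:] G"
proof -
  have "[:- c, 1:] dvd coeff F n" for n
    using arg_cong[OF assms, of "\<lambda>q. coeff q n"] by (simp add: coeff_map_poly poly_eq_0_iff_dvd)
  then have "[:[:- c, 1:]:] dvd F" by (simp add: const_poly_dvd_iff)
  then show thesis using that by (auto elim!: dvdE)
qed

text \<open>
  Dividing by \<open>X - c\<close> lowers the degree of the leading coefficient in \<open>X\<close>. So after finitely many
  divisions the reduction at \<open>X = c\<close> is nonzero.
\<close>

lemma remove_linear_content:
  fixes F :: "'k::idom poly poly"
  assumes "F \<noteq> 0"
  obtains j G where "F = smult ([:- c, 1:] ^ j) G" "map_poly (\<lambda>q. poly q c) G \<noteq> 0"
proof -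
  have "\<exists>j G. F = smult ([:- c, 1:] ^ j) G \<and> map_poly (\<lambda>q. poly q c) G \<noteq> 0"
    using assms
  proof (induction "degree (lead_coeff F)" arbitrary: F rule: less_induct)
    case less
    show ?case
    proof (cases "map_poly (\<lambda>q. poly q c) F = 0")
      case False
      then show ?thesis by (intro exI[of _ 0] exI[of _ F]) simp
    next
      case True
      obtain G where G: "F = smult [:- c, 1:] G" using linear_dvd_coeffs[OF True] .
      have "G \<noteq> 0" using less.prems G by auto
      then have "lead_coeff F = [:- c, 1:] * lead_coeff G" "lead_coeff G \<noteq> 0"
        by (simp_all add: G lead_coeff_smult del: mult_pCons_left)
      then have "degree (lead_coeff G) < degree (lead_coeff F)"
        by (simp add: degree_mult_eq del: mult_pCons_left)
      then obtain j H where "G = smult ([:- c, 1:] ^ j) H" "map_poly (\<lambda>q. poly q c) H \<noteq> 0"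
        using less.hyps \<open>G \<noteq> 0\<close> by blast
      then show ?thesis by (intro exI[of _ "Suc j"] exI[of _ H]) (simp add: G)
    qed
  qed
  then show thesis using that by blast
qed

lemma hom_on_const_poly: "hom_on UNIV (\<lambda>a. [:a:])"
  by (simp add: hom_on_def one_pCons)

text \<open>
  Modulo \<open>X - c\<close> each coefficient \<open>q\<close> in \<open>k[X]\<close> equals the constant \<open>q(c)\<close>.
\<close>

lemma reduce_modulo_linear:
  fixes F :: "'k::comm_ring_1 poly poly"
  assumes P: "prime_ideal P" and c: "[:[:- c, 1:]:] \<in> P"
  shows "F - map_poly (\<lambda>q. [:poly q c:]) F \<in> P"
proof (induction F)
  case (pCons q F)
  have "[:- c, 1:] dvd q - [:poly q c:]" by (simp add: dvd_iff_poly_eq_0 flip: poly_eq_0_iff_dvd)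
  then obtain r where r: "q - [:poly q c:] = [:- c, 1:] * r" by (elim dvdE)
  have "pCons q F - map_poly (\<lambda>q. [:poly q c:]) (pCons q F) =
    [:[:- c, 1:]:] * [:r:] + [:0, 1:] * (F - map_poly (\<lambda>q. [:poly q c:]) F)"
    using r by (simp add: map_poly_pCons)
  then show ?case using prime_idealD[OF P] c pCons by metis
qed (simp add: prime_idealD[OF P])

abbreviation const2 :: "'k::comm_ring_1 \<Rightarrow> 'k poly poly" where
  "const2 a \<equiv> [:[:a:]:]"

lemma hom_on_const2: "hom_on UNIV const2"
  by (simp add: hom_on_def one_pCons)

lemma eval_const2_X: "eval_at const2 [:[:0, 1:]:] q = [:q:]"
  by (induction q) simp_all

lemma eval_const2_Y: "eval_at const2 [:0, 1:] g = map_poly (\<lambda>a. [:a:]) g"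
  by (induction g) (simp_all add: map_poly_pCons)

lemma map_const_eval:
  "map_poly (\<lambda>q. [:poly q c:]) F = map_poly (\<lambda>a. [:a:]) (map_poly (\<lambda>q. poly q c) F)"
  by (simp add: map_poly_map_poly comp_def)

context
  fixes P :: "'k::alg_closed_field poly poly set"
  assumes P: "prime_ideal P"
begin

lemma linear_X_in_prime:
  assumes "[:q:] \<in> P" "q \<noteq> 0"
  obtains c where "[:[:- c, 1:]:] \<in> P"
  using linear_in_prime_ideal[OF hom_on_const2 P assms(2), of "[:[:0, 1:]:]"] assms(1) that
  by (auto simp: eval_const2_X)

lemma linear_Y_in_prime:
  assumes c: "[:[:- c, 1:]:] \<in> P" and F: "F \<in> P" "map_poly (\<lambda>q. poly q c) F \<noteq> 0"
  obtains \<mu> where "[:[:- \<mu>:], 1:] \<in> P"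
proof -
  have "F - (F - map_poly (\<lambda>q. [:poly q c:]) F) \<in> P"
    by (intro prime_idealD(5)[OF P] F reduce_modulo_linear[OF P c])
  then have "eval_at const2 [:0, 1:] (map_poly (\<lambda>q. poly q c) F) \<in> P"
    by (simp add: eval_const2_Y map_const_eval)
  then obtain \<mu> where "[:0, 1:] - const2 \<mu> \<in> P"
    by (rule linear_in_prime_ideal[OF hom_on_const2 P F(2)])
  then show thesis using that[of \<mu>] by simp
qed

text \<open>
  Modulo \<open>X - c\<close> and \<open>Y - \<mu>\<close> every polynomial is congruent to an element of the field, so a strictly
  larger ideal contains a unit.
\<close>

lemma prime_with_linear_X_Y_is_maximal:
  assumes X: "[:[:- c, 1:]:] \<in> P" and Y: "[:[:- \<mu>:], 1:] \<in> P"
    and P': "prime_ideal P'" "P \<subset> P'"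
  shows False
proof -
  obtain F where F: "F \<in> P'" "F \<notin> P" using P'(2) by blast
  define g where "g = map_poly (\<lambda>q. poly q c) F"
  define \<kappa> where "\<kappa> = poly g \<mu>"
  obtain r where r: "g - [:\<kappa>:] = [:- \<mu>, 1:] * r"
  proof -
    have "poly (g - [:\<kappa>:]) \<mu> = 0" by (simp add: \<kappa>_def)
    then have "[:- \<mu>, 1:] dvd g - [:\<kappa>:]" by (simp only: poly_eq_0_iff_dvd)
    then show thesis using that by (elim dvdE)
  qed
  have "hom_on UNIV (map_poly (\<lambda>a::'k. [:a:]))"
    using hom_on_map_poly[OF hom_on_const_poly is_subring_UNIV] by simp
  note h = hom_onD(2,3)[OF this]
  have "map_poly (\<lambda>a. [:a:]) g = map_poly (\<lambda>a. [:a:]) ([:- \<mu>, 1:] * r + [:\<kappa>:])"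
    using r by (metis diff_add_cancel)
  also have "\<dots> = [:[:- \<mu>:], 1:] * map_poly (\<lambda>a. [:a:]) r + const2 \<kappa>"
    by (subst h(1), simp, simp, subst h(2)) (simp_all add: map_poly_pCons one_pCons)
  finally have "F - const2 \<kappa> = (F - map_poly (\<lambda>q. [:poly q c:]) F) + [:[:- \<mu>:], 1:] * map_poly (\<lambda>a. [:a:]) r"
    by (simp add: map_const_eval g_def)
  moreover have "\<dots> \<in> P"
    by (intro prime_idealD(2,4)[OF P] Y reduce_modulo_linear[OF P X])
  ultimately have mem: "F - const2 \<kappa> \<in> P" by (simp only:)
  then have "\<kappa> \<noteq> 0" using F by auto
  have "F - const2 \<kappa> \<in> P'" using mem P'(2) by blast
  then have "F - (F - const2 \<kappa>) \<in> P'" by (rule prime_idealD(5)[OF P'(1) F(1)])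
  then have "const2 (inverse \<kappa>) * const2 \<kappa> \<in> P'" by (intro prime_idealD(3)[OF P'(1)]) simp
  then show False using \<open>\<kappa> \<noteq> 0\<close> prime_idealD(6)[OF P'(1)] by (simp add: one_pCons)
qed

text \<open>
  Over the field \<open>k(X)\<close> nonzero primes of the polynomial ring in \<open>Y\<close> are maximal, so a prime
  strictly above a nonzero prime has to meet \<open>k[X]\<close>. Pseudo-division by an element \<open>h\<close> of least
  degree takes the place of the division in \<open>k(X)[Y]\<close>.
\<close>

lemma prime_above_nonzero_prime_meets_base:
  assumes nz: "f0 \<in> P" "f0 \<noteq> 0" and P': "prime_ideal P'" "P \<subset> P'"
  shows "\<exists>q. q \<noteq> 0 \<and> [:q:] \<in> P'"
proof (rule ccontr)
  assume no: "\<not> ?thesis"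
  obtain h where h: "h \<in> P'" "h \<noteq> 0" and h_min: "\<And>g. g \<in> P' \<Longrightarrow> g \<noteq> 0 \<Longrightarrow> degree h \<le> degree g"
    using ex_has_least_nat[of "\<lambda>h. h \<in> P' \<and> h \<noteq> 0" f0 degree] nz P'(2) by blast
  obtain f where f: "f \<in> P" "f \<noteq> 0" and f_min: "\<And>g. g \<in> P \<Longrightarrow> g \<noteq> 0 \<Longrightarrow> degree f \<le> degree g"
    using ex_has_least_nat[of "\<lambda>h. h \<in> P \<and> h \<noteq> 0" f0 degree] nz by blast
  have deg_h: "degree h > 0"
  proof (rule ccontr)
    assume "\<not> ?thesis"
    then obtain q where "h = [:q:]" by (metis degree_eq_zeroE gr0I)
    then show False using no h by auto
  qed
  have div: "\<exists>N u. smult (lead_coeff h ^ N) F = h * u" if "F \<in> P'" for F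
  proof -
    obtain N u r where d: "smult (lead_coeff h ^ N) F = h * u + r" "r = 0 \<or> degree r < degree h"
      using pseudo_division[OF is_subring_UNIV, of h F] h by auto
    have "r = [:lead_coeff h ^ N:] * F - h * u" using d(1) by simp
    then have "r \<in> P'" using that h(1) prime_idealD(3,4,5)[OF P'(1)] by metis
    then have "r = 0" using d(2) h_min[of r] by force
    then show ?thesis using d(1) by auto
  qed
  have smult_mem: "smult a F \<in> P" if "F \<in> P" for a F
    using prime_idealD(3)[OF P that, of "[:a:]"] by simp
  have "h \<in> P"
  proof (rule ccontr)
    assume "h \<notin> P"
    obtain N u where u: "smult (lead_coeff h ^ N) f = h * u" using div[of f] f P'(2) by blast
    then have "u \<in> P" using smult_mem[OF f(1)] prime_idealD(7)[OF P] \<open>h \<notin> P\<close> by metis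
    have nz: "lead_coeff h ^ N \<noteq> 0" using h(2) by simp
    then have "u \<noteq> 0" using u f(2) by auto
    moreover have "degree f = degree h + degree u"
      using u nz \<open>u \<noteq> 0\<close> h(2) by (metis degree_mult_eq degree_smult_eq)
    ultimately show False using f_min[OF \<open>u \<in> P\<close>] deg_h by simp
  qed
  obtain F where F: "F \<in> P'" "F \<notin> P" using P'(2) by blast
  obtain N u where "smult (lead_coeff h ^ N) F = h * u" using div[OF F(1)] by blast
  then have "[:lead_coeff h ^ N:] * F \<in> P" using prime_idealD(4)[OF P \<open>h \<in> P\<close>] by simp
  then have "[:lead_coeff h ^ N:] \<in> P'" using prime_idealD(7)[OF P] F P'(2) by blast
  then show False using no h(2) by (metis leading_coeff_0_iff power_not_zero)
qed

end

text \<open>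
  The third prime \<open>P 2\<close> of such a chain would contain some \<open>X - c\<close>, because either \<open>P 1\<close> already meets
  \<open>k[X]\<close> or \<open>P 2\<close> does by the preceding lemma. In both cases it would also contain an element that does
  not vanish at \<open>X = c\<close>, hence some \<open>Y - \<mu>\<close>, and be maximal.
\<close>

theorem poly_poly_no_prime_chain:
  fixes P :: "nat \<Rightarrow> 'k::alg_closed_field poly poly set"
  assumes prime: "\<And>i. i \<le> 3 \<Longrightarrow> prime_ideal (P i)" and strict: "\<And>i. i < 3 \<Longrightarrow> P i \<subset> P (Suc i)"
  shows False
proof -
  have P: "prime_ideal (P (Suc 0))" "prime_ideal (P 2)" "prime_ideal (P 3)" by (auto intro: prime)
  have sub: "P (Suc 0) \<subset> P 2" "P 2 \<subset> P 3" using strict[of "Suc 0"] strict[of 2] by (simp_all add: numeral_eq_Suc)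
  have "0 \<in> P 0" using prime_idealD(1)[OF prime] by simp
  then obtain f where f: "f \<in> P (Suc 0)" "f \<noteq> 0" using strict[of 0] by auto
  obtain c F where c: "[:[:- c, 1:]:] \<in> P 2" "F \<in> P 2" "map_poly (\<lambda>q. poly q c) F \<noteq> 0"
  proof (cases "\<exists>q. q \<noteq> 0 \<and> [:q:] \<in> P (Suc 0)")
    case True
    then obtain c where c: "[:[:- c, 1:]:] \<in> P (Suc 0)" using linear_X_in_prime[OF P(1)] by blast
    obtain F where F: "F \<in> P 2" "F \<notin> P (Suc 0)" using sub by blast
    have "map_poly (\<lambda>q. poly q c) F \<noteq> 0"
    proof
      assume "map_poly (\<lambda>q. poly q c) F = 0"
      then have "F \<in> P (Suc 0)"
        using reduce_modulo_linear[OF P(1) c, of F] by (simp add: map_const_eval)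
      then show False using F by simp
    qed
    then show thesis using that c F sub by blast
  next
    case False
    obtain q where "q \<noteq> 0" "[:q:] \<in> P 2"
      using prime_above_nonzero_prime_meets_base[OF P(1) f P(2) sub(1)] by blast
    then obtain c where c: "[:[:- c, 1:]:] \<in> P 2" using linear_X_in_prime[OF P(2)] by blast
    obtain j G where G: "f = smult ([:- c, 1:] ^ j) G" "map_poly (\<lambda>q. poly q c) G \<noteq> 0"
      using remove_linear_content[OF f(2)] .
    have "[:[:- c, 1:] ^ j:] * G \<in> P (Suc 0)" using f(1) G(1) by simp
    moreover have "[:- c, 1:] ^ j \<noteq> 0" by simp
    ultimately have "G \<in> P (Suc 0)" using prime_idealD(7)[OF P(1)] False by blast
    then show thesis using that[OF c _ G(2)] sub by blast
  qed
  obtain \<mu> where "[:[:- \<mu>:], 1:] \<in> P 2" using linear_Y_in_prime[OF P(2) c] .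
  then show False using prime_with_linear_X_Y_is_maximal[OF P(2) c(1) _ P(3) sub(2)] by blast
qed

section \<open>Homomorphisms into an algebraically closed field\<close>

text \<open>
  The value at \<open>q(x)\<close> has to be that of the image of \<open>q\<close> at \<open>\<omega>\<close>. It does not depend on the choice of \<open>q\<close>
  because \<open>\<omega>\<close> satisfies the images of all relations of \<open>x\<close>.
\<close>

lemma hom_on_adjoin_exists:
  fixes x :: "'a::comm_ring_1" and \<phi> :: "'a \<Rightarrow> 'c::comm_ring_1"
  assumes R: "is_subring R" and \<phi>: "hom_on R \<phi>"
    and rel: "\<And>q. q \<in> polys_over R \<Longrightarrow> poly q x = 0 \<Longrightarrow> eval_at \<phi> \<omega> q = 0"
  obtains \<psi> where "hom_on (adjoin R x) \<psi>"
    "\<And>q. q \<in> polys_over R \<Longrightarrow> \<psi> (poly q x) = eval_at \<phi> \<omega> q" "\<And>r. r \<in> R \<Longrightarrow> \<psi> r = \<phi> r"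
proof -
  define \<psi> where "\<psi> y = eval_at \<phi> \<omega> (SOME q. q \<in> polys_over R \<and> poly q x = y)" for y
  note PR = is_subring_polys_over[OF R] and E = hom_on_eval_at[OF \<phi> R, of \<omega>]
  have val: "\<psi> (poly q x) = eval_at \<phi> \<omega> q" if q: "q \<in> polys_over R" for q
  proof -
    define p where "p = (SOME p. p \<in> polys_over R \<and> poly p x = poly q x)"
    have p: "p \<in> polys_over R \<and> poly p x = poly q x"
      unfolding p_def by (rule someI[of _ q]) (use q in simp)
    then have "eval_at \<phi> \<omega> (p - q) = 0"
      using q by (intro rel is_subringD[OF PR]) auto
    then have "eval_at \<phi> \<omega> p = eval_at \<phi> \<omega> q"
      using hom_on_diff[OF E PR] p q by simp
    then show ?thesis by (simp add: \<psi>_def p_def)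
  qed
  have "hom_on (adjoin R x) \<psi>"
    unfolding hom_on_def
  proof (intro conjI ballI)
    show "\<psi> 1 = 1" using val[of 1] hom_onD(1)[OF E] is_subringD(2)[OF PR] by simp
  next
    fix y z assume "y \<in> adjoin R x" "z \<in> adjoin R x"
    then obtain p q where pq: "p \<in> polys_over R" "q \<in> polys_over R" "y = poly p x" "z = poly q x"
      by (auto simp: adjoin_def)
    show "\<psi> (y + z) = \<psi> y + \<psi> z" "\<psi> (y * z) = \<psi> y * \<psi> z"
      using val[of "p + q"] val[of "p * q"] val[of p] val[of q] pq hom_onD(2,3)[OF E pq(1,2)]
        is_subringD(4,5)[OF PR pq(1,2)] by simp_all
  qed
  moreover have "\<psi> r = \<phi> r" if "r \<in> R" for r
    using val[of "[:r:]"] that R \<phi> by (simp add: is_subringD hom_on_0)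
  ultimately show thesis using that val by blast
qed

text \<open>
  The Euclidean algorithm for \<open>q\<close> and a relation \<open>m\<close> of least degree, carried out with pseudo-division,
  inverts \<open>q(x)\<close> up to an element of the base ring. It does not stop early,
  because nonzero polynomials of smaller degree than \<open>m\<close> do not vanish at \<open>x\<close>.
\<close>

lemma algebraic_inverse:
  fixes x :: "'a::idom"
  assumes R: "is_subring R" and m: "m \<in> polys_over R" "m \<noteq> 0"
    and m_min: "\<And>q. q \<in> polys_over R \<Longrightarrow> poly q x = 0 \<Longrightarrow> q \<noteq> 0 \<Longrightarrow> degree m \<le> degree q"
    and mx: "poly m x = 0"
    and q: "q \<in> polys_over R" "poly q x \<noteq> 0"
  shows "\<exists>v\<in>polys_over R. \<exists>a\<in>R. a \<noteq> 0 \<and> poly v x * poly q x = a"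
  using q
proof (induction "degree q" arbitrary: q rule: less_induct)
  case less
  note PR = is_subring_polys_over[OF R]
  have lc: "lead_coeff f ^ N \<in> R" "lead_coeff f ^ N \<noteq> 0"
    if "f \<in> polys_over R" "f \<noteq> 0" for f :: "'a poly" and N
    using that R by (auto intro: is_subring_power polys_overD)
  have q0: "q \<noteq> 0" using less.prems(2) by auto
  consider "degree q = 0" | "degree q > 0" "degree q < degree m" | "degree m \<le> degree q" "degree q > 0"
    by linarith
  then show ?case
  proof cases
    case 1
    then obtain a where "q = [:a:]" by (metis degree_eq_zeroE)
    then show ?thesis using less.prems R PR by (intro bexI[of _ 1] bexI[of _ a]) (auto simp: is_subringD)
  next
    case 2
    obtain N u r where d: "u \<in> polys_over R" "r \<in> polys_over R"
      "smult (lead_coeff q ^ N) m = q * u + r" "r = 0 \<or> degree r < degree q"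
      using pseudo_division[OF R less.prems(1) q0 m(1)] .
    have eq: "poly q x * poly u x + poly r x = 0"
      using arg_cong[OF d(3), of "\<lambda>f. poly f x"] mx by simp
    have "r \<noteq> 0"
    proof
      assume "r = 0"
      have nz: "lead_coeff q ^ N \<noteq> 0" using q0 by simp
      then have "u \<noteq> 0" using d(3) \<open>r = 0\<close> m(2) by auto
      have "poly u x = 0" using eq less.prems(2) \<open>r = 0\<close> by simp
      then have "degree m \<le> degree u" using m_min d(1) \<open>u \<noteq> 0\<close> by blast
      moreover have "degree m = degree q + degree u"
        using d(3) nz \<open>r = 0\<close> q0 \<open>u \<noteq> 0\<close> by (metis add.right_neutral degree_mult_eq degree_smult_eq)
      ultimately show False using 2 by simp
    qed
    then have "degree r < degree q" using d(4) by simp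
    moreover have "poly r x \<noteq> 0"
      using m_min[OF d(2) _ \<open>r \<noteq> 0\<close>] 2 \<open>degree r < degree q\<close> by force
    ultimately obtain v a where v: "v \<in> polys_over R" "a \<in> R" "a \<noteq> 0" "poly v x * poly r x = a"
      using less.hyps[of r] d(2) by blast
    have "poly r x = - (poly q x * poly u x)" using eq by (simp add: eq_neg_iff_add_eq_0 add.commute)
    then have "poly (- (v * u)) x * poly q x = a"
      using v(4) by (simp add: algebra_simps)
    moreover have "- (v * u) \<in> polys_over R" using v(1) d(1) by (intro is_subringD[OF PR])
    ultimately show ?thesis using v by blast
  next
    case 3
    obtain N u r where d: "u \<in> polys_over R" "r \<in> polys_over R"
      "smult (lead_coeff m ^ N) q = m * u + r" "r = 0 \<or> degree r < degree m"
      using pseudo_division[OF R m less.prems(1)] .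
    have eq: "lead_coeff m ^ N * poly q x = poly r x"
      using arg_cong[OF d(3), of "\<lambda>f. poly f x"] mx by simp
    then have rx: "poly r x \<noteq> 0" using less.prems(2) m(2) by (auto simp flip: eq)
    then have "degree r < degree q" using d(4) 3 by auto
    then obtain v a where v: "v \<in> polys_over R" "a \<in> R" "a \<noteq> 0" "poly v x * poly r x = a"
      using less.hyps[of r] d(2) rx by blast
    have "poly (smult (lead_coeff m ^ N) v) x * poly q x = a"
      using v(4) by (simp add: eq[symmetric] algebra_simps)
    moreover have "smult (lead_coeff m ^ N) v \<in> polys_over R"
      by (intro polys_over_smult R lc m v)
    ultimately show ?thesis using v by blast
  qed
qed

lemma alg_closed_nonroot_exists:
  fixes f :: "'a::alg_closed_field poly"
  assumes "f \<noteq> 0"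
  obtains x where "poly f x \<noteq> 0"
proof (cases "degree f = 0")
  case True
  then show thesis using that[of 0] assms by (auto elim!: degree_eq_zeroE)
next
  case False
  \<comment> \<open>A root of \<open>f - 1\<close> is not a root of \<open>f\<close>.\<close>
  then have "degree (f - 1) > 0"
    using degree_add_eq_left[of "- 1" f] by simp
  then obtain x where "poly (f - 1) x = 0" using alg_closed_imp_poly_has_root by blast
  then show thesis using that[of x] by simp
qed

text \<open>
  Homomorphisms into an algebraically closed field extend generically: it suffices that one
  nonzero element of the base ring is not mapped to zero. For an algebraic \<open>x\<close> this element
  controls the leading coefficient of a minimal relation, so that a root of its image exists and
  is compatible with all other relations. Prescribing \<open>\<psi> b \<noteq> 0\<close> is what lets the extensions be
  iterated.
\<close>

lemma extend_hom_simple: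
  fixes x :: "'w::idom"
  assumes R: "is_subring R" and b: "b \<in> adjoin R x" "b \<noteq> 0"
  shows "\<exists>a\<in>R. a \<noteq> 0 \<and> (\<forall>\<phi> :: 'w \<Rightarrow> 'v::alg_closed_field. hom_on R \<phi> \<longrightarrow> \<phi> a \<noteq> 0 \<longrightarrow>
    (\<exists>\<psi>. hom_on (adjoin R x) \<psi> \<and> (\<forall>r\<in>R. \<psi> r = \<phi> r) \<and> \<psi> b \<noteq> 0))"
proof -
  obtain q where q: "q \<in> polys_over R" "b = poly q x" using b(1) by (auto simp: adjoin_def)
  then have "q \<noteq> 0" using b(2) by auto
  show ?thesis
  proof (cases "transcendental_over R x")
    case True
    show ?thesis
    proof (intro bexI[of _ "lead_coeff q"] conjI allI impI)
      show "lead_coeff q \<noteq> 0" "lead_coeff q \<in> R" using q \<open>q \<noteq> 0\<close> by (auto intro: polys_overD)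
      fix \<phi> :: "'w \<Rightarrow> 'v" assume \<phi>: "hom_on R \<phi>" "\<phi> (lead_coeff q) \<noteq> 0"
      have "coeff (map_poly \<phi> q) (degree q) \<noteq> 0"
        using \<phi> by (simp add: coeff_map_poly hom_on_0[OF \<phi>(1) R])
      then have "map_poly \<phi> q \<noteq> 0" by auto
      then obtain \<omega> where "poly (map_poly \<phi> q) \<omega> \<noteq> 0" by (rule alg_closed_nonroot_exists)
      then have \<omega>: "eval_at \<phi> \<omega> q \<noteq> 0" by (simp add: eval_at_def)
      have rel: "eval_at \<phi> \<omega> p = 0" if "p \<in> polys_over R" "poly p x = 0" for p
        using transcendental_overD[OF True that] by simp
      obtain \<psi> where "hom_on (adjoin R x) \<psi>" "\<psi> (poly q x) = eval_at \<phi> \<omega> q" "\<And>r. r \<in> R \<Longrightarrow> \<psi> r = \<phi> r"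
        using hom_on_adjoin_exists[OF R \<phi>(1) rel] q(1) by metis
      then show "\<exists>\<psi>. hom_on (adjoin R x) \<psi> \<and> (\<forall>r\<in>R. \<psi> r = \<phi> r) \<and> \<psi> b \<noteq> 0"
        using \<omega> q(2) by auto
    qed
  next
    case False
    then have "\<exists>m. m \<in> polys_over R \<and> poly m x = 0 \<and> m \<noteq> 0"
      by (auto simp: transcendental_over_def)
    then obtain m where m: "m \<in> polys_over R" "poly m x = 0" "m \<noteq> 0"
      and m_min: "\<And>q. q \<in> polys_over R \<Longrightarrow> poly q x = 0 \<Longrightarrow> q \<noteq> 0 \<Longrightarrow> degree m \<le> degree q"
      using ex_has_least_nat[of "\<lambda>m. m \<in> polys_over R \<and> poly m x = 0 \<and> m \<noteq> 0" _ degree] by metis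
    obtain v a where v: "v \<in> polys_over R" "a \<in> R" "a \<noteq> 0" "poly v x * poly q x = a"
      using algebraic_inverse[OF R m(1,3) m_min m(2) q(1)] b(2) q(2) by blast
    have deg_m: "degree m > 0" using m(2,3) by (metis degree_eq_zeroE gr0I poly_const_conv pCons_0_0)
    define l where "l = lead_coeff m"
    have l: "l \<in> R" "l \<noteq> 0" using m by (auto simp: l_def intro: polys_overD)
    show ?thesis
    proof (intro bexI[of _ "l * a"] conjI allI impI)
      show "l * a \<noteq> 0" "l * a \<in> R" using l v R by (simp_all add: is_subringD)
      fix \<phi> :: "'w \<Rightarrow> 'v" assume \<phi>: "hom_on R \<phi>" "\<phi> (l * a) \<noteq> 0"
      then have \<phi>l: "\<phi> l \<noteq> 0" and \<phi>a: "\<phi> a \<noteq> 0" using hom_onD(3)[OF \<phi>(1) l(1) v(2)] by auto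
      have "coeff (map_poly \<phi> m) (degree m) \<noteq> 0"
        using \<phi>l by (simp add: coeff_map_poly hom_on_0[OF \<phi>(1) R] l_def)
      then have "degree (map_poly \<phi> m) > 0" using le_degree[of "map_poly \<phi> m" "degree m"] deg_m by simp
      then obtain \<omega> where "poly (map_poly \<phi> m) \<omega> = 0" using alg_closed_imp_poly_has_root by blast
      then have \<omega>: "eval_at \<phi> \<omega> m = 0" by (simp add: eval_at_def)
      note E = hom_on_eval_at[OF \<phi>(1) R, of \<omega>] and PR = is_subring_polys_over[OF R]
      have const: "[:c:] \<in> polys_over R \<and> eval_at \<phi> \<omega> [:c:] = \<phi> c" if "c \<in> R" for c
        using that R hom_on_0[OF \<phi>(1) R] by (simp add: is_subringD)
      have rel: "eval_at \<phi> \<omega> p = 0" if p: "p \<in> polys_over R" "poly p x = 0" for p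
      proof -
        obtain N u r where d: "u \<in> polys_over R" "r \<in> polys_over R"
          "smult (l ^ N) p = m * u + r" "r = 0 \<or> degree r < degree m"
          using pseudo_division[OF R m(1,3) p(1)] unfolding l_def .
        have "poly r x = 0" using arg_cong[OF d(3), of "\<lambda>f. poly f x"] m(2) p(2) by simp
        then have "r = 0" using m_min[OF d(2)] d(4) by force
        then have "[:l ^ N:] * p = m * u" using d(3) by simp
        moreover have lN: "l ^ N \<in> R" using l by (intro is_subring_power R)
        ultimately have "\<phi> (l ^ N) * eval_at \<phi> \<omega> p = 0"
          using hom_onD(3)[OF E _ p(1), of "[:l ^ N:]"] hom_onD(3)[OF E m(1) d(1)] const[OF lN] \<omega>
          by simp
        then show ?thesis using \<phi>l hom_on_power[OF \<phi>(1) R l(1)] by simp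
      qed
      obtain \<psi> where \<psi>: "hom_on (adjoin R x) \<psi>"
        "\<And>q. q \<in> polys_over R \<Longrightarrow> \<psi> (poly q x) = eval_at \<phi> \<omega> q" "\<And>r. r \<in> R \<Longrightarrow> \<psi> r = \<phi> r"
        using hom_on_adjoin_exists[OF R \<phi>(1) rel] by blast
      have "poly v x \<in> adjoin R x" using v(1) by (auto simp: adjoin_def)
      then have "\<psi> (poly v x) * \<psi> b = \<phi> a"
        using hom_onD(3)[OF \<psi>(1) _ b(1), of "poly v x"] v(2,4) q(2) \<psi>(3) by simp
      then have "\<psi> b \<noteq> 0" using \<phi>a by auto
      then show "\<exists>\<psi>. hom_on (adjoin R x) \<psi> \<and> (\<forall>r\<in>R. \<psi> r = \<phi> r) \<and> \<psi> b \<noteq> 0"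
        using \<psi> by blast
    qed
  qed
qed

fun adjoin_list :: "'a::comm_semiring_0 set \<Rightarrow> 'a list \<Rightarrow> 'a set" where
  "adjoin_list R [] = R"
| "adjoin_list R (x # xs) = adjoin_list (adjoin R x) xs"

lemma is_subring_adjoin_list: "is_subring R \<Longrightarrow> is_subring (adjoin_list R xs)"
  by (induction xs arbitrary: R) (simp_all add: is_subring_adjoin)

lemma subset_adjoin_list: "is_subring R \<Longrightarrow> R \<subseteq> adjoin_list R xs"
proof (induction xs arbitrary: R)
  case (Cons x xs)
  then show ?case using subset_adjoin[of R x] is_subring_adjoin[of R x] by fastforce
qed simp

lemma set_subset_adjoin_list: "is_subring R \<Longrightarrow> set xs \<subseteq> adjoin_list R xs"
proof (induction xs arbitrary: R)
  case (Cons x xs)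
  then show ?case
    using mem_adjoin[of R x] is_subring_adjoin[of R x] subset_adjoin_list[of "adjoin R x" xs] by fastforce
qed simp

lemma adjoin_list_least:
  "is_subring R \<Longrightarrow> is_subring T \<Longrightarrow> R \<subseteq> T \<Longrightarrow> set xs \<subseteq> T \<Longrightarrow> adjoin_list R xs \<subseteq> T"
  by (induction xs arbitrary: R) (simp_all add: adjoin_least is_subring_adjoin)

lemma extend_hom_list:
  fixes xs :: "'w::idom list"
  assumes "is_subring R" "b \<in> adjoin_list R xs" "b \<noteq> 0"
  shows "\<exists>a\<in>R. a \<noteq> 0 \<and> (\<forall>\<phi> :: 'w \<Rightarrow> 'v::alg_closed_field. hom_on R \<phi> \<longrightarrow> \<phi> a \<noteq> 0 \<longrightarrow>
    (\<exists>\<psi>. hom_on (adjoin_list R xs) \<psi> \<and> (\<forall>r\<in>R. \<psi> r = \<phi> r) \<and> \<psi> b \<noteq> 0))"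
  using assms
proof (induction xs arbitrary: R)
  case (Cons x xs)
  note S = is_subring_adjoin[OF Cons.prems(1), of x]
  obtain c where c: "c \<in> adjoin R x" "c \<noteq> 0"
    and ext: "\<And>\<phi> :: 'w \<Rightarrow> 'v. hom_on (adjoin R x) \<phi> \<Longrightarrow> \<phi> c \<noteq> 0 \<Longrightarrow>
      \<exists>\<psi>. hom_on (adjoin_list (adjoin R x) xs) \<psi> \<and> (\<forall>r\<in>adjoin R x. \<psi> r = \<phi> r) \<and> \<psi> b \<noteq> 0"
    using Cons.IH[OF S] Cons.prems by auto
  obtain a where a: "a \<in> R" "a \<noteq> 0"
    and ext': "\<And>\<phi> :: 'w \<Rightarrow> 'v. hom_on R \<phi> \<Longrightarrow> \<phi> a \<noteq> 0 \<Longrightarrow>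
      \<exists>\<psi>. hom_on (adjoin R x) \<psi> \<and> (\<forall>r\<in>R. \<psi> r = \<phi> r) \<and> \<psi> c \<noteq> 0"
    using extend_hom_simple[OF Cons.prems(1) c] by blast
  have "\<exists>\<psi>. hom_on (adjoin_list R (x # xs)) \<psi> \<and> (\<forall>r\<in>R. \<psi> r = \<phi> r) \<and> \<psi> b \<noteq> 0"
    if \<phi>: "hom_on R \<phi>" "\<phi> a \<noteq> 0" for \<phi> :: "'w \<Rightarrow> 'v"
  proof -
    obtain \<phi>' where \<phi>': "hom_on (adjoin R x) \<phi>'" "\<forall>r\<in>R. \<phi>' r = \<phi> r" "\<phi>' c \<noteq> 0"
      using ext'[OF \<phi>] by blast
    obtain \<psi> where "hom_on (adjoin_list (adjoin R x) xs) \<psi>" "\<forall>r\<in>adjoin R x. \<psi> r = \<phi>' r" "\<psi> b \<noteq> 0"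
      using ext[OF \<phi>'(1,3)] by blast
    then show ?thesis
      using \<phi>'(2) subset_adjoin[OF Cons.prems(1), of x]
      by (intro exI[of _ \<psi>]) (auto simp: subset_iff)
  qed
  then show ?case using a by blast
qed auto


lemma hom_on_subset: "hom_on S h \<Longrightarrow> R \<subseteq> S \<Longrightarrow> hom_on R h"
  by (auto simp: hom_on_def)

lemma adjoin_list_image:
  assumes R: "is_subring R" and \<psi>: "hom_on (adjoin_list R xs) \<psi>"
  shows "\<psi> ` adjoin_list R xs = adjoin_list (\<psi> ` R) (map \<psi> xs)"
proof -
  note B = is_subring_adjoin_list[OF R, of xs]
  note \<psi>R = hom_on_image_subring[OF hom_on_subset[OF \<psi> subset_adjoin_list[OF R]] R]
  note B' = is_subring_adjoin_list[OF \<psi>R, of "map \<psi> xs"]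
  have "adjoin_list R xs \<subseteq> {y \<in> adjoin_list R xs. \<psi> y \<in> adjoin_list (\<psi> ` R) (map \<psi> xs)}"
  proof (rule adjoin_list_least[OF R])
    show "is_subring {y \<in> adjoin_list R xs. \<psi> y \<in> adjoin_list (\<psi> ` R) (map \<psi> xs)}"
      using is_subringD[OF B] is_subringD[OF B'] hom_onD[OF \<psi>] hom_on_0[OF \<psi> B]
        hom_on_minus[OF \<psi> B]
      by (simp add: is_subring_def)
    show "R \<subseteq> {y \<in> adjoin_list R xs. \<psi> y \<in> adjoin_list (\<psi> ` R) (map \<psi> xs)}"
      using subset_adjoin_list[OF R] subset_adjoin_list[OF \<psi>R] by (auto simp: subset_iff)
    show "set xs \<subseteq> {y \<in> adjoin_list R xs. \<psi> y \<in> adjoin_list (\<psi> ` R) (map \<psi> xs)}"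
      using set_subset_adjoin_list[OF R, of xs] set_subset_adjoin_list[OF \<psi>R, of "map \<psi> xs"] by auto
  qed
  moreover have "adjoin_list (\<psi> ` R) (map \<psi> xs) \<subseteq> \<psi> ` adjoin_list R xs"
  proof (rule adjoin_list_least[OF \<psi>R hom_on_image_subring[OF \<psi> B]])
    show "\<psi> ` R \<subseteq> \<psi> ` adjoin_list R xs" by (intro image_mono subset_adjoin_list[OF R])
    show "set (map \<psi> xs) \<subseteq> \<psi> ` adjoin_list R xs"
      using set_subset_adjoin_list[OF R, of xs] by auto
  qed
  ultimately show ?thesis by blast
qed

text \<open>
  A finitely generated domain over \<open>R\<close> that contains a transcendental element \<open>y\<close> is not a field
  over \<open>R\<close>: specializing \<open>y\<close> to an element \<open>\<omega>\<close> of \<open>R\<close> outside a finite set extends to the whole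
  domain, and kills \<open>y - \<omega>\<close>.
\<close>

lemma specialization_exists:
  fixes y :: "'w::alg_closed_field"
  assumes R0: "is_subring R0" "infinite R0" and R: "is_subring R" "R0 \<subseteq> R" "R \<subseteq> adjoin_list R0 xs"
    and y: "y \<in> adjoin_list R0 xs" "transcendental_over R y"
  obtains \<psi> z where "hom_on (adjoin_list R0 xs) \<psi>" "\<And>r. r \<in> R \<Longrightarrow> \<psi> r = r"
    "z \<in> adjoin_list R0 xs" "z \<noteq> 0" "\<psi> z = 0"
proof -
  note S = is_subring_adjoin[OF R(1), of y]
  have B: "adjoin_list (adjoin R y) xs = adjoin_list R0 xs"
  proof
    have "adjoin R y \<subseteq> adjoin_list R0 xs"
      using R y by (intro adjoin_least is_subring_adjoin_list R0)
    then show "adjoin_list (adjoin R y) xs \<subseteq> adjoin_list R0 xs"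
      using S by (intro adjoin_list_least is_subring_adjoin_list R0 set_subset_adjoin_list)
    show "adjoin_list R0 xs \<subseteq> adjoin_list (adjoin R y) xs"
      using S R subset_adjoin_list[OF S, of xs] subset_adjoin[OF R(1), of y]
      by (intro adjoin_list_least is_subring_adjoin_list R0 set_subset_adjoin_list) auto
  qed
  have "1 \<in> adjoin_list (adjoin R y) xs" by (intro is_subringD(2) is_subring_adjoin_list S)
  then have "\<exists>a\<in>adjoin R y. a \<noteq> 0 \<and> (\<forall>\<phi> :: 'w \<Rightarrow> 'w. hom_on (adjoin R y) \<phi> \<longrightarrow> \<phi> a \<noteq> 0 \<longrightarrow>
    (\<exists>\<psi>. hom_on (adjoin_list R0 xs) \<psi> \<and> (\<forall>r\<in>adjoin R y. \<psi> r = \<phi> r) \<and> \<psi> 1 \<noteq> 0))"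
    using extend_hom_list[OF S, of 1 xs] unfolding B by simp
  then obtain a where a: "a \<in> adjoin R y" "a \<noteq> 0"
    and ext: "\<And>\<phi> :: 'w \<Rightarrow> 'w. hom_on (adjoin R y) \<phi> \<Longrightarrow> \<phi> a \<noteq> 0 \<Longrightarrow>
      \<exists>\<psi>. hom_on (adjoin_list R0 xs) \<psi> \<and> (\<forall>r\<in>adjoin R y. \<psi> r = \<phi> r)"
    by blast
  obtain q where q: "q \<in> polys_over R" "a = poly q y" using a(1) by (auto simp: adjoin_def)
  have "q \<noteq> 0" using q a(2) by auto
  then have "finite {\<omega>. poly q \<omega> = 0}" by (rule poly_roots_finite)
  then have "infinite (R0 - {\<omega>. poly q \<omega> = 0})" using R0(2) by (rule Diff_infinite_finite)
  then have "R0 - {\<omega>. poly q \<omega> = 0} \<noteq> {}" by (rule infinite_imp_nonempty)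
  then obtain \<omega> where \<omega>: "\<omega> \<in> R0" "poly q \<omega> \<noteq> 0" by blast
  have id: "hom_on R (\<lambda>a. a)" by (simp add: hom_on_def)
  have rel: "eval_at (\<lambda>a. a) \<omega> q = 0" if "q \<in> polys_over R" "poly q y = 0" for q
    using transcendental_overD[OF y(2) that] by simp
  obtain \<phi> where \<phi>: "hom_on (adjoin R y) \<phi>"
    "\<And>q. q \<in> polys_over R \<Longrightarrow> \<phi> (poly q y) = poly q \<omega>" "\<And>r. r \<in> R \<Longrightarrow> \<phi> r = r"
    using hom_on_adjoin_exists[OF R(1) id rel] unfolding eval_at_id by blast
  have "\<phi> a \<noteq> 0" using \<phi>(2)[OF q(1)] q(2) \<omega>(2) by simp
  then obtain \<psi> where \<psi>: "hom_on (adjoin_list R0 xs) \<psi>" "\<forall>r\<in>adjoin R y. \<psi> r = \<phi> r"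
    using ext[OF \<phi>(1)] by blast
  have \<omega>R: "\<omega> \<in> R" using \<omega>(1) R(2) by blast
  then have p: "[:- \<omega>, 1:] \<in> polys_over R" using R(1) by (simp add: is_subringD)
  have z: "y - \<omega> = poly [:- \<omega>, 1:] y" by simp
  have zmem: "y - \<omega> \<in> adjoin R y" unfolding z adjoin_def using p by blast
  show thesis
  proof (rule that[of \<psi> "y - \<omega>"])
    show "hom_on (adjoin_list R0 xs) \<psi>" by (rule \<psi>(1))
    show "r \<in> R \<Longrightarrow> \<psi> r = r" for r using \<psi>(2) \<phi>(3) subset_adjoin[OF R(1), of y] by auto
    show "y - \<omega> \<in> adjoin_list R0 xs"
      using zmem subset_adjoin_list[OF S, of xs] B by blast
    show "y - \<omega> \<noteq> 0" using transcendental_overD[OF y(2) p] by auto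
    have "\<phi> (y - \<omega>) = 0" unfolding z \<phi>(2)[OF p] by simp
    then show "\<psi> (y - \<omega>) = 0" using \<psi>(2) zmem by simp
  qed
qed

text \<open>
  A specialization that fixes \<open>R n\<close> and kills a nonzero element uses up the top step of the tower. Its
  image is again finitely generated and contains the rest of the tower, so specializations can be composed
  until the tower is exhausted; each one strictly enlarges the kernel.
\<close>

lemma specialization_chain_exists:
  fixes R :: "nat \<Rightarrow> 'w::alg_closed_field set"
  assumes "infinite (R 0)" "\<And>i. i \<le> n \<Longrightarrow> is_subring (R i)" "\<And>i. i < n \<Longrightarrow> R i \<subseteq> R (Suc i)"
    and "R n \<subseteq> adjoin_list (R 0) xs" "\<And>i. i < n \<Longrightarrow> \<exists>y\<in>R (Suc i). transcendental_over (R i) y"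
  shows "\<exists>\<Psi> :: nat \<Rightarrow> 'w \<Rightarrow> 'w. (\<forall>i\<le>n. hom_on (adjoin_list (R 0) xs) (\<Psi> i)) \<and>
    (\<forall>i<n. {b \<in> adjoin_list (R 0) xs. \<Psi> i b = 0} \<subset> {b \<in> adjoin_list (R 0) xs. \<Psi> (Suc i) b = 0})"
  using assms
proof (induction n arbitrary: xs)
  case 0
  show ?case by (intro exI[of _ "\<lambda>_ x. x"]) (simp add: hom_on_def)
next
  case (Suc n)
  let ?B = "adjoin_list (R 0) xs"
  have R0: "is_subring (R 0)" using Suc.prems(2) by simp
  obtain y where y: "y \<in> R (Suc n)" "transcendental_over (R n) y" using Suc.prems(5) by blast
  have "R 0 \<subseteq> R j" if "j \<le> n" for j
    using that
  proof (induction j)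
    case (Suc j)
    then show ?case using Suc.prems \<open>\<And>i. i < Suc n \<Longrightarrow> R i \<subseteq> R (Suc i)\<close>[of j] by auto
  qed simp
  then have R0n: "R 0 \<subseteq> R n" by simp
  have RnB: "R n \<subseteq> ?B" using Suc.prems(3)[of n] Suc.prems(4) by auto
  have yB: "y \<in> ?B" using y(1) Suc.prems(4) by auto
  obtain \<psi> z where \<psi>: "hom_on ?B \<psi>" "\<And>r. r \<in> R n \<Longrightarrow> \<psi> r = r" and z: "z \<in> ?B" "z \<noteq> 0" "\<psi> z = 0"
    using specialization_exists[OF R0 Suc.prems(1) _ R0n RnB yB y(2)] Suc.prems(2)[of n] by auto
  have "\<psi> ` R 0 = R 0" using R0n \<psi>(2) by (auto simp: subset_iff image_iff)
  then have img: "\<psi> ` ?B = adjoin_list (R 0) (map \<psi> xs)"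
    using adjoin_list_image[OF R0 \<psi>(1)] by simp
  have "r \<in> \<psi> ` ?B" if "r \<in> R n" for r
    using RnB \<psi>(2) that by (intro image_eqI[of _ _ r]) auto
  then have "R n \<subseteq> \<psi> ` ?B" by blast
  then obtain \<Psi> :: "nat \<Rightarrow> 'w \<Rightarrow> 'w" where \<Psi>: "\<forall>i\<le>n. hom_on (\<psi> ` ?B) (\<Psi> i)"
    "\<forall>i<n. {b \<in> \<psi> ` ?B. \<Psi> i b = 0} \<subset> {b \<in> \<psi> ` ?B. \<Psi> (Suc i) b = 0}"
    using Suc.IH[of "map \<psi> xs"] Suc.prems unfolding img by auto
  define \<Phi> where "\<Phi> i = (case i of 0 \<Rightarrow> (\<lambda>x. x) | Suc j \<Rightarrow> \<Psi> j \<circ> \<psi>)" for i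
  have \<Phi>: "\<Phi> 0 b = b" "\<Phi> (Suc j) b = \<Psi> j (\<psi> b)" for j b by (simp_all add: \<Phi>_def)
  have hom: "hom_on ?B (\<Phi> i)" if "i \<le> Suc n" for i
  proof (cases i)
    case 0
    then show ?thesis by (simp add: hom_on_def \<Phi>)
  next
    case (Suc j)
    then have "hom_on (\<psi> ` ?B) (\<Psi> j)" using that \<Psi>(1) by simp
    then have "hom_on ?B (\<Psi> j \<circ> \<psi>)" by (rule hom_on_comp[OF \<psi>(1)]) simp
    then show ?thesis by (simp add: Suc \<Phi>_def)
  qed
  moreover have "{b \<in> ?B. \<Phi> i b = 0} \<subset> {b \<in> ?B. \<Phi> (Suc i) b = 0}" if i: "i < Suc n" for i
  proof (cases i)
    case 0
    have "\<Phi> (Suc 0) 0 = 0" by (rule hom_on_0[OF hom is_subring_adjoin_list[OF R0]]) simp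
    moreover from this have "\<Phi> (Suc 0) z = 0"
      using hom_on_0[OF \<psi>(1) is_subring_adjoin_list[OF R0]] z(3) by (simp add: \<Phi>)
    ultimately have "{b \<in> ?B. \<Phi> 0 b = 0} \<subseteq> {b \<in> ?B. \<Phi> (Suc 0) b = 0}"
      "z \<in> {b \<in> ?B. \<Phi> (Suc 0) b = 0} - {b \<in> ?B. \<Phi> 0 b = 0}"
      using z(1,2) by (auto simp: \<Phi>(1))
    then show ?thesis unfolding 0 by blast
  next
    case (Suc j)
    then have "{b \<in> \<psi> ` ?B. \<Psi> j b = 0} \<subset> {b \<in> \<psi> ` ?B. \<Psi> (Suc j) b = 0}" using \<Psi>(2) i by simp
    then show ?thesis unfolding Suc \<Phi> by blast
  qed
  ultimately show ?case by blast
qed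

section \<open>Chains of prime ideals from towers of transcendental extensions\<close>

lemma prime_ideal_kernel:
  fixes h :: "'a::comm_ring_1 \<Rightarrow> 'c::idom"
  assumes "hom_on UNIV h"
  shows "prime_ideal {b. h b = 0}"
proof -
  have "1 \<notin> {b. h b = 0}" using hom_onD(1)[OF assms] by simp
  then have "{b. h b = 0} \<noteq> UNIV" by blast
  then show ?thesis
    using hom_on_0[OF assms is_subring_UNIV] hom_onD[OF assms]
    by (simp add: prime_ideal_def ring_ideal_def)
qed

lemma transcendental_over_image:
  assumes \<iota>: "hom_on UNIV \<iota>" "inj \<iota>" and y: "transcendental_over R y"
  shows "transcendental_over (\<iota> ` R) (\<iota> y)"
  unfolding transcendental_over_def
proof (intro ballI impI)
  note \<iota>0 = hom_on_0[OF \<iota>(1) is_subring_UNIV]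
  fix q assume q: "q \<in> polys_over (\<iota> ` R)" "poly q (\<iota> y) = 0"
  define p where "p = map_poly (inv_into UNIV \<iota>) q"
  have "inv_into UNIV \<iota> 0 = 0" using \<iota> \<iota>0 by (metis inv_f_f)
  then have p: "coeff p n \<in> R \<and> \<iota> (coeff p n) = coeff q n" for n
    using polys_overD[OF q(1), of n] \<iota>(2) by (auto simp: p_def coeff_map_poly)
  then have pq: "q = map_poly \<iota> p" by (intro poly_eqI) (simp add: coeff_map_poly \<iota>0)
  have "poly (map_poly \<iota> p) (\<iota> y) = \<iota> (poly p y)"
    by (induction p) (simp_all add: map_poly_pCons \<iota>0 hom_onD[OF \<iota>(1)])
  then have "\<iota> (poly p y) = \<iota> 0" using q(2) pq \<iota>0 by simp
  then have "poly p y = 0" by (rule injD[OF \<iota>(2)])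
  moreover have "p \<in> polys_over R" using p by (simp add: polys_over_def)
  ultimately have "p = 0" by (intro transcendental_overD[OF y])
  then show "q = 0" using pq by simp
qed

text \<open>
  One half of the equality of Krull dimension and transcendence degree. The domain embeds into the
  algebraic closure \<open>\<Omega>\<close> of its field of fractions, and the kernels of successive specializations within \<open>\<Omega>\<close>
  form the chain. As all specializations have values in the same field \<open>\<Omega>\<close>, they can be composed.
\<close>

theorem prime_chain_exists:
  fixes R :: "nat \<Rightarrow> 'b::idom set"
  assumes inf: "infinite (R 0)" and sub: "\<And>i. i \<le> n \<Longrightarrow> is_subring (R i)"
    and mono: "\<And>i. i < n \<Longrightarrow> R i \<subseteq> R (Suc i)"
    and fg: "adjoin_list (R 0) xs = UNIV"
    and trans: "\<And>i. i < n \<Longrightarrow> \<exists>y\<in>R (Suc i). transcendental_over (R i) y"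
  shows "\<exists>P :: nat \<Rightarrow> 'b set. (\<forall>i\<le>n. prime_ideal (P i)) \<and> (\<forall>i<n. P i \<subset> P (Suc i))"
proof -
  define \<iota> :: "'b \<Rightarrow> 'b fract alg_closure" where "\<iota> b = to_ac (Fract b 1)" for b
  have \<iota>: "hom_on UNIV \<iota>" by (simp add: hom_on_def \<iota>_def One_fract_def[symmetric] flip: to_ac_add to_ac_mult)
  have inj: "inj \<iota>" by (auto simp: inj_on_def \<iota>_def eq_fract)
  have all: "adjoin_list (\<iota> ` R 0) (map \<iota> xs) = range \<iota>"
    using adjoin_list_image[of "R 0" xs \<iota>] sub[of 0] \<iota> by (simp add: fg)
  have subring: "is_subring (\<iota> ` R i)" if "i \<le> n" for i
    using sub[OF that] \<iota> by (intro hom_on_image_subring) (auto intro: hom_on_subset)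
  have "infinite (\<iota> ` R 0)"
    using inf inj by (simp add: finite_image_iff inj_on_subset[of \<iota> UNIV])
  then obtain \<Psi> :: "nat \<Rightarrow> 'b fract alg_closure \<Rightarrow> 'b fract alg_closure" where
    \<Psi>: "\<forall>i\<le>n. hom_on (range \<iota>) (\<Psi> i)"
      "\<forall>i<n. {b \<in> range \<iota>. \<Psi> i b = 0} \<subset> {b \<in> range \<iota>. \<Psi> (Suc i) b = 0}"
    using specialization_chain_exists[of "\<lambda>i. \<iota> ` R i" n "map \<iota> xs"] subring mono trans
      transcendental_over_image[OF \<iota> inj]
    unfolding all by (auto simp: image_mono) blast
  show ?thesis
  proof (intro exI[of _ "\<lambda>i. {b. (\<Psi> i \<circ> \<iota>) b = 0}"] conjI allI impI)
    show "prime_ideal {b. (\<Psi> i \<circ> \<iota>) b = 0}" if "i \<le> n" for i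
      using \<Psi>(1) that by (intro prime_ideal_kernel hom_on_comp[OF \<iota>]) auto
    show "{b. (\<Psi> i \<circ> \<iota>) b = 0} \<subset> {b. (\<Psi> (Suc i) \<circ> \<iota>) b = 0}" if "i < n" for i
    proof -
      have "{b \<in> range \<iota>. \<Psi> i b = 0} \<subset> {b \<in> range \<iota>. \<Psi> (Suc i) b = 0}" using \<Psi>(2) that by simp
      then show ?thesis by auto
    qed
  qed
qed

section \<open>Unique factorization\<close>

lemma UFD_irreducible_factor:
  fixes x :: "'b::idom"
  assumes "is_UFD TYPE('b)" "x \<noteq> 0" "\<not> x dvd 1"
  obtains p where "irreducible p" "p dvd x"
proof -
  obtain F where F: "\<forall>p\<in>#F. irreducible p" "prod_mset F = x"
    using conjunct1[OF assms(1)[unfolded is_UFD_def]] assms(2,3) by auto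
  have "F \<noteq> {#}"
  proof
    assume "F = {#}"
    then have "x = 1" using F(2) by simp
    then show False using assms(3) by simp
  qed
  then obtain p where p: "p \<in># F" by blast
  show thesis
    by (rule that[of p]) (use F p dvd_prod_mset[OF p] in simp_all)
qed

lemma rel_mset_partner:
  assumes "rel_mset R M N" "x \<in># M"
  obtains y where "y \<in># N" "R x y"
proof -
  obtain xs ys where l: "mset xs = M" "mset ys = N" "list_all2 R xs ys"
    using assms(1) by (auto simp: rel_mset_def)
  have "x \<in> set xs" using assms(2) l(1) by auto
  then obtain i where i: "i < length xs" "xs ! i = x" by (auto simp: in_set_conv_nth)
  show thesis
  proof (rule that)
    have "i < length ys" using i(1) list_all2_lengthD[OF l(3)] by simp
    then have "ys ! i \<in> set ys" by simp
    then show "ys ! i \<in># N" using l(2) by auto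
    show "R x (ys ! i)" using list_all2_nthD[OF l(3) i(1)] i(2) by simp
  qed
qed

text \<open>
  The irreducible \<open>p\<close> is part of one factorization of \<open>x y\<close>; another one is the union of factorizations
  of \<open>x\<close> and \<open>y\<close>. Uniqueness matches \<open>p\<close>, up to a unit, with a factor of \<open>x\<close> or of \<open>y\<close>.
\<close>

lemma UFD_irreducible_dvd_mult:
  fixes p :: "'b::idom"
  assumes ufd: "is_UFD TYPE('b)" and p: "irreducible p" and dvd: "p dvd x * y"
  shows "p dvd x \<or> p dvd y"
proof -
  note ufd = ufd[unfolded is_UFD_def]
  have fac: "\<exists>F. (\<forall>p\<in>#F. irreducible p) \<and> prod_mset F = z" if "z \<noteq> 0" "\<not> z dvd 1" for z :: 'b
    using conjunct1[OF ufd] that by simp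
  have uniq: "rel_mset (\<lambda>p q. p dvd q \<and> q dvd p) F G"
    if "\<forall>p\<in>#F. irreducible p" "\<forall>p\<in>#G. irreducible p" "prod_mset F = prod_mset G" for F G :: "'b multiset"
    by (rule conjunct2[OF ufd, THEN spec, THEN spec, THEN mp, THEN mp, THEN mp]) (fact that)+
  consider "x * y = 0" | "x dvd 1" | "y dvd 1" | "x * y \<noteq> 0" "\<not> x dvd 1" "\<not> y dvd 1" by blast
  then show ?thesis
  proof cases
    case 1
    then show ?thesis by auto
  next
    case 2
    then have "x * y dvd y" using mult_dvd_mono[of x 1 y y] by simp
    then show ?thesis using dvd_trans[OF dvd] by simp
  next
    case 3
    then have "x * y dvd x" using mult_dvd_mono[of x x y 1] by simp
    then show ?thesis using dvd_trans[OF dvd] by simp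
  next
    case 4
    have "x \<noteq> 0" "y \<noteq> 0" using 4(1) by auto
    then obtain F G where FG: "\<forall>p\<in>#F. irreducible p" "prod_mset F = x"
      "\<forall>p\<in>#G. irreducible p" "prod_mset G = y"
      using fac[of x] fac[of y] 4 by blast
    obtain c where c: "x * y = p * c" using dvd by (elim dvdE)
    obtain H p' where H: "\<forall>p\<in>#H. irreducible p" "prod_mset H = x * y" "p' \<in># H" "p dvd p'"
    proof (cases "c dvd 1")
      case True
      then obtain d where d: "c * d = 1" by (metis dvdE)
      have "irreducible (p * c)"
      proof (rule irreducibleI)
        show "p * c \<noteq> 0" using c 4 by simp
        show "\<not> p * c dvd 1" using p by (metis dvd_mult_left irreducible_def)
        fix a b assume ab: "p * c = a * b"
        have "p = (p * c) * d" using d by (simp add: mult.assoc)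
        also have "\<dots> = a * (b * d)" by (simp add: ab mult.assoc)
        finally have "a dvd 1 \<or> b * d dvd 1" using irreducibleD[OF p] by blast
        then show "a dvd 1 \<or> b dvd 1" by (auto dest: dvd_mult_left)
      qed
      then show thesis by (intro that[of "{#p * c#}" "p * c"]) (simp_all add: c)
    next
      case False
      have "c \<noteq> 0" using c 4 by auto
      then obtain H where "\<forall>p\<in>#H. irreducible p" "prod_mset H = c" using fac False by blast
      then show thesis by (intro that[of "add_mset p H" p]) (simp_all add: c p)
    qed
    have "rel_mset (\<lambda>p q. p dvd q \<and> q dvd p) H (F + G)"
    proof (rule uniq)
      show "\<forall>p\<in>#H. irreducible p" by (rule H(1))
      show "\<forall>p\<in>#F + G. irreducible p" using FG(1,3) by auto
      show "prod_mset H = prod_mset (F + G)" using FG(2,4) H(2) by simp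
    qed
    then obtain q where q: "q \<in># F + G" "p' dvd q" using rel_mset_partner[OF _ H(3)] by blast
    then have "q \<in># F \<or> q \<in># G" by simp
    then have "q dvd x \<or> q dvd y"
      using dvd_prod_mset[of q F] dvd_prod_mset[of q G] FG(2,4) by blast
    then show ?thesis using dvd_trans[OF dvd_trans[OF H(4) q(2)]] by blast
  qed
qed

lemma UFD_prime_ideal:
  fixes p :: "'b::idom"
  assumes "is_UFD TYPE('b)" "irreducible p"
  shows "prime_ideal {x. p dvd x}"
proof -
  have 1: "{x. p dvd x} \<noteq> UNIV"
  proof
    assume "{x. p dvd x} = UNIV"
    then have "1 \<in> {x. p dvd x}" by simp
    then show False using assms(2) by (simp add: irreducible_def)
  qed
  have 2: "ring_ideal {x. p dvd x}" by (simp add: ring_ideal_def)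
  have 3: "\<forall>x y. x * y \<in> {x. p dvd x} \<longrightarrow> x \<in> {x. p dvd x} \<or> y \<in> {x. p dvd x}"
    unfolding mem_Collect_eq by (intro allI impI UFD_irreducible_dvd_mult[OF assms])
  show ?thesis unfolding prime_ideal_def by (intro conjI 1 2 3)
qed

section \<open>Krull dimension\<close>

definition prime_chain :: "nat \<Rightarrow> (nat \<Rightarrow> 'b::comm_ring_1 set) \<Rightarrow> bool" where
  "prime_chain n P \<longleftrightarrow> (\<forall>i\<le>n. prime_ideal (P i)) \<and> (\<forall>i<n. P i \<subset> P (Suc i))"

lemma krull_dim_le:
  assumes "\<And>n P. prime_chain n (P :: nat \<Rightarrow> 'b::comm_ring_1 set) \<Longrightarrow> n \<le> d"
  shows "krull_dim TYPE('b) \<le> enat d"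
  unfolding krull_dim_def
  by (rule Sup_least) (use assms in \<open>auto simp: prime_chain_def\<close>)

lemma krull_dim_ge:
  assumes "prime_chain n (P :: nat \<Rightarrow> 'b::comm_ring_1 set)"
  shows "enat n \<le> krull_dim TYPE('b)"
  unfolding krull_dim_def
  by (rule Sup_upper) (use assms in \<open>auto simp: prime_chain_def\<close>)

text \<open>
  A supremum of extended natural numbers that is a successor is attained.
\<close>

lemma krull_dim_Suc_chain_exists:
  assumes "krull_dim TYPE('b::comm_ring_1) = enat (Suc d)"
  obtains P :: "nat \<Rightarrow> 'b::comm_ring_1 set" where "prime_chain (Suc d) P"
proof (rule ccontr)
  assume "\<not> thesis"
  then have no: "\<not> prime_chain (Suc d) (P :: nat \<Rightarrow> 'b set)" for P using that by blast
  have "n \<le> d" if "prime_chain n P" for n and P :: "nat \<Rightarrow> 'b set"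
  proof (rule ccontr)
    assume "\<not> n \<le> d"
    then have "prime_chain (Suc d) P" using that by (simp add: prime_chain_def)
    then show False using no by simp
  qed
  then have "krull_dim TYPE('b) \<le> enat d" by (rule krull_dim_le)
  then show False using assms by simp
qed

lemma adjoin_range:
  assumes \<phi>: "hom_on UNIV \<phi>"
  shows "polys_over (range \<phi>) = range (map_poly \<phi>)" "adjoin (range \<phi>) x = range (eval_at \<phi> x)"
proof -
  note \<phi>0 = hom_on_0[OF \<phi> is_subring_UNIV]
  show "polys_over (range \<phi>) = range (map_poly \<phi>)"
  proof
    show "polys_over (range \<phi>) \<subseteq> range (map_poly \<phi>)"
    proof
      fix q assume "q \<in> polys_over (range \<phi>)"
      then show "q \<in> range (map_poly \<phi>)"
      proof (induction q)
        case (pCons a q)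
        have zero: "0 \<in> range \<phi>" using \<phi>0 by (metis rangeI)
        then have "a \<in> range \<phi>" "q \<in> range (map_poly \<phi>)" using pCons by simp_all
        then obtain r b where "a = \<phi> b" "q = map_poly \<phi> r" by blast
        then have "pCons a q = map_poly \<phi> (pCons b r)" by (simp add: map_poly_pCons \<phi>0)
        then show ?case by (rule range_eqI)
      qed (rule range_eqI[of _ _ 0], simp)
    qed
    show "range (map_poly \<phi>) \<subseteq> polys_over (range \<phi>)"
      by (auto simp: polys_over_def coeff_map_poly \<phi>0)
  qed
  then show "adjoin (range \<phi>) x = range (eval_at \<phi> x)"
    by (simp add: adjoin_def eval_at_def image_image)
qed

text \<open>
  A ring with two generators is a quotient of \<open>k[X,Y]\<close>, and the preimages of a chain of primes under
  a surjection form a chain of the same length.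
\<close>

lemma two_generated_no_prime_chain:
  fixes \<phi> :: "'k::alg_closed_field \<Rightarrow> 'b::comm_ring_1" and P :: "nat \<Rightarrow> 'b set"
  assumes \<phi>: "hom_on UNIV \<phi>" and gen: "adjoin (adjoin (range \<phi>) t) s = UNIV"
    and prime: "\<And>i. i \<le> 3 \<Longrightarrow> prime_ideal (P i)" and strict: "\<And>i. i < 3 \<Longrightarrow> P i \<subset> P (Suc i)"
  shows False
proof -
  let ?ev = "eval_at (eval_at \<phi> t) s"
  have h: "hom_on UNIV ?ev" by (intro hom_on_eval_UNIV \<phi>)
  have "surj ?ev"
    using gen adjoin_range[OF \<phi>] adjoin_range[OF hom_on_eval_UNIV[OF \<phi>, of t]] by simp
  show False
  proof (rule poly_poly_no_prime_chain[of "\<lambda>i. ?ev -` P i"])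
    show "prime_ideal (?ev -` P i)" if "i \<le> 3" for i
      by (intro prime_ideal_vimage h prime that)
    show "?ev -` P i \<subset> ?ev -` P (Suc i)" if i: "i < 3" for i
    proof -
      obtain b where b: "b \<in> P (Suc i)" "b \<notin> P i" using strict[OF i] by blast
      obtain F where "b = ?ev F" using surjD[OF \<open>surj ?ev\<close>] by blast
      then have "F \<in> ?ev -` P (Suc i)" "F \<notin> ?ev -` P i" using b by simp_all
      then show ?thesis using strict[OF i] by blast
    qed
  qed
qed

text \<open>
  Modulo an ideal containing \<open>t - c\<close> the value of \<open>F\<close> at \<open>(t, s)\<close> is the value of \<open>F(c, Y)\<close> at \<open>s\<close>.
\<close>

lemma reduce_two_variables:
  assumes \<phi>: "hom_on UNIV \<phi>" and P: "prime_ideal P" and t: "t - \<phi> c \<in> P"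
  shows "eval_at (eval_at \<phi> t) s F - eval_at \<phi> s (map_poly (\<lambda>q. poly q c) F) \<in> P"
proof (induction F)
  case (pCons q F)
  note \<phi>0 = hom_on_0[OF \<phi> is_subring_UNIV]
  note E = hom_onD(2,3)[OF hom_on_eval_UNIV[OF \<phi>, of t]]
  define \<kappa> where "\<kappa> = poly q c"
  obtain r where r: "q - [:\<kappa>:] = [:- c, 1:] * r"
  proof -
    have "poly (q - [:\<kappa>:]) c = 0" by (simp add: \<kappa>_def)
    then have "[:- c, 1:] dvd q - [:\<kappa>:]" by (simp only: poly_eq_0_iff_dvd)
    then show thesis using that by (elim dvdE)
  qed
  have "eval_at \<phi> t q = eval_at \<phi> t ([:- c, 1:] * r + [:\<kappa>:])" by (simp only: r[symmetric] diff_add_cancel)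
  also have "\<dots> = eval_at \<phi> t [:- c, 1:] * eval_at \<phi> t r + eval_at \<phi> t [:\<kappa>:]"
    by (simp only: E UNIV_I)
  also have "eval_at \<phi> t [:\<kappa>:] = \<phi> (poly q c)" by (simp add: \<phi>0 \<kappa>_def)
  also have "eval_at \<phi> t [:- c, 1:] = t - \<phi> c"
    using hom_on_minus[OF \<phi> is_subring_UNIV, of c] hom_onD(1)[OF \<phi>] by (simp add: \<phi>0)
  finally have "eval_at (eval_at \<phi> t) s (pCons q F) - eval_at \<phi> s (map_poly (\<lambda>q. poly q c) (pCons q F))
    = (t - \<phi> c) * eval_at \<phi> t r + s * (eval_at (eval_at \<phi> t) s F - eval_at \<phi> s (map_poly (\<lambda>q. poly q c) F))"
    by (simp add: map_poly_pCons \<phi>0 algebra_simps)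
  also have "\<dots> \<in> P"
    by (rule prime_idealD(2)[OF P prime_idealD(4)[OF P t] prime_idealD(3)[OF P pCons.IH]])
  finally show ?case .
qed (simp add: prime_idealD[OF P])

section \<open>Algebras over an algebraically closed field of characteristic zero\<close>

locale alg_closed_algebra = comm_algebra scale
  for scale :: "'k::{alg_closed_field, field_char_0} \<Rightarrow> 'b::idom \<Rightarrow> 'b"
begin

definition emb :: "'k \<Rightarrow> 'b" where
  "emb c = scale c 1"

abbreviation K :: "'b set" where
  "K \<equiv> range emb"

lemma scale_emb: "scale c x = emb c * x"
  using scale_mult_left[of c 1 x] by (simp add: emb_def)

lemma hom_on_emb: "hom_on UNIV emb"
  unfolding hom_on_def
proof (intro conjI ballI)
  show "emb 1 = 1" by (simp add: emb_def)
  show "emb (x + y) = emb x + emb y" for x y by (simp add: emb_def scale_left_distrib)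
  show "emb (x * y) = emb x * emb y" for x y
    using scale_scale[of x y 1] scale_emb[of x "emb y"] by (simp add: emb_def)
qed

lemma emb_simps [simp]: "emb 0 = 0" "emb 1 = 1" "emb (x + y) = emb x + emb y"
  "emb (x * y) = emb x * emb y" "emb (- x) = - emb x" "emb (x - y) = emb x - emb y"
  using hom_on_0[OF hom_on_emb is_subring_UNIV] hom_onD[OF hom_on_emb]
    hom_on_minus[OF hom_on_emb is_subring_UNIV] hom_on_diff[OF hom_on_emb is_subring_UNIV]
  by simp_all

lemma emb_inverse: "c \<noteq> 0 \<Longrightarrow> emb c * emb (inverse c) = 1"
  by (simp flip: emb_simps(4))

lemma emb_eq_0_iff [simp]: "emb c = 0 \<longleftrightarrow> c = 0"
proof
  assume e: "emb c = 0"
  show "c = 0"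
  proof (rule ccontr)
    assume "c \<noteq> 0"
    from emb_inverse[OF this] show False by (simp add: e)
  qed
qed simp

lemma inj_emb: "inj emb"
proof (rule injI)
  fix x y assume "emb x = emb y"
  then have "emb (x - y) = 0" by simp
  then show "x = y" by (simp only: emb_eq_0_iff) simp
qed

lemma emb_of_nat: "emb (of_nat n) = of_nat n"
  by (induction n) simp_all

lemma is_subring_K: "is_subring K"
  using hom_on_image_subring[OF hom_on_emb is_subring_UNIV] .

lemma infinite_K: "infinite K"
proof -
  have "infinite (UNIV :: 'k set)" by (rule infinite_UNIV_char_0)
  then show ?thesis using inj_emb finite_imageD by blast
qed

lemma scalars_eq: "scalars scale = K"
  by (simp add: scalars_def emb_def)

lemma rational_UNIV: "n > 0 \<Longrightarrow> \<exists>u\<in>UNIV. of_nat n * u = (1 :: 'b)"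
  using emb_inverse[of "of_nat n"] by (auto simp: emb_of_nat)

lemma LND_imp_lnd_subring:
  assumes "D \<in> LND scale"
  shows "lnd_subring UNIV D"
proof -
  have der: "derivation scale D" using assms by (simp add: LND_def)
  then interpret lin: Vector_Spaces.linear scale scale D by (simp add: derivation_def)
  show ?thesis
  proof
    show "D (a * b) = a * D b + D a * b" for a b using der by (simp add: derivation_def)
    show "\<exists>n. (D ^^ n) a = 0" for a using assms by (auto simp: LND_def)
    show "n > 0 \<Longrightarrow> \<exists>u\<in>UNIV. of_nat n * u = (1 :: 'b)" for n by (rule rational_UNIV)
  qed (simp_all add: is_subring_UNIV lin.add)
qed

lemma is_subring_imp_subalgebra:
  assumes "is_subring S" "K \<subseteq> S"
  shows "subalgebra scale S"
proof -
  have "emb c \<in> S" for c using assms(2) by auto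
  then show ?thesis using assms(1) by (simp add: Defs.subalgebra_def scale_emb is_subring_def)
qed

lemma finitely_generated_adjoin_list:
  assumes "finitely_generated_algebra scale"
  obtains xs where "adjoin_list K xs = UNIV"
proof -
  obtain S where S: "finite S" "subalgebra scale hull S = UNIV"
    using assms by (auto simp: finitely_generated_algebra_def)
  obtain xs where xs: "set xs = S" using finite_list[OF S(1)] by blast
  have "subalgebra scale (adjoin_list K xs)"
    by (intro is_subring_imp_subalgebra is_subring_adjoin_list is_subring_K subset_adjoin_list)
  then have "subalgebra scale hull S \<subseteq> adjoin_list K xs"
    using set_subset_adjoin_list[OF is_subring_K, of xs] by (intro hull_minimal) (simp_all add: xs)
  then show thesis using that S(2) by blast
qed

text \<open>
  A unit divides \<open>1\<close>, which lies in the factorially closed kernel.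
\<close>

lemma lnd_kills_units:
  assumes "lnd_subring A D" "u \<in> A" "v \<in> A" "u * v = 1"
  shows "D u = 0"
proof -
  interpret lnd_subring A D by fact
  show ?thesis using ker_factor[of u v] assms by simp
qed

lemma lnd_kills_K:
  assumes "lnd_subring A D" "K \<subseteq> A"
  shows "D (emb c) = 0"
proof (cases "c = 0")
  case True
  interpret lnd_subring A D by fact
  show ?thesis using True by simp
next
  case False
  then show ?thesis
    using lnd_kills_units[OF assms(1), of "emb c" "emb (inverse c)"] emb_inverse assms(2) by auto
qed

lemma trivial_ML_units:
  assumes "makar_limanov scale = K" "u dvd 1"
  shows "u \<in> K"
proof -
  obtain v where "u * v = 1" using assms(2) by (metis dvdE)
  then have "D u = 0" if "D \<in> LND scale" for D
    using lnd_kills_units[OF LND_imp_lnd_subring[OF that]] by simp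
  then show ?thesis using assms(1) by (auto simp: makar_limanov_def)
qed

text \<open>
  When \<open>s\<close> is transcendental over \<open>A\<close> and \<open>B = A[s]\<close>, this identifies \<open>B\<close> with the polynomials over
  \<open>A\<close>, and a derivation of \<open>B\<close> becomes one of the polynomial ring.
\<close>

definition poly_repr :: "'b set \<Rightarrow> 'b \<Rightarrow> 'b \<Rightarrow> 'b poly" where
  "poly_repr A s = inv_into (polys_over A) (\<lambda>q. poly q s)"

context
  fixes A :: "'b set" and s :: 'b
  assumes A: "is_subring A" and gen: "adjoin A s = UNIV" and trans: "transcendental_over A s"
begin

lemma poly_repr_mem: "poly_repr A s b \<in> polys_over A"
  and poly_poly_repr: "poly (poly_repr A s b) s = b"
proof -
  have "b \<in> (\<lambda>q. poly q s) ` polys_over A" using gen by (simp add: adjoin_def)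
  then show "poly_repr A s b \<in> polys_over A" "poly (poly_repr A s b) s = b"
    unfolding poly_repr_def by (rule inv_into_into, rule f_inv_into_f)
qed

lemma poly_repr_eqI: "q \<in> polys_over A \<Longrightarrow> poly q s = b \<Longrightarrow> poly_repr A s b = q"
  by (rule transcendental_over_inj[OF trans A]) (simp_all add: poly_repr_mem poly_poly_repr)

lemma lnd_poly_repr:
  assumes "lnd_subring UNIV D" "K \<subseteq> A"
  shows "lnd_subring (polys_over A) (\<lambda>q. poly_repr A s (D (poly q s)))"
proof -
  interpret lnd_subring UNIV D by fact
  let ?D = "\<lambda>q. poly_repr A s (D (poly q s))"
  note PA = is_subring_polys_over[OF A]
  show ?thesis
  proof
    show "is_subring (polys_over A)" by (rule PA)
    show "\<exists>u\<in>polys_over A. of_nat n * u = 1" if "n > 0" for n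
    proof
      have "(of_nat n :: 'k) \<noteq> 0" using that by simp
      then have "of_nat n * emb (inverse (of_nat n)) = 1"
        using emb_inverse[of "of_nat n"] by (simp add: emb_of_nat)
      then show "of_nat n * [:emb (inverse (of_nat n)):] = 1"
        by (simp add: of_nat_poly one_pCons mult.commute)
      show "[:emb (inverse (of_nat n)):] \<in> polys_over A" using assms(2) A by (auto simp: is_subringD)
    qed
    show "?D q \<in> polys_over A" for q by (rule poly_repr_mem)
    show "?D (p + q) = ?D p + ?D q" if "p \<in> polys_over A" "q \<in> polys_over A" for p q
      by (intro poly_repr_eqI is_subringD[OF PA] poly_repr_mem) (simp add: poly_poly_repr additive)
    show "?D (p * q) = p * ?D q + ?D p * q" if "p \<in> polys_over A" "q \<in> polys_over A" for p q
      by (intro poly_repr_eqI is_subringD[OF PA] poly_repr_mem that)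
        (simp add: poly_poly_repr leibniz)
    show "\<exists>n. (?D ^^ n) q = 0" if q: "q \<in> polys_over A" for q
    proof -
      obtain n where n: "(D ^^ n) (poly q s) = 0" using nilpotent by blast
      have "(?D ^^ m) q = poly_repr A s ((D ^^ m) (poly q s))" for m
        using poly_repr_eqI[OF q refl] by (induction m) (simp_all add: poly_poly_repr)
      then have "(?D ^^ n) q = poly_repr A s 0" by (simp add: n)
      also have "\<dots> = 0" by (rule poly_repr_eqI) (simp_all add: is_subringD[OF PA])
      finally show ?thesis by blast
    qed
  qed
qed

text \<open>
  The elements \<open>a\<close> of \<open>A\<close> with \<open>D a\<close> of degree at most \<open>N\<close> form a subalgebra by the product rule. For
  large \<open>N\<close> it contains the coefficients of the finitely many generators of \<open>B\<close>, and these generate \<open>A\<close>.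
\<close>

lemma degree_bound_on_coefficients:
  assumes fg: "adjoin_list K xs = UNIV" and KA: "K \<subseteq> A" and D: "lnd_subring UNIV D"
  shows "\<exists>N. \<forall>a\<in>A. degree (poly_repr A s (D a)) \<le> N"
proof -
  interpret lnd_subring UNIV D by fact
  note PA = is_subring_polys_over[OF A]
  define Z where "Z = (\<Union>x\<in>set xs. set (coeffs (poly_repr A s x)))"
  define N where "N = Max (insert 0 ((\<lambda>a. degree (poly_repr A s (D a))) ` Z))"
  have fin: "finite Z" by (simp add: Z_def)
  define A0 where "A0 = {a \<in> A. degree (poly_repr A s (D a)) \<le> N}"
  have add: "poly_repr A s (a + b) = poly_repr A s a + poly_repr A s b" for a b
    by (intro poly_repr_eqI is_subringD[OF PA] poly_repr_mem) (simp add: poly_poly_repr)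
  have minus: "poly_repr A s (- a) = - poly_repr A s a" for a
    by (intro poly_repr_eqI is_subringD[OF PA] poly_repr_mem) (simp add: poly_poly_repr)
  have smult: "poly_repr A s (c * a) = smult c (poly_repr A s a)" if "c \<in> A" for a c
    by (intro poly_repr_eqI polys_over_smult A that poly_repr_mem) (simp add: poly_poly_repr)
  have zero: "poly_repr A s 0 = 0"
    by (rule poly_repr_eqI) (simp_all add: is_subringD[OF PA])
  have "is_subring A0"
    unfolding is_subring_def A0_def
  proof (intro conjI ballI CollectI)
    fix x y assume x: "x \<in> {a \<in> A. degree (poly_repr A s (D a)) \<le> N}"
      and y: "y \<in> {a \<in> A. degree (poly_repr A s (D a)) \<le> N}"
    show "x + y \<in> A" "x * y \<in> A" using x y A by (simp_all add: is_subringD)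
    show "degree (poly_repr A s (D (x + y))) \<le> N"
      using x y by (simp add: additive add degree_add_le)
    have "D (x * y) = x * D y + y * D x" by (simp add: leibniz mult.commute)
    then show "degree (poly_repr A s (D (x * y))) \<le> N"
      using x y by (auto simp: add smult intro!: degree_add_le order_trans[OF degree_smult_le])
  next
    fix x assume x: "x \<in> {a \<in> A. degree (poly_repr A s (D a)) \<le> N}"
    show "- x \<in> A" "degree (poly_repr A s (D (- x))) \<le> N"
      using x A by (simp_all add: is_subringD D_minus minus)
  qed (simp_all add: zero is_subringD[OF A])
  have "K \<subseteq> A0" using KA lnd_kills_K[OF D] zero by (auto simp: A0_def)
  have coeffs: "coeff (poly_repr A s x) n \<in> A0" if "x \<in> set xs" for x n
  proof (cases "coeff (poly_repr A s x) n = 0")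
    case True
    then show ?thesis using is_subringD(1)[OF \<open>is_subring A0\<close>] by simp
  next
    case False
    then have "coeff (poly_repr A s x) n \<in> Z"
      using that unfolding Z_def by (metis UN_I coeff_in_coeffs coeff_0 le_degree)
    then have "degree (poly_repr A s (D (coeff (poly_repr A s x) n))) \<le> N"
      using fin unfolding N_def by (intro Max_ge) auto
    then show ?thesis using polys_overD[OF poly_repr_mem] by (simp add: A0_def)
  qed
  have "UNIV \<subseteq> adjoin A0 s"
    unfolding fg[symmetric]
  proof (rule adjoin_list_least[OF is_subring_K is_subring_adjoin[OF \<open>is_subring A0\<close>]])
    show "K \<subseteq> adjoin A0 s" using \<open>K \<subseteq> A0\<close> subset_adjoin[OF \<open>is_subring A0\<close>] by blast
    show "set xs \<subseteq> adjoin A0 s"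
    proof
      fix x assume "x \<in> set xs"
      then have "poly_repr A s x \<in> polys_over A0" using coeffs by (simp add: polys_over_def)
      then show "x \<in> adjoin A0 s"
        unfolding adjoin_def by (rule rev_image_eqI) (simp add: poly_poly_repr)
    qed
  qed
  have "a \<in> A0" if a: "a \<in> A" for a
  proof -
    obtain q where q: "q \<in> polys_over A0" "a = poly q s"
      using \<open>UNIV \<subseteq> adjoin A0 s\<close> by (auto simp: adjoin_def)
    have "q \<in> polys_over A" using q(1) by (auto simp: polys_over_def A0_def)
    then have "poly_repr A s a = q" using q(2) by (intro poly_repr_eqI) simp_all
    moreover have "poly_repr A s a = [:a:]"
      using a A by (intro poly_repr_eqI) (simp_all add: is_subringD)
    ultimately have "q = [:a:]" by simp
    then show ?thesis using polys_overD[OF q(1), of 0] by simp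
  qed
  then show ?thesis by (auto simp: A0_def)
qed

end

end

section \<open>Prime elements whose residue ring is the ground field\<close>

context alg_closed_algebra
begin

text \<open>
  Writing \<open>q = c + p q'\<close> with a constant \<open>c\<close> lowers the degree with respect to \<open>D\<close>, because \<open>p\<close> is not
  killed by \<open>D\<close>. So repeated division by \<open>p\<close> ends and expresses \<open>q\<close> as a polynomial in \<open>p\<close>.
\<close>

lemma generated_by_prime:
  assumes D: "lnd_subring UNIV D" "D p \<noteq> 0"
    and C: "is_subring C" "K \<subseteq> C" "p \<in> C" "\<And>x y. x * y \<in> C \<Longrightarrow> x * y \<noteq> 0 \<Longrightarrow> y \<in> C"
    and const: "\<And>q. q \<in> C \<Longrightarrow> \<exists>c. p dvd q - emb c"
  shows "C = adjoin K p"
proof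
  interpret lnd_subring UNIV D by fact
  have p0: "p \<noteq> 0" using D(2) by auto
  have degp: "deg p > 0" using D(2) deg_eq_0_iff[of p] by simp
  note S = is_subring_adjoin[OF is_subring_K, of p]
  show "C \<subseteq> adjoin K p"
  proof
    fix q assume "q \<in> C"
    then show "q \<in> adjoin K p"
    proof (induction "deg q" arbitrary: q rule: less_induct)
      case less
      obtain c q' where q': "q - emb c = p * q'" using const[OF less.prems] by (metis dvdE)
      then have q: "q = p * q' + emb c" by (metis diff_add_cancel)
      have "q' \<in> adjoin K p"
      proof (cases "q' = 0")
        case True
        then show ?thesis using is_subringD(1)[OF S] by simp
      next
        case False
        have "p * q' \<in> C" using less.prems C(2) is_subringD(6)[OF C(1)] by (auto simp flip: q')
        then have "q' \<in> C" using C(4)[of p q'] p0 False by simp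
        moreover have "deg q = deg p + deg q'"
          using deg_diff_ker[of q "emb c"] deg_mult[of p q'] lnd_kills_K[OF D(1)] p0 False by (simp add: q')
        ultimately show ?thesis using less.hyps degp by simp
      qed
      then show ?case
        unfolding q using subset_adjoin[OF is_subring_K, of p]
        by (intro is_subringD(4,5)[OF S] mem_adjoin[OF is_subring_K]) auto
    qed
  qed
  show "adjoin K p \<subseteq> C" by (rule adjoin_least) (fact C)+
qed

lemma eval_two_range: "adjoin (adjoin K p) t = range (eval_at (eval_at emb p) t)"
  using adjoin_range[OF hom_on_emb] adjoin_range[OF hom_on_eval_UNIV[OF hom_on_emb, of p]] by simp

lemma eval_at_emb_linear: "eval_at emb x ([:- c, 1:] * q) = (x - emb c) * eval_at emb x q"
  using hom_onD(3)[OF hom_on_eval_UNIV[OF hom_on_emb, of x], of "[:- c, 1:]" q] by simp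

lemma eval_at_emb_power: "eval_at emb x (q ^ n) = eval_at emb x q ^ n"
  by (rule hom_on_power[OF hom_on_eval_UNIV[OF hom_on_emb] is_subring_UNIV]) simp

lemma eval_two_smult: "eval_at (eval_at emb p) t (smult q F) = eval_at emb p q * eval_at (eval_at emb p) t F"
  using hom_onD(3)[OF hom_on_eval_UNIV[OF hom_on_eval_UNIV[OF hom_on_emb]], of "[:q:]" F p t]
  by simp

lemma transcendental_over_K_inj:
  assumes "transcendental_over K p" "eval_at emb p g = eval_at emb p h"
  shows "g = h"
proof -
  have "map_poly emb g = map_poly emb h"
    using assms adjoin_range(1)[OF hom_on_emb]
    by (intro transcendental_over_inj[OF assms(1) is_subring_K]) (auto simp: eval_at_def)
  then have "coeff (map_poly emb g) n = coeff (map_poly emb h) n" for n by simp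
  then show ?thesis using inj_emb by (intro poly_eqI) (simp add: coeff_map_poly inj_eq)
qed

text \<open>
  An algebraic relation between \<open>p\<close> and \<open>q\<close>, cleared of powers of \<open>p\<close> and read modulo \<open>p\<close>, is a
  nonzero polynomial over the field with root \<open>q\<close>; one of its linear factors vanishes modulo \<open>p\<close>.
\<close>

lemma constant_modulo_prime:
  assumes P: "prime_ideal {x. p dvd x}" and p0: "p \<noteq> 0"
    and alg: "\<not> transcendental_over (adjoin K p) q"
  shows "\<exists>c. p dvd q - emb c"
proof -
  obtain f where f: "f \<in> polys_over (adjoin K p)" "poly f q = 0" "f \<noteq> 0"
    using alg by (auto simp: transcendental_over_def)
  obtain F where F: "f = map_poly (eval_at emb p) F"
  proof -
    have "f \<in> range (map_poly (eval_at emb p))"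
      using f(1) unfolding adjoin_range(2)[OF hom_on_emb]
        adjoin_range(1)[OF hom_on_eval_UNIV[OF hom_on_emb]] .
    then show thesis using that by blast
  qed
  have "F \<noteq> 0" using F f(3) by auto
  then obtain j G where G: "F = smult ([:- 0, 1:] ^ j) G" "map_poly (\<lambda>h. poly h 0) G \<noteq> 0"
    by (rule remove_linear_content)
  have "eval_at (eval_at emb p) q F = 0" using f(2) F by (simp add: eval_at_def[of "eval_at emb p"])
  then have "p ^ j * eval_at (eval_at emb p) q G = 0"
    using eval_at_emb_power[of p "[:0, 1:]" j] by (simp add: G(1) eval_two_smult)
  then have "eval_at (eval_at emb p) q G = 0" using p0 by simp
  moreover have "p - emb 0 \<in> {x. p dvd x}" by simp
  ultimately have "0 - eval_at emb q (map_poly (\<lambda>h. poly h 0) G) \<in> {x. p dvd x}"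
    using reduce_two_variables[OF hom_on_emb P, of p 0 q G] by simp
  then have "eval_at emb q (map_poly (\<lambda>h. poly h 0) G) \<in> {x. p dvd x}" by simp
  then show ?thesis using linear_in_prime_ideal[OF hom_on_emb P G(2)] by blast
qed

text \<open>
  A factorization of \<open>p - c\<close> takes place in \<open>k[p]\<close>, where it is a factorization of a linear
  polynomial.
\<close>

lemma irreducible_shift:
  assumes p: "transcendental_over K p"
    and fac: "\<And>x y. x * y \<in> adjoin K p \<Longrightarrow> x * y \<noteq> 0 \<Longrightarrow> y \<in> adjoin K p"
    and units: "\<And>u. u dvd 1 \<Longrightarrow> u \<in> K"
  shows "irreducible (p - emb c)"
proof (rule irreducibleI)
  have ev: "p - emb c = eval_at emb p [:- c, 1:]" by simp
  have notK: "p - emb c \<noteq> emb d" for d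
  proof
    assume "p - emb c = emb d"
    then have "eval_at emb p [:- c, 1:] = eval_at emb p [:d:]" by simp
    then have "[:- c, 1:] = [:d:]" by (rule transcendental_over_K_inj[OF p])
    then show False by simp
  qed
  show "p - emb c \<noteq> 0" using notK[of 0] by simp
  show "\<not> p - emb c dvd 1"
  proof
    assume "p - emb c dvd 1"
    from units[OF this] obtain d where "p - emb c = emb d" by (elim rangeE)
    then show False using notK by simp
  qed
  fix x y assume xy: "p - emb c = x * y"
  have "p - emb c \<in> adjoin K p"
    using subset_adjoin[OF is_subring_K, of p]
    by (intro is_subringD(6) is_subring_adjoin is_subring_K mem_adjoin) auto
  then have "x * y \<in> adjoin K p" unfolding xy .
  moreover have "x * y \<noteq> 0" using \<open>p - emb c \<noteq> 0\<close> unfolding xy .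
  ultimately have "y \<in> adjoin K p" "x \<in> adjoin K p"
    using fac[of x y] fac[of y x, unfolded mult.commute[of y x]] by blast+
  then obtain f g where fg: "x = eval_at emb p f" "y = eval_at emb p g"
    unfolding adjoin_range(2)[OF hom_on_emb] by blast
  have "eval_at emb p (f * g) = eval_at emb p [:- c, 1:]"
    using hom_onD(3)[OF hom_on_eval_UNIV[OF hom_on_emb, of p], of f g]
    unfolding ev[symmetric] xy fg by simp
  then have fg1: "f * g = [:- c, 1:]" by (rule transcendental_over_K_inj[OF p])
  have nz: "f \<noteq> 0" "g \<noteq> 0"
    using fg1 by (metis mult_zero_left mult_zero_right pCons_eq_0_iff zero_neq_one)+
  have unit: "eval_at emb p h dvd 1" if h: "degree h = 0" "h \<noteq> 0" for h
  proof -
    obtain a where a: "h = [:a:]" using degree_eq_zeroE[OF h(1)] .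
    then have "a \<noteq> 0" using h(2) by simp
    with a show ?thesis using emb_inverse[of a] by (intro dvdI[of _ _ "emb (inverse a)"]) simp
  qed
  have "degree f + degree g = 1" using arg_cong[OF fg1, of degree] nz by (simp add: degree_mult_eq)
  then consider "degree f = 0" | "degree g = 0" by linarith
  then show "x dvd 1 \<or> y dvd 1"
  proof cases
    case 1
    then show ?thesis using unit[OF 1 nz(1)] fg(1) by simp
  next
    case 2
    then show ?thesis using unit[OF 2 nz(2)] fg(2) by simp
  qed
qed

text \<open>
  An element of \<open>k[p,t]\<close> divisible by \<open>p - c\<close> is divisible by it within \<open>k[p,t]\<close>, unless \<open>t\<close> is constant
  modulo \<open>p - c\<close>: otherwise its reduction at \<open>p = c\<close> is a nonzero polynomial in \<open>t\<close> that vanishes modulo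
  the prime \<open>p - c\<close>. Cancelling the linear factors of \<open>g\<close> one by one clears the denominator \<open>g(p)\<close>.
\<close>

lemma cancel_denominator:
  assumes p: "transcendental_over K p"
    and prime: "\<And>c. prime_ideal {x. p - emb c dvd x}"
    and noconst: "\<And>c \<mu>. poly h c = 0 \<Longrightarrow> \<not> p - emb c dvd t - emb \<mu>"
    and g: "g \<noteq> 0" "\<And>c. poly g c = 0 \<Longrightarrow> poly h c = 0"
    and a: "eval_at emb p g * a \<in> adjoin (adjoin K p) t"
  shows "a \<in> adjoin (adjoin K p) t"
  using g a
proof (induction "degree g" arbitrary: g)
  case 0
  then obtain c where c: "g = [:c:]" "c \<noteq> 0" by (auto elim!: degree_eq_zeroE)
  let ?S = "adjoin (adjoin K p) t"
  note S0 = is_subring_adjoin[OF is_subring_K, of p] and S = is_subring_adjoin[OF is_subring_adjoin[OF is_subring_K, of p], of t]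
  have "emb (inverse c) \<in> ?S"
    using subset_adjoin[OF is_subring_K, of p] subset_adjoin[OF S0, of t] by auto
  then have "emb (inverse c) * (eval_at emb p g * a) \<in> ?S" by (rule is_subringD(5)[OF S _ 0(4)])
  also have "emb (inverse c) * (eval_at emb p g * a) = (emb c * emb (inverse c)) * a"
    by (simp add: c(1) mult_ac)
  finally show ?case using emb_inverse[OF c(2)] by simp
next
  case (Suc n)
  then obtain c where c: "poly g c = 0" using alg_closed_imp_poly_has_root[of g] by auto
  then obtain g' where g': "g = [:- c, 1:] * g'" by (auto simp: poly_eq_0_iff_dvd elim: dvdE)
  define b where "b = eval_at emb p g' * a"
  obtain F where F: "eval_at emb p g * a = eval_at (eval_at emb p) t F"
    using Suc.prems(3) unfolding eval_two_range by auto
  have b: "(p - emb c) * b = eval_at (eval_at emb p) t F"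
    using F by (simp add: g' eval_at_emb_linear b_def mult.assoc del: mult_pCons_left)
  have pc0: "p - emb c \<noteq> 0"
  proof
    assume "p - emb c = 0"
    then have "eval_at emb p [:- c, 1:] = eval_at emb p 0" by simp
    then have "[:- c, 1:] = 0" by (rule transcendental_over_K_inj[OF p])
    then show False by simp
  qed
  have "b \<in> adjoin (adjoin K p) t"
  proof (cases "F = 0")
    case True
    then have "b = 0" using b pc0 by simp
    then show ?thesis
      using is_subringD(1)[OF is_subring_adjoin[OF is_subring_adjoin[OF is_subring_K]]] by simp
  next
    case False
    have "map_poly (\<lambda>q. poly q c) F = 0"
    proof (rule ccontr)
      assume nz: "map_poly (\<lambda>q. poly q c) F \<noteq> 0"
      have 1: "eval_at (eval_at emb p) t F \<in> {x. p - emb c dvd x}" by (simp flip: b)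
      have 2: "eval_at (eval_at emb p) t F - eval_at emb t (map_poly (\<lambda>q. poly q c) F)
          \<in> {x. p - emb c dvd x}"
        by (rule reduce_two_variables[OF hom_on_emb prime]) simp
      have "eval_at emb t (map_poly (\<lambda>q. poly q c) F) \<in> {x. p - emb c dvd x}"
        using prime_idealD(5)[OF prime 1 2] by simp
      then obtain \<mu> where "t - emb \<mu> \<in> {x. p - emb c dvd x}"
        by (rule linear_in_prime_ideal[OF hom_on_emb prime nz])
      then show False using noconst[OF Suc.prems(2)[OF c]] by simp
    qed
    then obtain G where G: "F = smult [:- c, 1:] G"
      by (rule linear_dvd_coeffs)
    have "(p - emb c) * b = (p - emb c) * eval_at (eval_at emb p) t G"
      unfolding b G eval_two_smult using eval_at_emb_linear[of p c 1] hom_onD(1)[OF hom_on_eval_UNIV[OF hom_on_emb, of p]] by simp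
    then have "b = eval_at (eval_at emb p) t G" using pc0 by simp
    then show ?thesis unfolding eval_two_range by blast
  qed
  moreover have "g' \<noteq> 0" "n = degree g'"
    using Suc.prems(1) Suc.hyps(2) by (auto simp: g' degree_mult_eq simp del: mult_pCons_left)
  moreover have "poly h d = 0" if "poly g' d = 0" for d
    using Suc.prems(2)[of d] that by (simp add: g')
  ultimately show ?case unfolding b_def using Suc.hyps(1)[of g'] by blast
qed

end

section \<open>Three-dimensional factorial algebras with a slice and trivial Makar-Limanov invariant\<close>

context alg_closed_algebra
begin

text \<open>
  The slice theorem. Here \<open>D s = 1\<close>, so the denominators of a local slice are trivial.
\<close>

lemma slice_decomposition:
  assumes D: "lnd_subring UNIV D" "D s = 1"
  shows "is_subring {a. D a = 0}" "K \<subseteq> {a. D a = 0}" "adjoin {a. D a = 0} s = UNIV"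
    "transcendental_over {a. D a = 0} s"
    "\<And>x y. x * y \<noteq> 0 \<Longrightarrow> D (x * y) = 0 \<Longrightarrow> D y = 0"
proof -
  interpret lnd_subring UNIV D by (rule D)
  have ker: "{a. D a = 0} = ker" by (simp add: ker_def)
  show "is_subring {a. D a = 0}" unfolding ker by (rule is_subring_ker)
  show "K \<subseteq> {a. D a = 0}" using lnd_kills_K[OF D(1)] by auto
  show "transcendental_over {a. D a = 0} s" unfolding ker by (rule transcendental_over_ker) (simp_all add: D)
  have "b \<in> adjoin ker s" for b
    by (rule unit_local_slice_generates[of s 1]) (simp_all add: D is_subringD[OF is_subring_ker])
  then show "adjoin {a. D a = 0} s = UNIV" unfolding ker by blast
  show "D y = 0" if "x * y \<noteq> 0" "D (x * y) = 0" for x y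
    using ker_factor[of y x] that by (simp add: mult.commute)
qed

lemma kernel_factorially_closed:
  assumes \<delta>: "lnd_subring A \<delta>" and A: "\<And>x y. x * y \<in> A \<Longrightarrow> x * y \<noteq> 0 \<Longrightarrow> y \<in> A"
    and xy: "x * y \<in> lnd_subring.ker A \<delta>" "x * y \<noteq> 0"
  shows "y \<in> lnd_subring.ker A \<delta>"
proof -
  interpret lnd_subring A \<delta> by (rule \<delta>)
  have xyA: "x * y \<in> A" "\<delta> (y * x) = 0" using xy(1) by (simp_all add: ker_def mult.commute)
  have "y \<in> A" using A[OF xyA(1) xy(2)] .
  moreover have "x \<in> A" by (rule A[of y x]) (use xyA(1) xy(2) in \<open>simp_all add: mult.commute\<close>)
  moreover have "y * x \<noteq> 0" using xy(2) by (simp add: mult.commute)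
  ultimately show ?thesis using ker_factor[of y x] xyA(2) by (simp add: ker_def)
qed

text \<open>
  The identification of \<open>B\<close> with the polynomial ring over \<open>A\<close> turns \<open>D\<close> into a derivation to which
  \<open>nonzero_lnd_of_coefficients\<close> applies.
\<close>

lemma kernel_of_slice_has_lnd:
  assumes fg: "adjoin_list K xs = UNIV"
    and A: "is_subring A" "K \<subseteq> A" "adjoin A s = UNIV" "transcendental_over A s"
    and D: "lnd_subring UNIV D" "a \<in> A" "D a \<noteq> 0"
  shows "\<exists>\<delta>. lnd_subring A \<delta> \<and> (\<exists>a\<in>A. \<delta> a \<noteq> 0)"
proof -
  obtain N where N: "\<forall>a\<in>A. degree (poly_repr A s (D a)) \<le> N"
    using degree_bound_on_coefficients[OF A(1,3,4) fg A(2) D(1)] by blast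
  show ?thesis
  proof (rule nonzero_lnd_of_coefficients[OF A(1) _ lnd_poly_repr[OF A(1,3,4) D(1) A(2)] _ D(2)])
    show "\<exists>u\<in>A. of_nat n * u = 1" if "n > 0" for n
      using emb_inverse[of "of_nat n"] A(2) that by (intro bexI[of _ "emb (inverse (of_nat n))"]) (auto simp: emb_of_nat)
    show "degree (poly_repr A s (D (poly [:a:] s))) \<le> N" if "a \<in> A" for a using N that by simp
    show "poly_repr A s (D (poly [:a:] s)) \<noteq> 0"
    proof
      assume "poly_repr A s (D (poly [:a:] s)) = 0"
      then have "D a = 0" using poly_poly_repr[OF A(1,3,4), of "D a"] by simp
      then show False using D(3) by simp
    qed
  qed
qed

text \<open>
  The tower \<open>k \<subset> k[c] \<subset> C \<subset> A \<subset> B\<close> has four transcendental steps and would give a chain of five primes.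
\<close>

lemma tower_of_four_contradicts_dim_three:
  assumes dim: "krull_dim TYPE('b) = 3" and fg: "adjoin_list K xs = UNIV"
    and sub: "is_subring C" "is_subring A" "K \<subseteq> C" "C \<subseteq> A"
    and c: "c \<in> C" "transcendental_over K c" and q: "q \<in> C" "transcendental_over (adjoin K c) q"
    and t: "t \<in> A" "transcendental_over C t" and s: "transcendental_over A s"
  shows False
proof -
  define R where "R i = [K, adjoin K c, C, A, UNIV] ! i" for i
  have R: "R 0 = K" "R 1 = adjoin K c" "R 2 = C" "R 3 = A" "R 4 = UNIV"
    by (simp_all add: R_def numeral_eq_Suc)
  have le: "i \<le> 4 \<Longrightarrow> i = 0 \<or> i = 1 \<or> i = 2 \<or> i = 3 \<or> i = 4" for i :: nat by linarith
  have less: "i < 4 \<Longrightarrow> i = 0 \<or> i = 1 \<or> i = 2 \<or> i = 3" for i :: nat by linarith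
  have Suc: "Suc 0 = 1" "Suc 1 = 2" "Suc 2 = 3" "Suc 3 = 4" by simp_all
  have "\<exists>P :: nat \<Rightarrow> 'b set. (\<forall>i\<le>4. prime_ideal (P i)) \<and> (\<forall>i<4. P i \<subset> P (Suc i))"
  proof (rule prime_chain_exists)
    show "infinite (R 0)" unfolding R by (rule infinite_K)
    show "is_subring (R i)" if "i \<le> 4" for i
      using le[OF that] sub is_subring_K is_subring_adjoin[OF is_subring_K] is_subring_UNIV
      by (elim disjE) (simp_all only: R)
    have "adjoin K c \<subseteq> C" by (intro adjoin_least sub c)
    then show "R i \<subseteq> R (Suc i)" if "i < 4" for i
      using less[OF that] sub subset_adjoin[OF is_subring_K, of c]
      by (elim disjE) (simp_all only: R Suc subset_UNIV)
    show "adjoin_list (R 0) xs = UNIV" unfolding R by (rule fg)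
    \<comment> \<open>The transcendental elements of the four steps are \<open>c\<close>, \<open>q\<close>, \<open>t\<close> and \<open>s\<close>.\<close>
    show "\<exists>y\<in>R (Suc i). transcendental_over (R i) y" if "i < 4" for i
      using less[OF that]
    proof (elim disjE)
      assume "i = 0"
      then show ?thesis using c(2) mem_adjoin[OF is_subring_K, of c] by (auto simp only: R Suc)
    next
      assume "i = 1"
      then show ?thesis using q by (auto simp only: R Suc)
    next
      assume "i = 2"
      then show ?thesis using t by (auto simp only: R Suc)
    next
      assume "i = 3"
      then show ?thesis using s by (auto simp only: R Suc)
    qed
  qed
  then obtain P :: "nat \<Rightarrow> 'b set" where "prime_chain 4 P" by (auto simp: prime_chain_def)
  then have "enat 4 \<le> krull_dim TYPE('b)" by (rule krull_dim_ge)
  then show False using dim by (simp add: numeral_eq_enat)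
qed

lemma two_generators_contradict_dim_three:
  assumes dim: "krull_dim TYPE('b) = 3" and gen: "adjoin (adjoin K t) s = UNIV"
  shows False
proof -
  have "krull_dim TYPE('b) = enat (Suc 2)" using dim by (simp add: numeral_eq_enat)
  then obtain P :: "nat \<Rightarrow> 'b set" where "prime_chain (Suc 2) P" by (rule krull_dim_Suc_chain_exists)
  then show False
    using two_generated_no_prime_chain[OF hom_on_emb gen, of P] by (simp add: prime_chain_def)
qed

text \<open>
  An irreducible element \<open>p\<close> of \<open>B\<close> inside \<open>C\<close> exists because \<open>C\<close> is factorially closed. By algebraic
  dependence the elements of \<open>C\<close> are constant modulo \<open>p\<close>, and by the triviality of the Makar-Limanov
  invariant some derivation moves \<open>p\<close>; so \<open>p\<close> generates \<open>C\<close>.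
\<close>

lemma one_dimensional_UFD_is_polynomial_ring:
  assumes ufd: "is_UFD TYPE('b)" and ml: "makar_limanov scale = K"
    and C: "is_subring C" "K \<subset> C" "\<And>x y. x * y \<in> C \<Longrightarrow> x * y \<noteq> 0 \<Longrightarrow> y \<in> C"
    and dependent: "\<And>c q. c \<in> C \<Longrightarrow> transcendental_over K c \<Longrightarrow> q \<in> C \<Longrightarrow> \<not> transcendental_over (adjoin K c) q"
  obtains p where "transcendental_over K p" "C = adjoin K p"
proof -
  obtain c where c: "c \<in> C" "c \<notin> K" using C(2) by blast
  then have "c \<noteq> 0" using is_subringD(1)[OF is_subring_K] by blast
  have "\<not> c dvd 1" using trivial_ML_units[OF ml] c(2) by blast
  then obtain p where p: "irreducible p" "p dvd c"
    using UFD_irreducible_factor[OF ufd \<open>c \<noteq> 0\<close>] by blast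
  obtain d where "c = d * p" using p(2) by (metis dvdE mult.commute)
  then have "p \<in> C" using C(3)[of d p] c(1) \<open>c \<noteq> 0\<close> by simp
  have p0: "p \<noteq> 0" using p(1) by auto
  have "p \<notin> K"
  proof
    assume "p \<in> K"
    then obtain a where a: "p = emb a" by blast
    then have "a \<noteq> 0" using p0 by auto
    then have "p dvd 1" using emb_inverse[of a] a by (metis dvdI)
    then show False using p(1) by (simp add: irreducible_def)
  qed
  then have "p \<notin> makar_limanov scale" by (simp add: ml)
  then obtain D where D: "D \<in> LND scale" "D p \<noteq> 0" by (auto simp: makar_limanov_def)
  have lnd: "lnd_subring UNIV D" by (rule LND_imp_lnd_subring[OF D(1)])
  have trans: "transcendental_over K p"
  proof (rule transcendental_over_mono)
    show "transcendental_over (lnd_subring.ker UNIV D) p"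
      by (rule lnd_subring.transcendental_over_ker[OF lnd _ D(2)]) simp
    show "K \<subseteq> lnd_subring.ker UNIV D"
      using lnd_kills_K[OF lnd] by (auto simp: lnd_subring.ker_def[OF lnd])
  qed
  have "C = adjoin K p"
  proof (rule generated_by_prime[OF lnd D(2) C(1) _ \<open>p \<in> C\<close> C(3)])
    show "K \<subseteq> C" using C(2) by blast
    show "\<exists>c. p dvd q - emb c" if "q \<in> C" for q
      by (rule constant_modulo_prime[OF UFD_prime_ideal[OF ufd p(1)] p0 dependent[OF \<open>p \<in> C\<close> trans that]])
  qed
  then show thesis using that trans by blast
qed

text \<open>
  Let \<open>t\<close> be a local slice with \<open>\<delta> t = h(p)\<close> and \<open>h\<close> of least degree. Then no \<open>t - \<mu>\<close> is divisible by
  \<open>p - c\<close> for a root \<open>c\<close> of \<open>h\<close>, since the quotient would be a local slice with \<open>h\<close> replaced by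
  \<open>h / (X - c)\<close>. Hence the denominators, which are powers of \<open>h(p)\<close>, cancel.
\<close>

lemma kernel_polynomial_ring_imp_polynomial_ring:
  assumes ufd: "is_UFD TYPE('b)" and ml: "makar_limanov scale = K"
    and A: "K \<subseteq> A" "\<And>x y. x * y \<in> A \<Longrightarrow> x * y \<noteq> 0 \<Longrightarrow> y \<in> A"
    and \<delta>: "lnd_subring A \<delta>" "a0 \<in> A" "\<delta> a0 \<noteq> 0"
    and p: "transcendental_over K p" "{a \<in> A. \<delta> a = 0} = adjoin K p"
  obtains t where "t \<in> A" "transcendental_over (adjoin K p) t" "A = adjoin (adjoin K p) t"
proof -
  interpret lnd_subring A \<delta> by (rule \<delta>(1))
  have ker: "ker = adjoin K p" using p(2) by (simp add: ker_def)
  have facC: "y \<in> adjoin K p" if "x * y \<in> adjoin K p" "x * y \<noteq> 0" for x y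
  proof -
    have "x * y \<in> ker" using that(1) ker by simp
    from kernel_factorially_closed[OF \<delta>(1) _ this that(2)] have "y \<in> ker" using A(2) by blast
    then show ?thesis using ker by simp
  qed
  have prime: "prime_ideal {x. p - emb c dvd x}" for c
  proof (rule UFD_prime_ideal[OF ufd irreducible_shift[OF p(1)]])
    show "y \<in> adjoin K p" if "x * y \<in> adjoin K p" "x * y \<noteq> 0" for x y
      using that by (rule facC)
    show "u \<in> K" if "u dvd 1" for u using that by (rule trivial_ML_units[OF ml])
  qed
  obtain t0 where t0: "t0 \<in> A" "\<delta> t0 \<noteq> 0" "\<delta> (\<delta> t0) = 0" using local_slice_exists[OF \<delta>(2,3)] .
  have "\<delta> t0 \<in> adjoin K p" using t0 closed ker by (auto simp: ker_def)
  then obtain h0 where h0: "\<delta> t0 = eval_at emb p h0" using adjoin_range(2)[OF hom_on_emb] by auto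
  let ?good = "\<lambda>h. h \<noteq> 0 \<and> (\<exists>t\<in>A. \<delta> t = eval_at emb p h)"
  have "?good h0" using t0 h0 by auto
  then obtain h where h: "?good h" and h_min: "\<And>g. ?good g \<Longrightarrow> degree h \<le> degree g"
    using ex_has_least_nat[of ?good h0 degree] by blast
  obtain t where t: "t \<in> A" "\<delta> t = eval_at emb p h" using h by blast
  have "\<delta> t \<in> ker" unfolding t(2) ker adjoin_range(2)[OF hom_on_emb] by simp
  have nz: "\<delta> t \<noteq> 0"
  proof
    assume "\<delta> t = 0"
    then have "h = 0" using t(2) by (intro transcendental_over_K_inj[OF p(1)]) simp
    then show False using h by simp
  qed
  have noconst: "\<not> p - emb c dvd t - emb \<mu>" if hc: "poly h c = 0" for c \<mu>
  proof
    assume "p - emb c dvd t - emb \<mu>"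
    then obtain t' where t': "t - emb \<mu> = (p - emb c) * t'" by (elim dvdE)
    have embA: "emb a \<in> A" for a using A(1) by auto
    have pA: "p - emb c \<in> ker"
      unfolding ker using subset_adjoin[OF is_subring_K, of p]
      by (intro is_subringD(6) is_subring_adjoin is_subring_K mem_adjoin) auto
    have "t' \<in> A"
    proof (cases "(p - emb c) * t' = 0")
      case True
      then have "t - emb \<mu> = 0" using t' by (simp only:)
      then have "t = emb \<mu>" by simp
      then have "\<delta> t = 0" using lnd_kills_K[OF \<delta>(1) A(1)] by simp
      then show ?thesis using nz by simp
    next
      case False
      moreover have "(p - emb c) * t' \<in> A" unfolding t'[symmetric] by (intro A_closed t embA)
      ultimately show ?thesis using A(2) by blast
    qed
    have "\<delta> t = \<delta> (t - emb \<mu>)" using t(1) embA lnd_kills_K[OF \<delta>(1) A(1)] by (simp add: D_diff)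
    also have "\<dots> = (p - emb c) * \<delta> t'"
      using pA \<open>t' \<in> A\<close> by (simp add: t' leibniz ker_def)
    finally have dt: "\<delta> t = (p - emb c) * \<delta> t'" .
    obtain h' where h': "h = [:- c, 1:] * h'" using hc by (auto simp: poly_eq_0_iff_dvd elim: dvdE)
    have "eval_at emb p h = (p - emb c) * eval_at emb p h'" by (simp only: h' eval_at_emb_linear)
    then have "(p - emb c) * \<delta> t' = (p - emb c) * eval_at emb p h'"
      by (rule trans[OF trans[OF dt[symmetric] t(2)]])
    moreover have "p - emb c \<noteq> 0" using dt nz by auto
    ultimately have "\<delta> t' = eval_at emb p h'" using mult_left_cancel by blast
    moreover have h'0: "h' \<noteq> 0" using h h' by auto
    ultimately have "degree h \<le> degree h'" using h_min \<open>t' \<in> A\<close> by blast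
    moreover have "degree h = Suc (degree h')"
      using h'0 by (simp add: h' degree_mult_eq del: mult_pCons_left)
    ultimately show False by simp
  qed
  have "A \<subseteq> adjoin (adjoin K p) t"
  proof
    fix a assume "a \<in> A"
    have "\<delta> (\<delta> t) = 0" using \<open>\<delta> t \<in> ker\<close> by (simp add: ker_def)
    then obtain m q where q: "q \<in> polys_over ker" "\<delta> t ^ m * a = poly q t"
      using local_slice_generates[OF t(1) nz _ \<open>a \<in> A\<close>] by blast
    have "poly q t \<in> adjoin (adjoin K p) t"
      using q(1) unfolding ker adjoin_def[of "adjoin K p"] by (rule imageI)
    then have mem: "eval_at emb p (h ^ m) * a \<in> adjoin (adjoin K p) t"
      by (simp only: eval_at_emb_power t(2)[symmetric] q(2))
    show "a \<in> adjoin (adjoin K p) t"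
    proof (rule cancel_denominator[where g = "h ^ m" and h = h, OF p(1) prime _ _ _ mem])
      show "\<not> p - emb c dvd t - emb \<mu>" if "poly h c = 0" for c \<mu> by (rule noconst[OF that])
      show "h ^ m \<noteq> 0" using h by simp
      show "poly h c = 0" if "poly (h ^ m) c = 0" for c
        using that by (simp add: poly_power split: if_splits)
    qed
  qed
  moreover have "adjoin (adjoin K p) t \<subseteq> A"
  proof (rule adjoin_least[OF subring _ t(1)])
    show "adjoin K p \<subseteq> A" using ker_subset unfolding ker .
  qed
  ultimately have "A = adjoin (adjoin K p) t" by blast
  moreover have "transcendental_over (adjoin K p) t"
    using transcendental_over_ker[OF t(1) nz] by (simp add: ker)
  ultimately show thesis using that t(1) by blast
qed

text \<open>
  From the slice \<open>s\<close> with kernel \<open>A\<close>, the derivation \<open>\<delta>\<close> of \<open>A\<close> and its kernel \<open>C\<close>, one reads off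
  \<open>C = k[p]\<close>, \<open>A = C[t]\<close> and \<open>B = A[s]\<close>. The dimension excludes that two elements generate \<open>B\<close>, which rules
  out \<open>A = k\<close> and \<open>C = k\<close>, and that \<open>C\<close> contains two algebraically independent elements.
\<close>

theorem polynomial_generators_exist:
  assumes fg: "finitely_generated_algebra scale" and ufd: "is_UFD TYPE('b)"
    and dim: "krull_dim TYPE('b) = 3"
    and ml: "makar_limanov scale = K" and mls: "makar_limanov_star scale \<noteq> UNIV"
  obtains p t s where "transcendental_over K p" "transcendental_over (adjoin K p) t"
    "transcendental_over (adjoin (adjoin K p) t) s" "adjoin (adjoin (adjoin K p) t) s = UNIV"
proof -
  obtain xs where xs: "adjoin_list K xs = UNIV" using finitely_generated_adjoin_list[OF fg] .
  obtain D s where D: "D \<in> LND scale" "D s = 1"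
    using mls by (auto simp: makar_limanov_star_def LND_star_def)
  define A where "A = {a. D a = 0}"
  note A = slice_decomposition[OF LND_imp_lnd_subring[OF D(1)] D(2), folded A_def]
  have facA: "y \<in> A" if "x * y \<in> A" "x * y \<noteq> 0" for x y
    using A(5)[of x y] that by (simp add: A_def)
  have "\<exists>D'\<in>LND scale. \<exists>a\<in>A. D' a \<noteq> 0"
  proof (rule ccontr)
    assume "\<not> ?thesis"
    then have "A \<subseteq> makar_limanov scale" by (auto simp: makar_limanov_def)
    then have "A = K" using ml A(2) by simp
    \<comment> \<open>\<open>0\<close> is a redundant generator that brings \<open>k[s]\<close> into the form with two generators.\<close>
    then have "adjoin (adjoin K 0) s = UNIV"
      using A(3) adjoin_least[OF is_subring_K, of K 0] subset_adjoin[OF is_subring_K, of 0]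
        is_subringD(1)[OF is_subring_K] by auto
    then show False by (rule two_generators_contradict_dim_three[OF dim])
  qed
  then obtain D' a where "D' \<in> LND scale" "a \<in> A" "D' a \<noteq> 0" by blast
  then obtain \<delta> a0 where \<delta>: "lnd_subring A \<delta>" "a0 \<in> A" "\<delta> a0 \<noteq> 0"
    using kernel_of_slice_has_lnd[OF xs A(1-4)] LND_imp_lnd_subring by blast
  interpret lnd_subring A \<delta> by (rule \<delta>(1))
  obtain t0 where t0: "t0 \<in> A" "\<delta> t0 \<noteq> 0" "\<delta> (\<delta> t0) = 0" using local_slice_exists[OF \<delta>(2,3)] .
  have KC: "K \<subseteq> ker" using A(2) lnd_kills_K[OF \<delta>(1) A(2)] by (auto simp: ker_def)
  have "ker \<noteq> K"
  proof
    assume CK: "ker = K"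
    have "\<delta> t0 \<in> ker" using t0 closed by (simp add: ker_def)
    then obtain c where c: "\<delta> t0 = emb c" using CK by auto
    then have "c \<noteq> 0" using t0(2) by auto
    then have "A \<subseteq> adjoin K t0"
      using unit_local_slice_generates[OF t0(1) _ _ t0(3), of "emb (inverse c)"] emb_inverse[of c] c CK
      by auto
    moreover have "adjoin K t0 \<subseteq> A" by (intro adjoin_least A t0)
    ultimately have "adjoin (adjoin K t0) s = UNIV" using A(3) by simp
    then show False by (rule two_generators_contradict_dim_three[OF dim])
  qed
  then have "K \<subset> ker" using KC by blast
  moreover have "y \<in> ker" if "x * y \<in> ker" "x * y \<noteq> 0" for x y
    by (rule kernel_factorially_closed[OF \<delta>(1) _ that]) (rule facA)
  moreover have "\<not> transcendental_over (adjoin K c) q"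
    if "c \<in> ker" "transcendental_over K c" "q \<in> ker" for c q
    using tower_of_four_contradicts_dim_three[OF dim xs is_subring_ker A(1) KC ker_subset that(1,2,3) _
        t0(1) transcendental_over_ker[OF t0(1,2)] A(4)] by blast
  ultimately obtain p where p: "transcendental_over K p" "ker = adjoin K p"
    by (rule one_dimensional_UFD_is_polynomial_ring[OF ufd ml is_subring_ker])
  obtain t where "transcendental_over (adjoin K p) t" "A = adjoin (adjoin K p) t"
  proof (rule kernel_polynomial_ring_imp_polynomial_ring[OF ufd ml A(2) _ \<delta> p(1)])
    show "{a \<in> A. \<delta> a = 0} = adjoin K p" using p(2) by (simp add: ker_def)
  qed (use facA in blast)+
  then show thesis using that[OF p(1)] A(3,4) by simp
qed

end

section \<open>Polynomial algebras and partial derivatives\<close>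

text \<open>
  Identities between additive operations need to be checked on monomials only.
\<close>

lemma poly_mapping_additive_induct [case_names single add]:
  fixes P :: "'a \<Rightarrow>\<^sub>0 'c::comm_monoid_add"
  assumes single: "\<And>m c. Q (Poly_Mapping.single m c)" and add: "\<And>p q. Q p \<Longrightarrow> Q q \<Longrightarrow> Q (p + q)"
  shows "Q P"
proof -
  have "Q (\<Sum>m\<in>M. Poly_Mapping.single m (Poly_Mapping.lookup P m))" if "finite M" for M
    using that
  proof (induction M)
    case empty
    show ?case using single[of undefined 0] by simp
  next
    case (insert m M)
    then show ?case using add single by simp
  qed
  moreover have "(\<Sum>m\<in>Poly_Mapping.keys P. Poly_Mapping.single m (Poly_Mapping.lookup P m)) = P"
    by (rule poly_mapping_eqI) (auto simp: lookup_sum lookup_single when_def in_keys_iff)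
  ultimately show ?thesis using finite_keys[of P] by metis
qed

text \<open>
  For \<open>g\<close> additive in the coefficient this is the additive extension of \<open>g\<close> from monomials to
  polynomials. It serves for partial derivatives and for evaluation.
\<close>

definition sum_terms :: "('a \<Rightarrow> 'c::comm_monoid_add \<Rightarrow> 'd::comm_monoid_add) \<Rightarrow> ('a \<Rightarrow>\<^sub>0 'c) \<Rightarrow> 'd" where
  "sum_terms g P = (\<Sum>m\<in>Poly_Mapping.keys P. g m (Poly_Mapping.lookup P m))"

lemma sum_terms_superset:
  assumes "\<And>m. g m 0 = 0" "finite M" "Poly_Mapping.keys P \<subseteq> M"
  shows "sum_terms g P = (\<Sum>m\<in>M. g m (Poly_Mapping.lookup P m))"
  unfolding sum_terms_def
  by (rule sum.mono_neutral_left) (use assms in \<open>auto simp: in_keys_iff\<close>)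

lemma sum_terms_add:
  assumes "\<And>m. g m 0 = 0" "\<And>m a b. g m (a + b) = g m a + g m b"
  shows "sum_terms g (P + Q) = sum_terms g P + sum_terms g Q"
proof -
  let ?M = "Poly_Mapping.keys P \<union> Poly_Mapping.keys Q"
  have "finite ?M" "Poly_Mapping.keys (P + Q) \<subseteq> ?M" by (simp_all add: Poly_Mapping.keys_add)
  then show ?thesis
    using sum_terms_superset[of g ?M P] sum_terms_superset[of g ?M Q] sum_terms_superset[of g ?M "P + Q"] assms
    by (simp add: lookup_add sum.distrib)
qed

lemma sum_terms_single: "(\<And>m. g m 0 = 0) \<Longrightarrow> sum_terms g (Poly_Mapping.single m c) = g m c"
  by (simp add: sum_terms_def)

type_synonym ('n, 'k) mpoly = "('n \<Rightarrow>\<^sub>0 nat) \<Rightarrow>\<^sub>0 'k"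

text \<open>
  Subtraction of exponents truncates at zero; in this case the coefficient
  \<open>of_nat (lookup m i)\<close> is zero.
\<close>

definition partial :: "'n \<Rightarrow> ('n, 'k::comm_ring_1) mpoly \<Rightarrow> ('n, 'k) mpoly" where
  "partial i = sum_terms (\<lambda>m c.
     Poly_Mapping.single (m - Poly_Mapping.single i 1) (of_nat (Poly_Mapping.lookup m i) * c))"

lemma partial_add: "partial i (P + Q) = partial i P + partial i Q"
  unfolding partial_def by (rule sum_terms_add) (simp_all add: single_add distrib_left)

lemma partial_single: "partial i (Poly_Mapping.single m c) =
    Poly_Mapping.single (m - Poly_Mapping.single i 1) (of_nat (Poly_Mapping.lookup m i) * c)"
  unfolding partial_def by (rule sum_terms_single) simp

lemma partial_mult: "partial i (P * Q) = P * partial i Q + partial i P * Q"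
proof (induction P rule: poly_mapping_additive_induct)
  case (add P P')
  then show ?case by (simp add: distrib_right distrib_left partial_add)
next
  case (single m a)
  show ?case
  proof (induction Q rule: poly_mapping_additive_induct)
    case (add Q Q')
    then show ?case by (simp add: distrib_right distrib_left partial_add)
  next
    case (single n b)
    let ?e = "Poly_Mapping.single i (1::nat)"
    have shift: "m + (n - ?e) = m + n - ?e" if "Poly_Mapping.lookup n i > 0" for m n
      using that by (intro poly_mapping_eqI) (auto simp: lookup_add lookup_minus lookup_single when_def)
    have 1: "Poly_Mapping.single (m + (n - ?e)) (a * (of_nat (Poly_Mapping.lookup n i) * b)) =
        Poly_Mapping.single (m + n - ?e) (a * (of_nat (Poly_Mapping.lookup n i) * b))"
      using shift[of n m] by (cases "Poly_Mapping.lookup n i = 0") simp_all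
    have 2: "Poly_Mapping.single (m - ?e + n) (of_nat (Poly_Mapping.lookup m i) * a * b) =
        Poly_Mapping.single (m + n - ?e) (of_nat (Poly_Mapping.lookup m i) * a * b)"
      using shift[of m n] by (cases "Poly_Mapping.lookup m i = 0") (simp_all add: add.commute)
    show ?case
      unfolding mult_single partial_single 1 2
      by (simp add: lookup_add algebra_simps flip: single_add)
  qed
qed

lemma partial_zero [simp]: "partial i 0 = 0"
  using partial_add[of i 0 0] by simp

lemma partial_nilpotent: "\<exists>n. (partial i ^^ n) P = 0"
proof (induction P rule: poly_mapping_additive_induct)
  case (single m c)
  have "(partial i ^^ n) (Poly_Mapping.single m c) = 0" if "Poly_Mapping.lookup m i < n" for n
    using that
  proof (induction n arbitrary: m c)
    case (Suc n)
    have zero: "(partial i ^^ n) 0 = 0" by (induction n) simp_all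
    show ?case
    proof (cases "Poly_Mapping.lookup m i = 0")
      case True
      then show ?thesis using zero by (simp add: funpow_Suc_right partial_single del: funpow.simps)
    next
      case False
      then have "Poly_Mapping.lookup (m - Poly_Mapping.single i 1) i < n"
        using Suc.prems by (simp add: lookup_minus)
      then show ?thesis using Suc.IH by (simp add: funpow_Suc_right partial_single del: funpow.simps)
    qed
  qed simp
  then show ?case by blast
next
  case (add P Q)
  then obtain k l where kl: "(partial i ^^ k) P = 0" "(partial i ^^ l) Q = 0" by blast
  have zero: "(partial i ^^ n) 0 = 0" for n by (induction n) simp_all
  have sum: "(partial i ^^ n) (P + Q) = (partial i ^^ n) P + (partial i ^^ n) Q" for n
    by (induction n) (simp_all add: partial_add)
  have "(partial i ^^ (l + k)) P = 0" "(partial i ^^ (k + l)) Q = 0"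
    using kl zero by (simp_all only: funpow_add comp_apply)
  then have "(partial i ^^ (k + l)) (P + Q) = 0" by (simp add: sum add.commute)
  then show ?case by blast
qed

text \<open>
  Distinct monomials divisible by the variable \<open>i\<close> have distinct derivatives, so no cancellation
  occurs.
\<close>

lemma lookup_partial:
  fixes P :: "('n, 'k::comm_ring_1) mpoly"
  assumes "Poly_Mapping.lookup m i > 0"
  shows "Poly_Mapping.lookup (partial i P) (m - Poly_Mapping.single i 1) =
    of_nat (Poly_Mapping.lookup m i) * Poly_Mapping.lookup P m"
proof (induction P rule: poly_mapping_additive_induct)
  case (single n c)
  show ?case
  proof (cases "Poly_Mapping.lookup n i = 0")
    case True
    then show ?thesis using assms by (auto simp: partial_single lookup_single when_def)
  next
    case False
    have "n - Poly_Mapping.single i 1 = m - Poly_Mapping.single i 1 \<longleftrightarrow> n = m"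
    proof
      assume eq: "n - Poly_Mapping.single i 1 = m - Poly_Mapping.single i 1"
      show "n = m"
      proof (rule poly_mapping_eqI)
        fix j
        show "Poly_Mapping.lookup n j = Poly_Mapping.lookup m j"
          using arg_cong[OF eq, of "\<lambda>p. Poly_Mapping.lookup p j"] False assms
          by (auto simp: lookup_minus lookup_single when_def split: if_splits)
      qed
    qed simp
    then show ?thesis by (auto simp: partial_single lookup_single when_def)
  qed
next
  case (add P Q)
  then show ?case by (simp add: partial_add lookup_add distrib_left)
qed

lemma partials_zero_imp_constant:
  fixes P :: "('n, 'k::field_char_0) mpoly"
  assumes "\<And>i. partial i P = 0"
  shows "P = Poly_Mapping.single 0 (Poly_Mapping.lookup P 0)"
proof (rule poly_mapping_eqI)
  fix m
  show "Poly_Mapping.lookup P m = Poly_Mapping.lookup (Poly_Mapping.single 0 (Poly_Mapping.lookup P 0)) m"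
  proof (cases "m = 0")
    case False
    then obtain i where "Poly_Mapping.lookup m i > 0"
      by (metis gr0I lookup_zero poly_mapping_eqI)
    then have "Poly_Mapping.lookup P m = 0" using lookup_partial[of m i P] assms[of i] by simp
    then show ?thesis using False by (simp add: lookup_single)
  qed simp
qed

text \<open>
  Comparison of coefficients in the variable \<open>x\<close>, for sums whose terms are not sorted by exponent.
\<close>

lemma transcendental_sum_coefficients:
  assumes S: "is_subring S" and x: "transcendental_over S x" and M: "finite M"
    and g: "\<And>m. m \<in> M \<Longrightarrow> g m \<in> S" and sum: "(\<Sum>m\<in>M. g m * x ^ e m) = 0"
  shows "(\<Sum>m\<in>{m\<in>M. e m = n}. g m) = 0"
proof -
  define q where "q = (\<Sum>m\<in>M. monom (g m) (e m))"
  have "q \<in> polys_over S"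
    unfolding q_def using g is_subringD(1)[OF S] by (intro is_subring_sum is_subring_polys_over S) simp
  moreover have "poly q x = 0" using sum by (simp add: q_def poly_sum poly_monom)
  ultimately have "q = 0" by (rule transcendental_overD[OF x])
  then have "coeff q n = 0" by simp
  then have "(\<Sum>m\<in>M. coeff (monom (g m) (e m)) n) = 0" unfolding q_def coeff_sum .
  moreover have "(\<Sum>m\<in>{m\<in>M. e m = n}. g m) = (\<Sum>m\<in>M. coeff (monom (g m) (e m)) n)"
    using M by (intro sum.mono_neutral_cong_left) auto
  ultimately show ?thesis by simp
qed

lemma UNIV_3: "(UNIV :: 3 set) = {0, 1, 2}"
proof -
  have "card {0, 1, 2 :: 3} = CARD(3)" by simp
  then show ?thesis by (intro card_subset_eq[symmetric]) simp_all
qed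

context alg_closed_algebra
begin

text \<open>
  The partial derivatives have the variables as slices, and in characteristic zero only constants are
  killed by all of them.
\<close>

lemma polynomial_algebra_imp_ML_star:
  assumes "polynomial_algebra scale TYPE('n::finite)"
  shows "makar_limanov_star scale = K"
proof
  obtain f :: "('n, 'k) mpoly \<Rightarrow> 'b" where f: "algebra_iso mpoly_scale scale f"
    using assms by (auto simp: polynomial_algebra_def)
  then interpret lin: Vector_Spaces.linear mpoly_scale scale f by (simp add: algebra_iso_def)
  have f1: "f 1 = 1" and fm: "\<And>x y. f (x * y) = f x * f y" and bij: "bij f"
    using f by (auto simp: algebra_iso_def)
  define g where "g = inv_into UNIV f"
  have fg: "f (g b) = b" and gf: "g (f P) = P" for b P
    using bij by (simp_all add: g_def bij_is_surj surj_f_inv_f bij_is_inj)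
  have g_add: "g (x + y) = g x + g y" for x y using gf[of "g x + g y"] by (simp add: lin.add fg)
  have g_mult: "g (x * y) = g x * g y" for x y using gf[of "g x * g y"] by (simp add: fm fg)
  have g_scale: "g (scale c x) = mpoly_scale c (g x)" for c x
    using gf[of "mpoly_scale c (g x)"] by (simp add: lin.scale fg)
  have partial_scale: "partial i (mpoly_scale c P) = mpoly_scale c (partial i P)" for i c and P :: "('n, 'k) mpoly"
    by (simp add: mpoly_scale_def partial_mult partial_single)
  define D where "D i b = f (partial i (g b))" for i b
  have D: "D i \<in> LND scale" for i
  proof -
    have "Vector_Spaces.linear scale scale (D i)"
      by unfold_locales (simp_all add: D_def g_add g_scale partial_add partial_scale lin.add lin.scale)
    moreover have "D i (x * y) = x * D i y + D i x * y" for x y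
      unfolding D_def g_mult partial_mult lin.add fm fg ..
    moreover have "\<exists>m\<ge>1. (D i ^^ m) b = 0" for b
    proof -
      obtain n where n: "(partial i ^^ n) (g b) = 0" using partial_nilpotent[of i "g b"] by blast
      have iter: "(D i ^^ m) b = f ((partial i ^^ m) (g b))" for m
        by (induction m) (simp_all add: D_def gf fg)
      have "(D i ^^ Suc n) b = 0" unfolding iter by (simp add: n lin.zero)
      then show ?thesis by (intro exI[of _ "Suc n"]) simp
    qed
    ultimately show ?thesis by (simp add: LND_def derivation_def)
  qed
  have "D i (f (Poly_Mapping.single (Poly_Mapping.single i 1) 1)) = 1" for i
    by (simp add: D_def gf partial_single f1)
  then have star: "D i \<in> LND_star scale" for i using D by (auto simp: LND_star_def)
  show "makar_limanov_star scale \<subseteq> K"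
  proof
    fix b assume "b \<in> makar_limanov_star scale"
    then have "D i b = 0" for i using star by (auto simp: makar_limanov_star_def)
    then have "partial i (g b) = 0" for i using gf[of "partial i (g b)"] gf[of 0] by (simp add: D_def lin.zero)
    then have "g b = Poly_Mapping.single 0 (Poly_Mapping.lookup (g b) 0)"
      by (rule partials_zero_imp_constant)
    then have "b = f (mpoly_scale (Poly_Mapping.lookup (g b) 0) 1)"
      using fg[of b] by (simp add: mpoly_scale_def)
    also have "\<dots> = emb (Poly_Mapping.lookup (g b) 0)" by (simp add: lin.scale f1 emb_def)
    finally show "b \<in> K" by blast
  qed
  show "K \<subseteq> makar_limanov_star scale"
    using lnd_kills_K[OF LND_imp_lnd_subring] by (auto simp: makar_limanov_star_def LND_star_def)
qed

text \<open>
  Evaluation at \<open>(p, t, s)\<close>. For injectivity, coefficients are compared with respect to \<open>s\<close>, then \<open>t\<close>,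
  then \<open>p\<close>; fixing all three exponents leaves one monomial.
\<close>

lemma polynomial_generators_imp_polynomial_algebra:
  assumes p: "transcendental_over K p" and t: "transcendental_over (adjoin K p) t"
    and s: "transcendental_over (adjoin (adjoin K p) t) s"
    and gen: "adjoin (adjoin (adjoin K p) t) s = UNIV"
  shows "polynomial_algebra scale TYPE(3)"
proof -
  define mon :: "(3 \<Rightarrow>\<^sub>0 nat) \<Rightarrow> 'b" where
    "mon m = p ^ Poly_Mapping.lookup m 0 * t ^ Poly_Mapping.lookup m 1 * s ^ Poly_Mapping.lookup m 2" for m
  define f :: "(3, 'k) mpoly \<Rightarrow> 'b" where "f = sum_terms (\<lambda>m c. emb c * mon m)"
  have mon_add: "mon (m + n) = mon m * mon n" for m n
    by (simp add: mon_def lookup_add power_add mult_ac)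
  have f_add: "f (P + Q) = f P + f Q" for P Q
    unfolding f_def by (rule sum_terms_add) (simp_all add: distrib_right)
  have f_single: "f (Poly_Mapping.single m c) = emb c * mon m" for m c
    unfolding f_def by (rule sum_terms_single) simp
  have f_mult: "f (P * Q) = f P * f Q" for P Q
  proof (induction P rule: poly_mapping_additive_induct)
    case (add P P')
    then show ?case by (simp add: distrib_right f_add)
  next
    case (single m a)
    show ?case
    proof (induction Q rule: poly_mapping_additive_induct)
      case (add Q Q')
      then show ?case by (simp add: distrib_left f_add)
    next
      case (single n b)
      show ?case by (simp add: mult_single f_single mon_add mult_ac)
    qed
  qed
  have mon0: "mon 0 = 1" by (simp add: mon_def)
  have f_one: "f 1 = 1" using f_single[of 0 1] mon0 by simp
  have hom: "hom_on UNIV f" by (simp add: hom_on_def f_one f_add f_mult)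
  have f_scale: "f (mpoly_scale c P) = scale c (f P)" for c P
    by (simp add: mpoly_scale_def f_mult f_single mon0 scale_emb)
  have inj: "P = 0" if P: "f P = 0" for P
  proof (rule poly_mapping_eqI)
    fix n
    let ?c = "Poly_Mapping.lookup P" and ?M = "Poly_Mapping.keys P"
    let ?e = "\<lambda>m i. Poly_Mapping.lookup m (i :: 3)"
    note S1 = is_subring_adjoin[OF is_subring_K, of p]
    note S2 = is_subring_adjoin[OF S1, of t]
    have emb1: "emb a \<in> adjoin K p" for a using subset_adjoin[OF is_subring_K, of p] by auto
    have pp: "emb a * p ^ i \<in> adjoin K p" for a i
      by (intro is_subringD(5)[OF S1] emb1 is_subring_power[OF S1] mem_adjoin is_subring_K)
    have pt: "emb a * p ^ i * t ^ j \<in> adjoin (adjoin K p) t" for a i j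
      using is_subringD(5)[OF S2 subsetD[OF subset_adjoin[OF S1] pp]
          is_subring_power[OF S2 mem_adjoin[OF S1]]] .
    have "(\<Sum>m\<in>?M. (emb (?c m) * p ^ ?e m 0 * t ^ ?e m 1) * s ^ ?e m 2) = 0"
      using P by (simp add: f_def sum_terms_def mon_def mult.assoc)
    define M2 where "M2 = {m \<in> ?M. ?e m 2 = ?e n 2}"
    define M1 where "M1 = {m \<in> M2. ?e m 1 = ?e n 1}"
    have fin: "finite ?M" "finite M2" "finite M1" by (simp_all add: M2_def M1_def)
    have "(\<Sum>m\<in>M2. (emb (?c m) * p ^ ?e m 0) * t ^ ?e m 1) = 0"
      unfolding M2_def
      by (rule transcendental_sum_coefficients[OF S2 s fin(1) pt]) fact
    then have "(\<Sum>m\<in>M1. emb (?c m) * p ^ ?e m 0) = 0"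
      unfolding M1_def
      by (rule transcendental_sum_coefficients[OF S1 t fin(2) pp])
    then have sum: "(\<Sum>m\<in>{m \<in> M1. ?e m 0 = ?e n 0}. emb (?c m)) = 0"
      by (rule transcendental_sum_coefficients[OF is_subring_K p fin(3) rangeI])
    have "m = n" if "?e m 2 = ?e n 2" "?e m 1 = ?e n 1" "?e m 0 = ?e n 0" for m
    proof (rule poly_mapping_eqI)
      fix i :: 3
      have "i \<in> {0, 1, 2}" using UNIV_3 by blast
      then show "?e m i = ?e n i" using that by auto
    qed
    then have set: "{m \<in> M1. ?e m 0 = ?e n 0} = (if n \<in> ?M then {n} else {})"
      unfolding M1_def M2_def by auto
    show "?c n = Poly_Mapping.lookup 0 n"
      using sum unfolding set by (cases "n \<in> ?M") (simp_all add: in_keys_iff)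
  qed
  have "inj f"
  proof (rule injI)
    fix P Q assume "f P = f Q"
    then have "f (P - Q) = 0" using hom_on_diff[OF hom is_subring_UNIV, of P Q] by simp
    then show "P = Q" using inj[of "P - Q"] by simp
  qed
  moreover have "surj f"
  proof -
    note R = hom_on_image_subring[OF hom is_subring_UNIV]
    have var: "f (Poly_Mapping.single (Poly_Mapping.single 0 1) 1) = p"
      "f (Poly_Mapping.single (Poly_Mapping.single 1 1) 1) = t"
      "f (Poly_Mapping.single (Poly_Mapping.single 2 1) 1) = s"
      by (simp_all add: f_single mon_def lookup_single when_def)
    have vars: "p \<in> range f" "t \<in> range f" "s \<in> range f"
      using rangeI[of f "Poly_Mapping.single (Poly_Mapping.single 0 1) 1"]
        rangeI[of f "Poly_Mapping.single (Poly_Mapping.single 1 1) 1"]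
        rangeI[of f "Poly_Mapping.single (Poly_Mapping.single 2 1) 1"]
      unfolding var .
    have "emb c = f (Poly_Mapping.single 0 c)" for c by (simp add: f_single mon0)
    then have "K \<subseteq> range f" by blast
    then have "adjoin (adjoin (adjoin K p) t) s \<subseteq> range f"
      by (intro adjoin_least R vars)
    then show ?thesis using gen by blast
  qed
  ultimately have "bij f" by (simp add: bij_def)
  have "Vector_Spaces.linear mpoly_scale scale f"
  proof -
    interpret M: comm_algebra "mpoly_scale :: 'k \<Rightarrow> (3, 'k) mpoly \<Rightarrow> _" by (rule comm_algebra_mpoly_scale)
    show ?thesis by unfold_locales (simp_all add: f_add f_scale)
  qed
  then show ?thesis
    unfolding polynomial_algebra_def algebra_iso_def using f_one f_mult \<open>bij f\<close> by blast
qed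

end

section \<open>The characterization of affine three-space\<close>

theorem theorem4p6:
  fixes scale :: "'k::{alg_closed_field, field_char_0} \<Rightarrow> 'b::idom \<Rightarrow> 'b"
  assumes "affine_domain scale"
    and "is_UFD TYPE('b)"
    and "krull_dim TYPE('b) = 3"
  shows "(polynomial_algebra scale TYPE(3) \<longleftrightarrow> makar_limanov_star scale = scalars scale) \<and>
         (makar_limanov_star scale = scalars scale \<longleftrightarrow>
            makar_limanov scale = scalars scale \<and> makar_limanov_star scale \<noteq> UNIV)"
proof -
  have "comm_algebra scale" and fg: "finitely_generated_algebra scale"
    using assms(1) by (simp_all add: affine_domain_def)
  then interpret alg_closed_algebra scale by (intro alg_closed_algebra.intro)
  have I_II: "makar_limanov_star scale = K" if "polynomial_algebra scale TYPE(3)"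
    using that by (rule polynomial_algebra_imp_ML_star)
  have II_III: "makar_limanov scale = K \<and> makar_limanov_star scale \<noteq> UNIV"
    if star: "makar_limanov_star scale = K"
  proof
    have "makar_limanov scale \<subseteq> makar_limanov_star scale"
      by (auto simp: makar_limanov_def makar_limanov_star_def LND_star_def)
    moreover have "K \<subseteq> makar_limanov scale"
      using lnd_kills_K[OF LND_imp_lnd_subring] by (auto simp: makar_limanov_def)
    ultimately show "makar_limanov scale = K" using star by blast
    show "makar_limanov_star scale \<noteq> UNIV"
    proof
      assume "makar_limanov_star scale = UNIV"
      \<comment> \<open>Then \<open>B = k\<close>, an algebra with the two generators \<open>0\<close> and \<open>0\<close>.\<close>
      then have "adjoin (adjoin K 0) 0 = UNIV"
        using star subset_adjoin[OF is_subring_K, of 0]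
          subset_adjoin[OF is_subring_adjoin[OF is_subring_K, of 0], of 0] by auto
      then show False by (rule two_generators_contradict_dim_three[OF assms(3)])
    qed
  qed
  have III_I: "polynomial_algebra scale TYPE(3)"
    if ml: "makar_limanov scale = K" "makar_limanov_star scale \<noteq> UNIV"
    by (rule polynomial_generators_exist[OF fg assms(2,3) ml])
      (rule polynomial_generators_imp_polynomial_algebra)
  show ?thesis unfolding scalars_eq using I_II II_III III_I by blast
qed

end
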